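(* Let $\mathbb{M}$ be a monster model of a complete $C$-minimal expansion of ACVF whose language contains a constant symbol $t$ with $v(t)>0$, and suppose $\mathbb{M}$ is definably complete. Let $B\ni 0$ be a ball and $f:B\setminus\{0\}\to\mathbb{M}$ a definable function. Then $\lim_{x\to 0}f(x)$ exists in $\mathbb{M}\cup\{\infty\}$, where $\lim_{x\to0}f(x)=\infty$ means $\lim_{x\to 0}1/f(x)=0$.
   Context: ACVF is the theory of algebraically closed non-trivially valued fields; $C$-minimal means that in every model every definable subset of the home sort is a finite boolean combination of balls and points (balls: $\{x:v(x-a)>\gamma\}$ or $\{x:v(x-a)\ge\gamma\}$). "Definable" means with parameters; limits are taken in the valuation topology. $\mathbb{M}$ is definably complete if whenever $\{B_a\}_{a\in D}$ is a definable chain of balls whose radii approach $+\infty$, the intersection $\bigcap_{a\in D}B_a$ is non-empty. *)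

theory Defs
  imports "HOL-Analysis.Analysis" "HOL-Algebra.Algebraic_Closure"
begin

unbundle cardinal_syntax

section \<open>Many-sorted first-order logic\<close>

text \<open>
  The symbols of a language are all elements of the types \<open>'f\<close> (function symbols, the
  constants being those with empty domain) and \<open>'r\<close> (relation symbols); \<open>'s\<close> is the type of
  sorts.
\<close>

record ('s, 'f, 'r) lang =
  fdom :: "'f \<Rightarrow> 's list"
  fcod :: "'f \<Rightarrow> 's"
  rdom :: "'r \<Rightarrow> 's list"

text \<open>
  Variables are de Bruijn indices into a list (of sorts when typing, of values when
  evaluating); a quantifier pushes its variable to the front of that list.
\<close>

datatype 'f tm = TVar nat | TFun 'f "'f tm list"

datatype ('s, 'f, 'r) fm =
    FEq "'f tm" "'f tm"
  | FRel 'r "'f tm list"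
  | FNeg "('s, 'f, 'r) fm"
  | FConj "('s, 'f, 'r) fm" "('s, 'f, 'r) fm"
  | FEx 's "('s, 'f, 'r) fm"

inductive has_sort :: "('s, 'f, 'r, 'z) lang_scheme \<Rightarrow> 's list \<Rightarrow> 'f tm \<Rightarrow> 's \<Rightarrow> bool"
  for L ctx where
    "i < length ctx \<Longrightarrow> has_sort L ctx (TVar i) (ctx ! i)"
  | "list_all2 (has_sort L ctx) ts (fdom L g) \<Longrightarrow> has_sort L ctx (TFun g ts) (fcod L g)"

primrec wf_fm :: "('s, 'f, 'r, 'z) lang_scheme \<Rightarrow> 's list \<Rightarrow> ('s, 'f, 'r) fm \<Rightarrow> bool" where
  "wf_fm L ctx (FEq t u) \<longleftrightarrow> (\<exists>s. has_sort L ctx t s \<and> has_sort L ctx u s)"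
| "wf_fm L ctx (FRel r ts) \<longleftrightarrow> list_all2 (has_sort L ctx) ts (rdom L r)"
| "wf_fm L ctx (FNeg \<phi>) \<longleftrightarrow> wf_fm L ctx \<phi>"
| "wf_fm L ctx (FConj \<phi> \<psi>) \<longleftrightarrow> wf_fm L ctx \<phi> \<and> wf_fm L ctx \<psi>"
| "wf_fm L ctx (FEx s \<phi>) \<longleftrightarrow> wf_fm L (s # ctx) \<phi>"

abbreviation sentence :: "('s, 'f, 'r, 'z) lang_scheme \<Rightarrow> ('s, 'f, 'r) fm \<Rightarrow> bool" where
  "sentence L \<phi> \<equiv> wf_fm L [] \<phi>"

record ('s, 'f, 'r, 'a) struct =
  univ :: "'s \<Rightarrow> 'a set"
  fint :: "'f \<Rightarrow> 'a list \<Rightarrow> 'a"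
  rint :: "'r \<Rightarrow> 'a list \<Rightarrow> bool"

definition tuples :: "('s, 'f, 'r, 'a) struct \<Rightarrow> 's list \<Rightarrow> 'a list set" where
  "tuples M ss = {xs. list_all2 (\<lambda>x s. x \<in> univ M s) xs ss}"

definition is_struct :: "('s, 'f, 'r, 'z) lang_scheme \<Rightarrow> ('s, 'f, 'r, 'a) struct \<Rightarrow> bool" where
  "is_struct L M \<longleftrightarrow>
     (\<forall>s. univ M s \<noteq> {}) \<and>
     (\<forall>g. \<forall>xs \<in> tuples M (fdom L g). fint M g xs \<in> univ M (fcod L g))"

primrec tm_val :: "('s, 'f, 'r, 'a) struct \<Rightarrow> 'a list \<Rightarrow> 'f tm \<Rightarrow> 'a" where
  "tm_val M xs (TVar i) = xs ! i"
| "tm_val M xs (TFun g ts) = fint M g (map (tm_val M xs) ts)"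

primrec sat :: "('s, 'f, 'r, 'a) struct \<Rightarrow> 'a list \<Rightarrow> ('s, 'f, 'r) fm \<Rightarrow> bool" where
  "sat M xs (FEq t u) \<longleftrightarrow> tm_val M xs t = tm_val M xs u"
| "sat M xs (FRel r ts) \<longleftrightarrow> rint M r (map (tm_val M xs) ts)"
| "sat M xs (FNeg \<phi>) \<longleftrightarrow> \<not> sat M xs \<phi>"
| "sat M xs (FConj \<phi> \<psi>) \<longleftrightarrow> sat M xs \<phi> \<and> sat M xs \<psi>"
| "sat M xs (FEx s \<phi>) \<longleftrightarrow> (\<exists>x \<in> univ M s. sat M (x # xs) \<phi>)"

definition is_model ::
  "('s, 'f, 'r, 'z) lang_scheme \<Rightarrow> ('s, 'f, 'r, 'a) struct \<Rightarrow> ('s, 'f, 'r) fm set \<Rightarrow> bool" where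
  "is_model L M T \<longleftrightarrow> is_struct L M \<and> (\<forall>\<phi> \<in> T. sat M [] \<phi>)"

text \<open>
  A complete theory is identified with its deductive closure. Consistency is not part of this
  definition; it holds for every \<open>T\<close> that has a model.
\<close>

definition complete_theory ::
  "('s, 'f, 'r, 'z) lang_scheme \<Rightarrow> ('s, 'f, 'r) fm set \<Rightarrow> bool" where
  "complete_theory L T \<longleftrightarrow>
     (\<forall>\<phi> \<in> T. sentence L \<phi>) \<and> (\<forall>\<phi>. sentence L \<phi> \<longrightarrow> \<phi> \<in> T \<or> FNeg \<phi> \<in> T)"

text \<open>Definability with parameters (the tuple \<open>cs\<close>) of sets of tuples of sorts \<open>ss\<close>.\<close>

definition definable ::
  "('s, 'f, 'r, 'z) lang_scheme \<Rightarrow> ('s, 'f, 'r, 'a) struct \<Rightarrow> 's list \<Rightarrow> 'a list set \<Rightarrow> bool" where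
  "definable L M ss S \<longleftrightarrow>
     (\<exists>\<phi> ps. \<exists>cs \<in> tuples M ps. wf_fm L (ss @ ps) \<phi> \<and>
        S = {xs \<in> tuples M ss. sat M (xs @ cs) \<phi>})"


section \<open>Monster models\<close>

text \<open>
  A small set of parameters is a family \<open>A s\<close> of subsets of the sorts whose disjoint union
  \<open>Sigma UNIV A\<close> has fewer than \<open>\<kappa>\<close> elements.
\<close>

definition tuples_in :: "('s \<Rightarrow> 'a set) \<Rightarrow> 's list \<Rightarrow> 'a list set" where
  "tuples_in A ss = {xs. list_all2 (\<lambda>x s. x \<in> A s) xs ss}"

definition small_params ::
  "('s, 'f, 'r, 'a) struct \<Rightarrow> 'k rel \<Rightarrow> ('s \<Rightarrow> 'a set) \<Rightarrow> bool" where
  "small_params M \<kappa> A \<longleftrightarrow> (\<forall>s. A s \<subseteq> univ M s) \<and> |Sigma UNIV A| <o \<kappa>"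

text \<open>
  An element \<open>(\<phi>, ps, cs)\<close> of \<open>p\<close> below is the formula \<open>\<phi>(x, cs)\<close> in one variable \<open>x\<close> of sort
  \<open>s\<close> with parameters \<open>cs\<close> of sorts \<open>ps\<close>.
\<close>

definition saturated ::
  "('s, 'f, 'r, 'z) lang_scheme \<Rightarrow> 'k rel \<Rightarrow> ('s, 'f, 'r, 'a) struct \<Rightarrow> bool" where
  "saturated L \<kappa> M \<longleftrightarrow>
     (\<forall>A s p.
        small_params M \<kappa> A \<longrightarrow>
        p \<subseteq> {(\<phi>, ps, cs). wf_fm L (s # ps) \<phi> \<and> cs \<in> tuples_in A ps} \<longrightarrow>
        (\<forall>q \<subseteq> p. finite q \<longrightarrow> (\<exists>x \<in> univ M s. \<forall>(\<phi>, ps, cs) \<in> q. sat M (x # cs) \<phi>)) \<longrightarrow>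
        (\<exists>x \<in> univ M s. \<forall>(\<phi>, ps, cs) \<in> p. sat M (x # cs) \<phi>))"

definition automorphism ::
  "('s, 'f, 'r, 'z) lang_scheme \<Rightarrow> ('s, 'f, 'r, 'a) struct \<Rightarrow> ('s \<Rightarrow> 'a \<Rightarrow> 'a) \<Rightarrow> bool" where
  "automorphism L M \<sigma> \<longleftrightarrow>
     (\<forall>s. bij_betw (\<sigma> s) (univ M s) (univ M s)) \<and>
     (\<forall>g. \<forall>xs \<in> tuples M (fdom L g).
        \<sigma> (fcod L g) (fint M g xs) = fint M g (map2 \<sigma> (fdom L g) xs)) \<and>
     (\<forall>r. \<forall>xs \<in> tuples M (rdom L r).
        rint M r xs \<longleftrightarrow> rint M r (map2 \<sigma> (rdom L r) xs))"

definition elementary_map ::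
  "('s, 'f, 'r, 'z) lang_scheme \<Rightarrow> ('s, 'f, 'r, 'a) struct \<Rightarrow> ('s \<Rightarrow> 'a set) \<Rightarrow>
   ('s \<Rightarrow> 'a \<Rightarrow> 'a) \<Rightarrow> bool" where
  "elementary_map L M A h \<longleftrightarrow>
     (\<forall>s. h s ` A s \<subseteq> univ M s) \<and>
     (\<forall>\<phi> ps. \<forall>cs \<in> tuples_in A ps.
        wf_fm L ps \<phi> \<longrightarrow> (sat M cs \<phi> \<longleftrightarrow> sat M (map2 h ps cs) \<phi>))"

definition strongly_homogeneous ::
  "('s, 'f, 'r, 'z) lang_scheme \<Rightarrow> 'k rel \<Rightarrow> ('s, 'f, 'r, 'a) struct \<Rightarrow> bool" where
  "strongly_homogeneous L \<kappa> M \<longleftrightarrow>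
     (\<forall>A h. small_params M \<kappa> A \<longrightarrow> elementary_map L M A h \<longrightarrow>
        (\<exists>\<sigma>. automorphism L M \<sigma> \<and> (\<forall>s. \<forall>x \<in> A s. \<sigma> s x = h s x)))"

text \<open>
  The only largeness imposed on \<open>\<kappa>\<close> is that it is uncountable and exceeds the number of
  symbols and sorts of the language.
\<close>

definition monster_model ::
  "('s, 'f, 'r, 'z) lang_scheme \<Rightarrow> 'k rel \<Rightarrow> ('s, 'f, 'r) fm set \<Rightarrow>
   ('s, 'f, 'r, 'a) struct \<Rightarrow> bool" where
  "monster_model L \<kappa> T M \<longleftrightarrow>
     Card_order \<kappa> \<and> natLeq <o \<kappa> \<and>
     |UNIV :: 's set| <o \<kappa> \<and> |UNIV :: 'f set| <o \<kappa> \<and> |UNIV :: 'r set| <o \<kappa> \<and>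
     is_model L M T \<and> saturated L \<kappa> M \<and> strongly_homogeneous L \<kappa> M"


section \<open>Expansions of algebraically closed valued fields\<close>

text \<open>
  The language of valued fields is \<open>{0, 1, +, \<cdot>, |}\<close> on the home sort, where \<open>x | y\<close> means
  \<open>v(x) \<le> v(y)\<close>. An expansion may have arbitrary further symbols and arbitrary further sorts.
\<close>

record ('s, 'f, 'r) vf_lang = "('s, 'f, 'r) lang" +
  home :: 's
  zero_sym :: 'f
  one_sym :: 'f
  add_sym :: 'f
  mult_sym :: 'f
  div_sym :: 'r

definition is_vf_lang :: "('s, 'f, 'r) vf_lang \<Rightarrow> bool" where
  "is_vf_lang L \<longleftrightarrow>
     fdom L (zero_sym L) = [] \<and> fcod L (zero_sym L) = home L \<and>
     fdom L (one_sym L) = [] \<and> fcod L (one_sym L) = home L \<and>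
     fdom L (add_sym L) = [home L, home L] \<and> fcod L (add_sym L) = home L \<and>
     fdom L (mult_sym L) = [home L, home L] \<and> fcod L (mult_sym L) = home L \<and>
     rdom L (div_sym L) = [home L, home L]"

definition home_ring :: "('s, 'f, 'r) vf_lang \<Rightarrow> ('s, 'f, 'r, 'a) struct \<Rightarrow> 'a ring" where
  "home_ring L M =
     \<lparr>carrier = univ M (home L),
      mult = (\<lambda>x y. fint M (mult_sym L) [x, y]),
      one = fint M (one_sym L) [],
      zero = fint M (zero_sym L) [],
      add = (\<lambda>x y. fint M (add_sym L) [x, y])\<rparr>"

definition vdiv :: "('s, 'f, 'r) vf_lang \<Rightarrow> ('s, 'f, 'r, 'a) struct \<Rightarrow> 'a \<Rightarrow> 'a \<Rightarrow> bool" where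
  "vdiv L M x y \<longleftrightarrow> rint M (div_sym L) [x, y]"

text \<open>
  The value group with \<open>\<infinity>\<close> is the quotient of the home sort by \<open>x | y | x\<close>; thus \<open>v(x)\<close> is the
  class of \<open>x\<close>, and \<open>v(0)\<close> is \<open>\<infinity>\<close>. The zero element of the value group is \<open>v(1)\<close>.
\<close>

definition val :: "('s, 'f, 'r) vf_lang \<Rightarrow> ('s, 'f, 'r, 'a) struct \<Rightarrow> 'a \<Rightarrow> 'a set" where
  "val L M x = {y \<in> univ M (home L). vdiv L M x y \<and> vdiv L M y x}"

definition value_group :: "('s, 'f, 'r) vf_lang \<Rightarrow> ('s, 'f, 'r, 'a) struct \<Rightarrow> 'a set set" where
  "value_group L M = val L M ` (univ M (home L) - {\<zero>\<^bsub>home_ring L M\<^esub>})"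

definition val_le ::
  "('s, 'f, 'r) vf_lang \<Rightarrow> ('s, 'f, 'r, 'a) struct \<Rightarrow> 'a set \<Rightarrow> 'a set \<Rightarrow> bool" where
  "val_le L M \<gamma> \<delta> \<longleftrightarrow> (\<exists>x \<in> \<gamma>. \<exists>y \<in> \<delta>. vdiv L M x y)"

definition val_less ::
  "('s, 'f, 'r) vf_lang \<Rightarrow> ('s, 'f, 'r, 'a) struct \<Rightarrow> 'a set \<Rightarrow> 'a set \<Rightarrow> bool" where
  "val_less L M \<gamma> \<delta> \<longleftrightarrow> val_le L M \<gamma> \<delta> \<and> \<gamma> \<noteq> \<delta>"

text \<open>
  The third and fourth conditions are \<open>v(x) \<le> v(y) \<Longrightarrow> v(x z) \<le> v(y z)\<close> and
  \<open>v(x + y) \<ge> min (v(x)) (v(y))\<close>; the fifth says that \<open>v(x) = \<infinity>\<close> only for \<open>x = 0\<close>; the last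
  one is non-triviality.
\<close>

definition acvf :: "('s, 'f, 'r) vf_lang \<Rightarrow> ('s, 'f, 'r, 'a) struct \<Rightarrow> bool" where
  "acvf L M \<longleftrightarrow>
     (let R = home_ring L M; K = carrier R in
        algebraically_closed R \<and>
        (\<forall>x \<in> K. \<forall>y \<in> K. vdiv L M x y \<or> vdiv L M y x) \<and>
        (\<forall>x \<in> K. \<forall>y \<in> K. \<forall>z \<in> K. vdiv L M x y \<and> vdiv L M y z \<longrightarrow> vdiv L M x z) \<and>
        (\<forall>x \<in> K. \<forall>y \<in> K. \<forall>z \<in> K. vdiv L M x y \<longrightarrow> vdiv L M (x \<otimes>\<^bsub>R\<^esub> z) (y \<otimes>\<^bsub>R\<^esub> z)) \<and>
        (\<forall>x \<in> K. \<forall>y \<in> K. vdiv L M x y \<longrightarrow> vdiv L M x (x \<oplus>\<^bsub>R\<^esub> y)) \<and>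
        (\<forall>x \<in> K. vdiv L M \<zero>\<^bsub>R\<^esub> x \<longrightarrow> x = \<zero>\<^bsub>R\<^esub>) \<and>
        (\<exists>x \<in> K. x \<noteq> \<zero>\<^bsub>R\<^esub> \<and> val L M x \<noteq> val L M \<one>\<^bsub>R\<^esub>))"

definition open_ball ::
  "('s, 'f, 'r) vf_lang \<Rightarrow> ('s, 'f, 'r, 'a) struct \<Rightarrow> 'a \<Rightarrow> 'a set \<Rightarrow> 'a set" where
  "open_ball L M a \<gamma> =
     {x \<in> univ M (home L). val_less L M \<gamma> (val L M (x \<ominus>\<^bsub>home_ring L M\<^esub> a))}"

definition closed_ball ::
  "('s, 'f, 'r) vf_lang \<Rightarrow> ('s, 'f, 'r, 'a) struct \<Rightarrow> 'a \<Rightarrow> 'a set \<Rightarrow> 'a set" where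
  "closed_ball L M a \<gamma> =
     {x \<in> univ M (home L). val_le L M \<gamma> (val L M (x \<ominus>\<^bsub>home_ring L M\<^esub> a))}"

definition ball_of_radius ::
  "('s, 'f, 'r) vf_lang \<Rightarrow> ('s, 'f, 'r, 'a) struct \<Rightarrow> 'a set \<Rightarrow> 'a set \<Rightarrow> bool" where
  "ball_of_radius L M B \<gamma> \<longleftrightarrow>
     \<gamma> \<in> value_group L M \<and>
     (\<exists>a \<in> univ M (home L). B = open_ball L M a \<gamma> \<or> B = closed_ball L M a \<gamma>)"

definition is_ball ::
  "('s, 'f, 'r) vf_lang \<Rightarrow> ('s, 'f, 'r, 'a) struct \<Rightarrow> 'a set \<Rightarrow> bool" where
  "is_ball L M B \<longleftrightarrow> (\<exists>\<gamma>. ball_of_radius L M B \<gamma>)"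

inductive_set bool_combs :: "'a set \<Rightarrow> 'a set set \<Rightarrow> 'a set set" for U G where
  base: "S \<in> G \<Longrightarrow> S \<in> bool_combs U G"
| compl: "S \<in> bool_combs U G \<Longrightarrow> U - S \<in> bool_combs U G"
| union: "S \<in> bool_combs U G \<Longrightarrow> S' \<in> bool_combs U G \<Longrightarrow> S \<union> S' \<in> bool_combs U G"

text \<open>
  The condition that \<open>C\<close>-minimality of a theory imposes on each of its models. In HOL, ``every
  model'' has to mean every structure over one fixed type. If that type is infinite and has at
  least as many elements as there are symbols and sorts, nothing is lost: a failure in some
  model passes to a small elementary substructure, which has a copy over that type. The type of
  a monster model is always large enough.
\<close>

definition c_minimal_model ::
  "('s, 'f, 'r) vf_lang \<Rightarrow> ('s, 'f, 'r, 'a) struct \<Rightarrow> bool" where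
  "c_minimal_model L M \<longleftrightarrow>
     (\<forall>S. definable L M [home L] ((\<lambda>x. [x]) ` S) \<longrightarrow>
        S \<in> bool_combs (univ M (home L))
              ({B. is_ball L M B} \<union> {{a} | a. a \<in> univ M (home L)}))"

text \<open>
  The index set \<open>D\<close> is a definable set of tuples of arbitrary sorts. Index sets in imaginary
  sorts give nothing new, as such a family can be pulled back along the quotient map.
\<close>

definition definably_complete ::
  "('s, 'f, 'r) vf_lang \<Rightarrow> ('s, 'f, 'r, 'a) struct \<Rightarrow> bool" where
  "definably_complete L M \<longleftrightarrow>
     (\<forall>ss D (\<B> :: 'a list \<Rightarrow> 'a set).
        definable L M ss D \<longrightarrow>
        definable L M (home L # ss) {x # a | x a. a \<in> D \<and> x \<in> \<B> a} \<longrightarrow>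
        (\<forall>a \<in> D. is_ball L M (\<B> a)) \<longrightarrow>
        (\<forall>a \<in> D. \<forall>b \<in> D. \<B> a \<subseteq> \<B> b \<or> \<B> b \<subseteq> \<B> a) \<longrightarrow>
        (\<forall>\<gamma> \<in> value_group L M. \<exists>a \<in> D. \<exists>\<delta>.
           ball_of_radius L M (\<B> a) \<delta> \<and> val_less L M \<gamma> \<delta>) \<longrightarrow>
        (\<Inter>a \<in> D. \<B> a) \<noteq> {})"

definition val_topology ::
  "('s, 'f, 'r) vf_lang \<Rightarrow> ('s, 'f, 'r, 'a) struct \<Rightarrow> 'a topology" where
  "val_topology L M =
     topology_generated_by
       {open_ball L M a \<gamma> | a \<gamma>. a \<in> univ M (home L) \<and> \<gamma> \<in> value_group L M}"

definition definable_function ::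
  "('s, 'f, 'r) vf_lang \<Rightarrow> ('s, 'f, 'r, 'a) struct \<Rightarrow> 'a set \<Rightarrow> ('a \<Rightarrow> 'a) \<Rightarrow> bool" where
  "definable_function L M S f \<longleftrightarrow>
     S \<subseteq> univ M (home L) \<and> f ` S \<subseteq> univ M (home L) \<and>
     definable L M [home L, home L] {[x, f x] | x. x \<in> S}"

definition has_limit_at_zero ::
  "('s, 'f, 'r) vf_lang \<Rightarrow> ('s, 'f, 'r, 'a) struct \<Rightarrow> 'a set \<Rightarrow> ('a \<Rightarrow> 'a) \<Rightarrow> 'a \<Rightarrow> bool" where
  "has_limit_at_zero L M S f l \<longleftrightarrow>
     limitin (val_topology L M) f l (atin_within (val_topology L M) \<zero>\<^bsub>home_ring L M\<^esub> S)"

text \<open>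
  Since the library inverse of zero is unspecified, that \<open>1 / f\<close> is defined near zero is
  required explicitly.
\<close>

definition has_limit_infinity_at_zero ::
  "('s, 'f, 'r) vf_lang \<Rightarrow> ('s, 'f, 'r, 'a) struct \<Rightarrow> 'a set \<Rightarrow> ('a \<Rightarrow> 'a) \<Rightarrow> bool" where
  "has_limit_infinity_at_zero L M S f \<longleftrightarrow>
     eventually (\<lambda>x. f x \<noteq> \<zero>\<^bsub>home_ring L M\<^esub>)
       (atin_within (val_topology L M) \<zero>\<^bsub>home_ring L M\<^esub> S) \<and>
     has_limit_at_zero L M S (\<lambda>x. inv\<^bsub>home_ring L M\<^esub> (f x)) \<zero>\<^bsub>home_ring L M\<^esub>"

end

theory Submission
  imports Defs
begin

text \<open>
  By \<open>C\<close>-minimality, every definable property holds either throughout or nowhere on some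
  punctured neighbourhood of \<open>0\<close>; so the balls that eventually contain \<open>f(x)\<close> form a definable
  chain. If there are none, the limit is \<open>\<infinity>\<close>; if their radii are unbounded, definable
  completeness gives the limit. Otherwise the radii have a supremum \<open>s\<close>, and a contradiction is
  needed.

  Orthogonality of residue field and value group rules out that \<open>f(x)\<close> tends to the generic point
  of a closed ball of radius \<open>s\<close>; after possibly passing to \<open>1 / (f - b)\<close> and rescaling,
  \<open>v(f(x) - f(y))\<close> has for \<open>y \<rightarrow> 0\<close> an eventual value \<open>c(x)\<close>, which tends to \<open>0\<close> strictly from
  below as \<open>x \<rightarrow> 0\<close>. The leading term \<open>\<phi>(x)\<close> of \<open>f(x) - f(y)\<close> is also eventually constant in
  \<open>y\<close>. For each unit \<open>u\<close> the residue of \<open>\<phi>(u x) / \<phi>(x)\<close> is eventually a constant \<open>\<chi>(u)\<close>, and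
  this cancels in \<open>\<psi>(x) = \<phi>(t x) / \<phi>(x)\<close>. Hence \<open>\<psi>(x)\<close> depends only on \<open>v(x)\<close>, while \<open>v(\<psi>(x))\<close>
  is non-zero, tends to \<open>0\<close>, and is an eventually injective function of \<open>v(x)\<close>. The union of the
  classes \<open>\<psi>(x)\<close> then meets each annulus near \<open>v = 0\<close> in at most one class of leading terms,
  contradicting \<open>C\<close>-minimality.
\<close>

section \<open>Definable predicates on the home sort\<close>

text \<open>Neither the value group nor the residue field is a sort here. A map on values is a
  relation \<open>r x d\<close> that does not change when \<open>x\<close> is multiplied by a unit,
  and a leading term is a class described by a relation such as \<open>Phi x z\<close>; no definable
  choice of representatives is assumed, so the argument works with relations throughout.

  \<open>C\<close>-minimality enters in one way: a finite boolean combination of balls and points is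
  decided along certain directed families of sets. Three families occur: punctured balls about 0,
  annuli closing in on a cut of the value group, and the valuation ring without finitely many
  residue classes. The second yields suprema, the third strong minimality of the residue field.

  The main obstacle is uniformity: a statement proved for each unit \<open>u\<close> and all small
  \<open>x\<close>, with a bound depending on \<open>u\<close>, is needed for all units at once.
  Orthogonality is what moves the quantifier over residue classes inside "eventually". The other
  obstacle is that \<open>\<phi>(x)\<close> may behave like \<open>c x^n\<close>, whose class
  depends on the residue of \<open>x\<close> and not only on its value; the quotient of
  \<open>\<phi>\<close> at \<open>t x\<close> and \<open>x\<close> removes this dependence.\<close>

primrec tm_rename :: "(nat \<Rightarrow> nat) \<Rightarrow> 'f tm \<Rightarrow> 'f tm" where
  "tm_rename \<rho> (TVar i) = TVar (\<rho> i)"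
| "tm_rename \<rho> (TFun g ts) = TFun g (map (tm_rename \<rho>) ts)"

primrec lift_ren :: "(nat \<Rightarrow> nat) \<Rightarrow> nat \<Rightarrow> nat" where
  "lift_ren \<rho> 0 = 0"
| "lift_ren \<rho> (Suc i) = Suc (\<rho> i)"

primrec fm_rename :: "(nat \<Rightarrow> nat) \<Rightarrow> ('s, 'f, 'r) fm \<Rightarrow> ('s, 'f, 'r) fm" where
  "fm_rename \<rho> (FEq t u) = FEq (tm_rename \<rho> t) (tm_rename \<rho> u)"
| "fm_rename \<rho> (FRel r ts) = FRel r (map (tm_rename \<rho>) ts)"
| "fm_rename \<rho> (FNeg \<phi>) = FNeg (fm_rename \<rho> \<phi>)"
| "fm_rename \<rho> (FConj \<phi> \<psi>) = FConj (fm_rename \<rho> \<phi>) (fm_rename \<rho> \<psi>)"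
| "fm_rename \<rho> (FEx s \<phi>) = FEx s (fm_rename (lift_ren \<rho>) \<phi>)"

text \<open>The element type is left open so that one condition serves both contexts of sorts
  (\<open>wf_fm_rename\<close>) and tuples of values (\<open>sat_rename\<close>).\<close>

definition ren_ok :: "(nat \<Rightarrow> nat) \<Rightarrow> 'b list \<Rightarrow> 'b list \<Rightarrow> bool" where
  "ren_ok \<rho> xs ys \<longleftrightarrow> (\<forall>i < length xs. \<rho> i < length ys \<and> ys ! \<rho> i = xs ! i)"

lemma ren_ok_lift: "ren_ok \<rho> xs ys ==> ren_ok (lift_ren \<rho>) (x # xs) (x # ys)"
  unfolding ren_ok_def by (auto simp: less_Suc_eq_0_disj)

lemma has_sort_rename:
  assumes "has_sort L ctx t s" "ren_ok \<rho> ctx ctx'"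
  shows "has_sort L ctx' (tm_rename \<rho> t) s"
  using assms
proof (induction rule: has_sort.induct)
  case (1 i)
  then show ?case using has_sort.intros(1)[of "\<rho> i" ctx' L] by (auto simp: ren_ok_def)
next
  case (2 ts g)
  then show ?case by (auto simp: list_all2_conv_all_nth intro!: has_sort.intros(2))
qed

lemma wf_fm_rename:
  "wf_fm L ctx \<phi> ==> ren_ok \<rho> ctx ctx' ==> wf_fm L ctx' (fm_rename \<rho> \<phi>)"
proof (induction \<phi> arbitrary: ctx ctx' \<rho>)
  case (FEx s \<phi>)
  then show ?case using ren_ok_lift[of \<rho> ctx ctx' s] by simp
next
  case (FEq t u)
  then show ?case using has_sort_rename by (metis fm_rename.simps(1) wf_fm.simps(1))
next
  case (FRel r ts)
  then show ?case using has_sort_rename[of L ctx _ _ \<rho> ctx'] by (simp add: list_all2_conv_all_nth)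
next
  case (FNeg \<phi>)
  then show ?case by simp
next
  case (FConj \<phi> \<psi>)
  then show ?case unfolding wf_fm.simps fm_rename.simps by blast
qed

lemma tm_val_rename:
  assumes "has_sort L ctx t s" "ren_ok \<rho> xs ys" "length xs = length ctx"
  shows "tm_val M ys (tm_rename \<rho> t) = tm_val M xs t"
  using assms
proof (induction rule: has_sort.induct)
  case (1 i)
  then show ?case by (auto simp: ren_ok_def)
next
  case (2 ts g)
  then have "map (\<lambda>t. tm_val M ys (tm_rename \<rho> t)) ts = map (tm_val M xs) ts"
    unfolding list_all2_conv_all_nth by (intro nth_equalityI) auto
  then show ?case by (simp add: comp_def del: map_eq_conv)
qed

lemma sat_rename:
  "wf_fm L ctx \<phi> ==> ren_ok \<rho> xs ys ==> length xs = length ctx ==>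
   sat M ys (fm_rename \<rho> \<phi>) \<longleftrightarrow> sat M xs \<phi>"
proof (induction \<phi> arbitrary: ctx xs ys \<rho>)
  case (FEq t u)
  then obtain s where "has_sort L ctx t s" "has_sort L ctx u s" by auto
  then show ?case using FEq.prems tm_val_rename[of L ctx _ _ \<rho> xs ys M] by simp
next
  case (FRel r ts)
  have "map (\<lambda>t. tm_val M ys (tm_rename \<rho> t)) ts = map (tm_val M xs) ts"
    using FRel.prems tm_val_rename[of L ctx _ _ \<rho> xs ys M]
    by (intro nth_equalityI) (auto simp: list_all2_conv_all_nth)
  then show ?case by (simp add: comp_def del: map_eq_conv)
next
  case (FEx s \<phi>)
  have "sat M (x # ys) (fm_rename (lift_ren \<rho>) \<phi>) = sat M (x # xs) \<phi>" for x
    using FEx.prems by (intro FEx.IH[of "s # ctx"]) (auto simp: ren_ok_lift)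
  then show ?case by simp
next
  case (FNeg \<phi>)
  then have "wf_fm L ctx \<phi>" by simp
  then show ?case using FNeg.IH[OF _ FNeg.prems(2,3)] by simp
next
  case (FConj \<phi>1 \<phi>2)
  then have "wf_fm L ctx \<phi>1" "wf_fm L ctx \<phi>2" by simp_all
  then show ?case using FConj.IH[OF _ FConj.prems(2,3)] by simp
qed

section \<open>Closure properties of definable predicates on home-sort tuples\<close>

abbreviation ntuples :: "'a set \<Rightarrow> nat \<Rightarrow> 'a list set" where
  "ntuples K n \<equiv> {xs. length xs = n \<and> set xs \<subseteq> K}"

text \<open>All variables have the home sort, while the parameters hidden in
  \<open>definable\<close> may come from any sort.\<close>

definition dp_of :: "('s, 'f, 'r) vf_lang \<Rightarrow> ('s, 'f, 'r, 'a) struct \<Rightarrow> nat \<Rightarrow> ('a list \<Rightarrow> bool) \<Rightarrow> bool" where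
  "dp_of L M n P \<longleftrightarrow> definable L M (replicate n (home L)) {xs \<in> ntuples (univ M (home L)) n. P xs}"

lemma tuples_replicate: "tuples M (replicate n s) = ntuples (univ M s) n"
proof -
  have "list_all2 (\<lambda>x s. x \<in> univ M s) xs (replicate n s) \<longleftrightarrow> length xs = n \<and> (\<forall>x \<in> set xs. x \<in> univ M s)" for xs
    by (auto simp: list_all2_conv_all_nth all_set_conv_all_nth)
  then show ?thesis by (auto simp: tuples_def)
qed

lemma dp_of_iff:
  "dp_of L M n P \<longleftrightarrow> (\<exists>\<phi> ps. \<exists>cs \<in> tuples M ps. wf_fm L (replicate n (home L) @ ps) \<phi> \<and>
     (\<forall>xs \<in> ntuples (univ M (home L)) n. P xs \<longleftrightarrow> sat M (xs @ cs) \<phi>))"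
proof -
  have "({xs \<in> ntuples (univ M (home L)) n. P xs} = {xs \<in> ntuples (univ M (home L)) n. sat M (xs @ cs) \<phi>})
    \<longleftrightarrow> (\<forall>xs \<in> ntuples (univ M (home L)) n. P xs \<longleftrightarrow> sat M (xs @ cs) \<phi>)" for cs \<phi>
    by auto
  then show ?thesis unfolding dp_of_def definable_def tuples_replicate by simp
qed

lemma tuples_length: "cs \<in> tuples M ps ==> length cs = length ps"
  by (auto simp: tuples_def dest: list_all2_lengthD)

lemma dp_of_cong:
  "(!!xs. length xs = n ==> set xs \<subseteq> univ M (home L) ==> P xs = Q xs) ==>
   dp_of L M n P = dp_of L M n Q"
  unfolding dp_of_iff by simp

lemma dp_of_not: "dp_of L M n P ==> dp_of L M n (\<lambda>xs. ~ P xs)"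
  unfolding dp_of_iff
proof (elim exE bexE conjE)
  fix \<phi> ps cs
  assume "cs \<in> tuples M ps" "wf_fm L (replicate n (home L) @ ps) \<phi>"
    "\<forall>xs \<in> ntuples (univ M (home L)) n. P xs \<longleftrightarrow> sat M (xs @ cs) \<phi>"
  then show "\<exists>\<phi> ps. \<exists>cs \<in> tuples M ps. wf_fm L (replicate n (home L) @ ps) \<phi> \<and>
     (\<forall>xs \<in> ntuples (univ M (home L)) n. (~ P xs) \<longleftrightarrow> sat M (xs @ cs) \<phi>)"
    by (intro exI[of _ "FNeg \<phi>"] exI[of _ ps] bexI[of _ cs]) auto
qed

lemma dp_of_conj:
  assumes "dp_of L M n P" "dp_of L M n Q"
  shows "dp_of L M n (\<lambda>xs. P xs \<and> Q xs)"
proof -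
  from assms obtain \<phi> ps cs \<psi> qs ds where
    1: "cs \<in> tuples M ps" "wf_fm L (replicate n (home L) @ ps) \<phi>"
     "!!xs. xs \<in> ntuples (univ M (home L)) n ==> P xs \<longleftrightarrow> sat M (xs @ cs) \<phi>" and
    2: "ds \<in> tuples M qs" "wf_fm L (replicate n (home L) @ qs) \<psi>"
     "!!xs. xs \<in> ntuples (univ M (home L)) n ==> Q xs \<longleftrightarrow> sat M (xs @ ds) \<psi>"
    unfolding dp_of_iff by blast
  \<comment> \<open>The two formulas bring their own parameters. Those of \<open>\<phi>\<close> keep
    their positions, those of \<open>\<psi>\<close> are shifted past \<open>cs\<close>.\<close>
  define \<rho> where "\<rho> i = (if i < n then i else i + length ps)" for i
  have a: "ren_ok id (replicate n (home L) @ ps) (replicate n (home L) @ ps @ qs)"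
    by (auto simp: ren_ok_def nth_append)
  have b: "ren_ok \<rho> (replicate n (home L) @ qs) (replicate n (home L) @ ps @ qs)"
    by (auto simp: ren_ok_def nth_append \<rho>_def)
  have c: "ren_ok id (xs @ cs) (xs @ cs @ ds)" for xs
    by (auto simp: ren_ok_def nth_append)
  have d: "ren_ok \<rho> (xs @ ds) (xs @ cs @ ds)" if "length xs = n" for xs
    using that tuples_length[OF 1(1)] by (auto simp: ren_ok_def nth_append \<rho>_def)
  have e: "cs @ ds \<in> tuples M (ps @ qs)"
    using 1(1) 2(1) by (auto simp: tuples_def list_all2_appendI)
  show ?thesis unfolding dp_of_iff
  proof (intro exI bexI conjI ballI)
    show "cs @ ds \<in> tuples M (ps @ qs)" by (rule e)
    show "wf_fm L (replicate n (home L) @ ps @ qs) (FConj (fm_rename id \<phi>) (fm_rename \<rho> \<psi>))"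
      using wf_fm_rename[OF 1(2) a] wf_fm_rename[OF 2(2) b] by simp
    fix xs assume xs: "xs \<in> ntuples (univ M (home L)) n"
    then show "(P xs \<and> Q xs) = sat M (xs @ cs @ ds) (FConj (fm_rename id \<phi>) (fm_rename \<rho> \<psi>))"
      using 1(3) 2(3) sat_rename[OF 1(2) c] sat_rename[OF 2(2) d] tuples_length[OF 1(1)]
        tuples_length[OF 2(1)] by simp
  qed
qed

lemma dp_of_ex:
  assumes "dp_of L M (Suc n) (\<lambda>ys. Q (hd ys) (tl ys))"
  shows "dp_of L M n (\<lambda>xs. \<exists>y \<in> univ M (home L). Q y xs)"
proof -
  from assms obtain \<phi> ps cs where
    1: "cs \<in> tuples M ps" "wf_fm L (replicate (Suc n) (home L) @ ps) \<phi>"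
     "!!xs. xs \<in> ntuples (univ M (home L)) (Suc n) ==> Q (hd xs) (tl xs) \<longleftrightarrow> sat M (xs @ cs) \<phi>"
    unfolding dp_of_iff by blast
  show ?thesis unfolding dp_of_iff
  proof (intro exI bexI conjI ballI)
    show "cs \<in> tuples M ps" by fact
    show "wf_fm L (replicate n (home L) @ ps) (FEx (home L) \<phi>)" using 1 by simp
    fix xs assume "xs \<in> ntuples (univ M (home L)) n"
    then show "(\<exists>y\<in>univ M (home L). Q y xs) = sat M (xs @ cs) (FEx (home L) \<phi>)"
      using 1(3)[of "_ # xs"] by simp
  qed
qed

lemma dp_of_rename:
  assumes "dp_of L M m P" "length is = m" "!!i. i \<in> set is ==> i < n"
  shows "dp_of L M n (\<lambda>xs. P (map ((!) xs) is))"
proof -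
  from assms obtain \<phi> ps cs where
    1: "cs \<in> tuples M ps" "wf_fm L (replicate m (home L) @ ps) \<phi>"
     "!!xs. xs \<in> ntuples (univ M (home L)) m ==> P xs \<longleftrightarrow> sat M (xs @ cs) \<phi>"
    unfolding dp_of_iff by blast
  define \<rho> where "\<rho> i = (if i < m then is ! i else i - m + n)" for i
  have a: "ren_ok \<rho> (replicate m (home L) @ ps) (replicate n (home L) @ ps)"
    using assms(2) assms(3)[OF nth_mem] by (auto simp: ren_ok_def nth_append \<rho>_def trans_less_add1)
  have b: "ren_ok \<rho> (map ((!) xs) is @ cs) (xs @ cs)" if "length xs = n" for xs
    using assms(2) assms(3)[OF nth_mem] that by (auto simp: ren_ok_def nth_append \<rho>_def trans_less_add1)
  show ?thesis unfolding dp_of_iff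
  proof (intro exI bexI conjI ballI)
    show "cs \<in> tuples M ps" by fact
    show "wf_fm L (replicate n (home L) @ ps) (fm_rename \<rho> \<phi>)" by (rule wf_fm_rename[OF 1(2) a])
    fix xs assume xs: "xs \<in> ntuples (univ M (home L)) n"
    then have "map ((!) xs) is \<in> ntuples (univ M (home L)) m"
      using assms by (force simp: in_set_conv_nth)
    with xs show "P (map ((!) xs) is) = sat M (xs @ cs) (fm_rename \<rho> \<phi>)"
      using 1(3) sat_rename[OF 1(2) b] tuples_length[OF 1(1)] assms(2) by simp
  qed
qed

text \<open>Carries the front entry past the next \<open>n\<close> ones. The first variable thus
  becomes the first parameter, which is how \<open>dp_of_param\<close> specialises a variable to an
  element.\<close>

definition ren_rotate :: "nat \<Rightarrow> nat \<Rightarrow> nat" where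
  "ren_rotate n i = (case i of 0 \<Rightarrow> n | Suc j \<Rightarrow> if j < n then j else Suc j)"

lemma ren_ok_rotate:
  assumes "length xs = n"
  shows "ren_ok (ren_rotate n) (x # xs @ ys) (xs @ x # ys)"
  unfolding ren_ok_def
proof (intro allI impI)
  fix i assume "i < length (x # xs @ ys)"
  with assms show "ren_rotate n i < length (xs @ x # ys) \<and> (xs @ x # ys) ! ren_rotate n i = (x # xs @ ys) ! i"
    by (cases i) (auto simp: ren_rotate_def nth_append nth_Cons' Suc_diff_Suc)
qed

lemma dp_of_param:
  assumes "dp_of L M (Suc n) P" "a \<in> univ M (home L)"
  shows "dp_of L M n (\<lambda>xs. P (a # xs))"
proof -
  from assms obtain \<phi> ps cs where
    1: "cs \<in> tuples M ps" "wf_fm L (replicate (Suc n) (home L) @ ps) \<phi>"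
     "!!xs. xs \<in> ntuples (univ M (home L)) (Suc n) ==> P xs \<longleftrightarrow> sat M (xs @ cs) \<phi>"
    unfolding dp_of_iff by blast
  define \<rho> where "\<rho> = ren_rotate n"
  have a: "ren_ok \<rho> (replicate (Suc n) (home L) @ ps) (replicate n (home L) @ home L # ps)"
    using ren_ok_rotate[of "replicate n (home L)" n] unfolding \<rho>_def by simp
  show ?thesis unfolding dp_of_iff
  proof (intro exI bexI conjI ballI)
    show "a # cs \<in> tuples M (home L # ps)" using 1 assms by (simp add: tuples_def)
    show "wf_fm L (replicate n (home L) @ home L # ps) (fm_rename \<rho> \<phi>)"
      by (rule wf_fm_rename[OF 1(2) a])
    fix xs assume xs: "xs \<in> ntuples (univ M (home L)) n"
    then show "P (a # xs) = sat M (xs @ a # cs) (fm_rename \<rho> \<phi>)"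
      using 1(3)[of "a # xs"] sat_rename[OF 1(2), of \<rho> "a # xs @ cs" "xs @ a # cs"] ren_ok_rotate[of xs n a cs] tuples_length[OF 1(1)] assms(2) by (simp add: \<rho>_def)
  qed
qed

lemma has_sort_home: "i < n ==> has_sort L (replicate n (home L)) (TVar i) (home L)"
  using has_sort.intros(1)[of i "replicate n (home L)" L] by simp

lemma dp_of_atoms:
  assumes "is_vf_lang L"
  shows "dp_of L M 2 (\<lambda>xs. vdiv L M (xs ! 0) (xs ! 1))"
    and "dp_of L M 2 (\<lambda>xs. xs ! 0 = xs ! 1)"
    and "dp_of L M 3 (\<lambda>xs. xs ! 0 = fint M (add_sym L) [xs ! 1, xs ! 2])"
    and "dp_of L M 3 (\<lambda>xs. xs ! 0 = fint M (mult_sym L) [xs ! 1, xs ! 2])"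
proof -
  have *: "dp_of L M n P" if "wf_fm L (replicate n (home L)) \<phi>"
    "!!xs. length xs = n ==> P xs \<longleftrightarrow> sat M xs \<phi>" for n P \<phi>
    unfolding dp_of_iff using that
    by (intro exI[of _ \<phi>] exI[of _ "[]"] bexI[of _ "[]"]) (auto simp: tuples_def)
  show "dp_of L M 2 (\<lambda>xs. vdiv L M (xs ! 0) (xs ! 1))"
    using assms by (intro *[of _ "FRel (div_sym L) [TVar 0, TVar 1]"])
      (auto simp: is_vf_lang_def vdiv_def has_sort_home)
  show "dp_of L M 2 (\<lambda>xs. xs ! 0 = xs ! 1)"
    by (intro *[of _ "FEq (TVar 0) (TVar 1)"]) (auto intro!: exI[of _ "home L"] simp: has_sort_home)
  have "has_sort L (replicate 3 (home L)) (TFun g [TVar 1, TVar 2]) (home L)"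
    if "g = add_sym L \<or> g = mult_sym L" for g
    using has_sort.intros(2)[of L "replicate 3 (home L)" "[TVar 1, TVar 2]" g] that assms
    by (auto simp: is_vf_lang_def has_sort_home)
  then have **: "wf_fm L (replicate 3 (home L)) (FEq (TVar 0) (TFun g [TVar 1, TVar 2]))"
    if "g = add_sym L \<or> g = mult_sym L" for g
    using that has_sort_home[of 0 3 L] by fastforce
  show "dp_of L M 3 (\<lambda>xs. xs ! 0 = fint M (add_sym L) [xs ! 1, xs ! 2])"
    by (rule *[OF **[of "add_sym L"]]) simp_all
  show "dp_of L M 3 (\<lambda>xs. xs ! 0 = fint M (mult_sym L) [xs ! 1, xs ! 2])"
    by (rule *[OF **[of "mult_sym L"]]) simp_all
qed

section \<open>Valued fields\<close>

text \<open>A value is represented by any element that has it, so no type of values is needed. The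
  order \<open>\<le>v\<close> compares valuations; hence \<open>\<zero>\<close>, of value
  \<infinity>, is the largest element and small elements are large for
  \<open>\<le>v\<close>.\<close>

locale valued_field = field R for R (structure) +
  fixes le :: "'a \<Rightarrow> 'a \<Rightarrow> bool"  (infix \<open>\<le>v\<close> 50)
  assumes le_total: "x \<in> carrier R ==> y \<in> carrier R ==> x \<le>v y \<or> y \<le>v x"
    and le_trans: "x \<in> carrier R ==> y \<in> carrier R ==> z \<in> carrier R ==> x \<le>v y ==> y \<le>v z ==> x \<le>v z"
    and le_mult: "x \<in> carrier R ==> y \<in> carrier R ==> z \<in> carrier R ==> x \<le>v y ==> x \<otimes> z \<le>v y \<otimes> z"
    and le_add_self: "x \<in> carrier R ==> y \<in> carrier R ==> x \<le>v y ==> x \<le>v x \<oplus> y"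
    and zero_le: "x \<in> carrier R ==> \<zero> \<le>v x ==> x = \<zero>"
    and nontrivial: "\<exists>x \<in> carrier R. x ~= \<zero> \<and> ~ (x \<le>v \<one> \<and> \<one> \<le>v x)"
    and alg_closed: "algebraically_closed R"
begin

text \<open>By totality the negation is the strict order on \<open>K\<close>. It forces the
  left-hand side to be nonzero, since \<open>\<zero>\<close> is on top; this is used silently many
  times.\<close>

abbreviation lt :: "'a \<Rightarrow> 'a \<Rightarrow> bool"  (infix \<open><v\<close> 50) where "x <v y \<equiv> ~ y \<le>v x"

abbreviation "K \<equiv> carrier R"

lemma le_refl [simp]: "x \<in> K ==> x \<le>v x"
  using le_total by blast

lemma lt_imp_le: "x <v y ==> x \<in> K ==> y \<in> K ==> x \<le>v y"
  using le_total by blast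

lemma lt_trans: "x <v y ==> y <v z ==> x \<in> K ==> y \<in> K ==> z \<in> K ==> x <v z"
  using le_total le_trans by blast

lemma lt_le_trans: "x <v y ==> y \<le>v z ==> x \<in> K ==> y \<in> K ==> z \<in> K ==> x <v z"
  using le_trans by blast

lemma le_lt_trans: "x \<le>v y ==> y <v z ==> x \<in> K ==> y \<in> K ==> z \<in> K ==> x <v z"
  using le_trans by blast

lemma le_zero [simp]: "x \<in> K ==> x \<le>v \<zero>"
  using le_total[of x \<zero>] zero_le by force

lemma zero_le_iff [simp]: "x \<in> K ==> \<zero> \<le>v x \<longleftrightarrow> x = \<zero>"
  using zero_le by auto

lemma inv_closed [simp, intro]: "x \<in> K ==> x ~= \<zero> ==> inv x \<in> K"
  by (simp add: field_Units)

lemma inv_cancel [simp]: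
  assumes "x \<in> K" "x ~= \<zero>"
  shows "inv x \<otimes> x = \<one>" "x \<otimes> inv x = \<one>" "inv x ~= \<zero>"
    and "y \<in> K ==> y \<otimes> inv x \<otimes> x = y" "y \<in> K ==> y \<otimes> x \<otimes> inv x = y"
    and "y \<in> K ==> x \<otimes> (inv x \<otimes> y) = y" "y \<in> K ==> inv x \<otimes> (x \<otimes> y) = y"
proof -
  show 1: "inv x \<otimes> x = \<one>" "x \<otimes> inv x = \<one>" using assms by (simp_all add: field_Units)
  then show "inv x ~= \<zero>" using assms by (metis r_null zero_not_one)
  show "y \<in> K ==> y \<otimes> inv x \<otimes> x = y" "y \<in> K ==> y \<otimes> x \<otimes> inv x = y" 
    using 1 assms by (simp_all add: m_assoc)
  show "y \<in> K ==> x \<otimes> (inv x \<otimes> y) = y" "y \<in> K ==> inv x \<otimes> (x \<otimes> y) = y"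
    using 1 assms by (simp_all add: m_assoc[symmetric])
qed

lemma mult_zero_iff [simp]: "x \<in> K ==> y \<in> K ==> x \<otimes> y = \<zero> \<longleftrightarrow> x = \<zero> \<or> y = \<zero>"
  by (auto simp: integral_iff)

lemma mult_le_iff [simp]:
  assumes "x \<in> K" "y \<in> K" "z \<in> K" "z ~= \<zero>"
  shows "x \<otimes> z \<le>v y \<otimes> z \<longleftrightarrow> x \<le>v y" "z \<otimes> x \<le>v z \<otimes> y \<longleftrightarrow> x \<le>v y"
proof -
  show "x \<otimes> z \<le>v y \<otimes> z \<longleftrightarrow> x \<le>v y"
    using le_mult[of x y z] le_mult[of "x \<otimes> z" "y \<otimes> z" "inv z"] assms by auto
  then show "z \<otimes> x \<le>v z \<otimes> y \<longleftrightarrow> x \<le>v y" using assms by (simp add: m_comm)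
qed

text \<open>The square of \<open>\<ominus> \<one>\<close> is \<open>\<one>\<close>, so in a totally
  ordered value group its value must be 0.\<close>

lemma neg_le:
  assumes "x \<in> K"
  shows "\<ominus> x \<le>v x \<and> x \<le>v \<ominus> x"
proof -
  have mm: "(\<ominus> \<one>) \<otimes> (\<ominus> \<one>) = \<one>" by (simp add: l_minus)
  have "\<ominus> \<one> \<le>v \<one> \<and> \<one> \<le>v \<ominus> \<one>"
    using le_total[of \<one> "\<ominus> \<one>"] le_mult[of \<one> "\<ominus> \<one>" "\<ominus> \<one>"] le_mult[of "\<ominus> \<one>" \<one> "\<ominus> \<one>"] mm by auto
  then show ?thesis
    using le_mult[of "\<ominus> \<one>" \<one> x] le_mult[of \<one> "\<ominus> \<one>" x] assms by (simp add: l_minus)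
qed

lemma neg_le_iff [simp]:
  assumes "x \<in> K" "y \<in> K"
  shows "\<ominus> x \<le>v y \<longleftrightarrow> x \<le>v y" "x \<le>v \<ominus> y \<longleftrightarrow> x \<le>v y"
proof -
  show "\<ominus> x \<le>v y \<longleftrightarrow> x \<le>v y"
    using neg_le[of x] le_trans[of x "\<ominus> x" y] le_trans[of "\<ominus> x" x y] assms by auto
  show "x \<le>v \<ominus> y \<longleftrightarrow> x \<le>v y"
    using neg_le[of y] le_trans[of x "\<ominus> y" y] le_trans[of x y "\<ominus> y"] assms by auto
qed

lemma le_add:
  assumes "z \<le>v x" "z \<le>v y" "x \<in> K" "y \<in> K" "z \<in> K"
  shows "z \<le>v x \<oplus> y"
  using le_total[of x y] le_add_self[of x y] le_add_self[of y x] assms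
    le_trans[of z x "x \<oplus> y"] le_trans[of z y "x \<oplus> y"] by (auto simp: a_comm)

lemma lt_add:
  assumes "z <v x" "z <v y" "x \<in> K" "y \<in> K" "z \<in> K"
  shows "z <v x \<oplus> y"
  using le_total[of x y] le_add_self[of x y] le_add_self[of y x] assms
    le_trans[of x "x \<oplus> y" z] le_trans[of y "x \<oplus> y" z] by (auto simp: a_comm)

lemma minus_swap:
  assumes "x \<in> K" "y \<in> K"
  shows "x \<ominus> y = \<ominus> (y \<ominus> x)"
  using assms by (simp add: a_minus_def minus_add a_comm)

lemma diff_sym:
  assumes "x \<in> K" "y \<in> K" "g \<in> K"
  shows "g \<le>v x \<ominus> y \<longleftrightarrow> g \<le>v y \<ominus> x" "x \<ominus> y \<le>v g \<longleftrightarrow> y \<ominus> x \<le>v g"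
  using assms minus_swap[of x y] by simp_all

lemma diff_trans_eq:
  assumes "x \<in> K" "y \<in> K" "z \<in> K"
  shows "x \<ominus> z = (x \<ominus> y) \<oplus> (y \<ominus> z)"
  using assms by (simp add: a_minus_def a_assoc r_neg1)

lemma le_diff_trans:
  assumes "g \<le>v x \<ominus> y" "g \<le>v y \<ominus> z" "x \<in> K" "y \<in> K" "z \<in> K" "g \<in> K"
  shows "g \<le>v x \<ominus> z"
  using le_add[OF assms(1,2)] assms diff_trans_eq[of x y z] by simp

lemma lt_diff_trans:
  assumes "g <v x \<ominus> y" "g <v y \<ominus> z" "x \<in> K" "y \<in> K" "z \<in> K" "g \<in> K"
  shows "g <v x \<ominus> z"
  using lt_add[OF assms(1,2)] assms diff_trans_eq[of x y z] by simp

lemma le_diff: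
  assumes "g \<le>v x" "g \<le>v y" "x \<in> K" "y \<in> K" "g \<in> K"
  shows "g \<le>v x \<ominus> y"
  using le_add[of g x "\<ominus> y"] assms by (simp add: a_minus_def)

lemma lt_diff:
  assumes "g <v x" "g <v y" "x \<in> K" "y \<in> K" "g \<in> K"
  shows "g <v x \<ominus> y"
  using lt_add[of x g "\<ominus> y"] assms by (simp add: a_minus_def)

lemma diff_cancel:
  assumes "x \<in> K" "y \<in> K"
  shows "x \<ominus> (x \<ominus> y) = y" "y \<oplus> (x \<ominus> y) = x" "(x \<ominus> y) \<oplus> y = x"
  using assms by (simp_all add: a_minus_def minus_add a_assoc a_lcomm r_neg l_neg r_neg2)

definition eqv :: "'a \<Rightarrow> 'a \<Rightarrow> bool"  (infix \<open>=v\<close> 50) where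
  "x =v y \<longleftrightarrow> x \<le>v y \<and> y \<le>v x"

lemma eqv_refl [simp]: "x \<in> K ==> x =v x"
  by (simp add: eqv_def)

lemma eqv_sym: "x =v y \<longleftrightarrow> y =v x"
  by (auto simp: eqv_def)

lemma eqv_trans: "x =v y ==> y =v z ==> x \<in> K ==> y \<in> K ==> z \<in> K ==> x =v z"
  unfolding eqv_def using le_trans by blast

lemma eqv_le:
  assumes "x =v y" "x \<in> K" "y \<in> K" "z \<in> K"
  shows "x \<le>v z \<longleftrightarrow> y \<le>v z" "z \<le>v x \<longleftrightarrow> z \<le>v y"
  using assms le_trans unfolding eqv_def by blast+

lemma eqv_zero_iff: "x =v y ==> x \<in> K ==> y \<in> K ==> x = \<zero> \<longleftrightarrow> y = \<zero>"
  unfolding eqv_def by (metis zero_le)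

lemma eqv_mult_iff [simp]:
  assumes "x \<in> K" "y \<in> K" "z \<in> K" "z ~= \<zero>"
  shows "x \<otimes> z =v y \<otimes> z \<longleftrightarrow> x =v y" "z \<otimes> x =v z \<otimes> y \<longleftrightarrow> x =v y"
  using assms by (simp_all add: eqv_def)

text \<open>Equality of leading terms, i.e. of the classes modulo \<open>1 + m\<close>; false if \<open>x = 0\<close>.\<close>

definition rveq :: "'a \<Rightarrow> 'a \<Rightarrow> bool"  (infix \<open>\<sim>v\<close> 50) where
  "x \<sim>v y \<longleftrightarrow> x <v x \<ominus> y"

lemma diff_self [simp]: "x \<in> K ==> x \<ominus> x = \<zero>"
  by (simp add: r_right_minus_eq)

lemma diff_zero [simp]: "x \<in> K ==> x \<ominus> \<zero> = x"
  by (simp add: a_minus_def)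

lemma rveq_eqv:
  assumes "x \<sim>v y" "x \<in> K" "y \<in> K"
  shows "x =v y"
proof -
  have 1: "x <v x \<ominus> y" using assms(1) by (simp add: rveq_def)
  have "x \<ominus> (x \<ominus> y) = y" "y \<oplus> (x \<ominus> y) = x" using assms(2,3) diff_cancel by simp_all
  moreover have "x \<le>v x \<ominus> (x \<ominus> y)"
    using le_diff[of x x "x \<ominus> y"] lt_imp_le[OF 1] assms by simp
  ultimately have 2: "x \<le>v y" by metis
  moreover have "y \<le>v x"
  proof (rule ccontr)
    \<comment> \<open>Both summands of \<open>x = y \<oplus> (x \<ominus> y)\<close> would then have
      value above that of \<open>x\<close>.\<close>
    assume "x <v y"
    then have "x <v y \<oplus> (x \<ominus> y)" using 1 assms by (intro lt_add) auto
    then show False using \<open>y \<oplus> (x \<ominus> y) = x\<close> assms by simp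
  qed
  ultimately show ?thesis by (simp add: eqv_def)
qed

lemma rveq_nonzero:
  assumes "x \<sim>v y" "x \<in> K" "y \<in> K" shows "x ~= \<zero>" "y ~= \<zero>"
proof -
  show "x ~= \<zero>" using assms by (auto simp: rveq_def)
  then show "y ~= \<zero>" using eqv_zero_iff[OF rveq_eqv[OF assms]] assms by simp
qed

lemma rveq_refl: "x \<in> K ==> x ~= \<zero> ==> x \<sim>v x"
  by (simp add: rveq_def)

lemma rveq_sym:
  assumes "x \<sim>v y" "x \<in> K" "y \<in> K" shows "y \<sim>v x"
  using assms rveq_eqv[OF assms] eqv_le(2)[of x y "x \<ominus> y"] diff_sym(2)[of x y y]
  unfolding rveq_def by simp

lemma rveq_trans:
  assumes "x \<sim>v y" "y \<sim>v z" "x \<in> K" "y \<in> K" "z \<in> K" shows "x \<sim>v z"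
proof -
  have "x <v y \<ominus> z"
    using eqv_le(2)[OF rveq_eqv[OF assms(1,3,4)] assms(3,4), of "y \<ominus> z"] assms unfolding rveq_def by simp
  then show ?thesis using assms lt_diff_trans[where g = x and x = x and y = y and z = z] unfolding rveq_def by simp
qed

lemma rveq_mult_iff:
  assumes "x \<in> K" "y \<in> K" "z \<in> K" "z ~= \<zero>"
  shows "z \<otimes> x \<sim>v z \<otimes> y \<longleftrightarrow> x \<sim>v y" "x \<otimes> z \<sim>v y \<otimes> z \<longleftrightarrow> x \<sim>v y"
proof -
  have "z \<otimes> x \<ominus> z \<otimes> y = z \<otimes> (x \<ominus> y)"
    using assms by (simp add: a_minus_def r_distr r_minus)
  then show "z \<otimes> x \<sim>v z \<otimes> y \<longleftrightarrow> x \<sim>v y" using assms by (simp add: rveq_def)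
  then show "x \<otimes> z \<sim>v y \<otimes> z \<longleftrightarrow> x \<sim>v y" using assms by (simp add: m_comm)
qed

lemma rveq_cong:
  assumes "x \<sim>v y" "x \<in> K" "y \<in> K" "z \<in> K"
  shows "x \<sim>v z \<longleftrightarrow> y \<sim>v z" "z \<sim>v x \<longleftrightarrow> z \<sim>v y"
  using assms rveq_sym rveq_trans by blast+

lemma rveqI: "g \<le>v x \<ominus> y ==> x <v g ==> x \<in> K ==> y \<in> K ==> g \<in> K ==> x \<sim>v y"
  unfolding rveq_def using le_trans by (meson minus_closed)

lemma dominate:
  assumes "x <v y" "x \<in> K" "y \<in> K"
  shows "x \<ominus> y =v x"
  using rveq_eqv[of x "x \<ominus> y"] diff_cancel(1)[of x y] assms by (auto simp: rveq_def eqv_sym)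

lemma inv_le_iff:
  assumes "x \<in> K" "x ~= \<zero>" "y \<in> K" "y ~= \<zero>"
  shows "inv x \<le>v inv y \<longleftrightarrow> y \<le>v x"
proof -
  have "inv x \<le>v inv y \<longleftrightarrow> inv x \<otimes> (x \<otimes> y) \<le>v inv y \<otimes> (x \<otimes> y)"
    by (rule mult_le_iff(1)[symmetric]) (use assms in auto)
  moreover have "inv y \<otimes> (x \<otimes> y) = x"
    using assms inv_cancel(7)[of y x] by (subst m_comm[of x y])
  moreover have "inv x \<otimes> (x \<otimes> y) = y" using assms by simp
  ultimately show ?thesis by simp
qed

section \<open>Algebraic closedness: square roots, a dense value group, an infinite residue
  field\<close>

lemma exists_root:
  assumes "p \<in> carrier (poly_ring R)" "degree p > 0"
  shows "\<exists>x \<in> K. eval p x = \<zero>"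
proof -
  have "size (roots p) > 0"
    using algebraically_closed.roots_over_carrier[OF alg_closed assms(1)] assms(2) by (simp add: splitted_def)
  then have "roots p ~= {#}" by auto
  then obtain x where "x \<in># roots p" by (rule multiset_nonemptyE)
  then have "is_root p x" using roots_mem_iff_is_root[OF assms(1)] by simp
  then show ?thesis by (auto simp: is_root_def)
qed

lemma exists_sqrt:
  assumes "a \<in> K"
  shows "\<exists>x \<in> K. x \<otimes> x = a"
proof -
  have "[\<one>, \<zero>, \<ominus> a] \<in> carrier (poly_ring R)"
    using assms by (simp add: univ_poly_carrier[symmetric] polynomial_def)
  then have "\<exists>x \<in> K. eval [\<one>, \<zero>, \<ominus> a] x = \<zero>" by (rule exists_root) simp
  then obtain x where x: "x \<in> K" "eval [\<one>, \<zero>, \<ominus> a] x = \<zero>" by blast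
  moreover have "eval [\<one>, \<zero>, \<ominus> a] x = x \<otimes> x \<oplus> \<ominus> a"
    using x(1) assms by (simp add: eval.simps numeral_2_eq_2)
  ultimately have "x \<otimes> x \<oplus> \<ominus> a = \<zero>" by simp
  then have "x \<otimes> x \<ominus> a = \<zero>" by (simp only: a_minus_def)
  then have "x \<otimes> x = a" using r_right_minus_eq[of "x \<otimes> x" a] assms x(1) by simp
  with x show ?thesis by blast
qed

lemma exists_gt_one: "\<exists>t \<in> K. t ~= \<zero> \<and> \<one> <v t"
proof -
  obtain x where x: "x \<in> K" "x ~= \<zero>" "~ (x \<le>v \<one> \<and> \<one> \<le>v x)" using nontrivial by blast
  have "x \<le>v \<one> \<longleftrightarrow> \<one> \<le>v inv x" using mult_le_iff(1)[of x \<one> "inv x"] x by simp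
  moreover have "\<one> \<le>v x \<longleftrightarrow> inv x \<le>v \<one>" using mult_le_iff(1)[of \<one> x "inv x"] x by simp
  ultimately show ?thesis using x by (metis inv_cancel(3) inv_closed le_total one_closed)
qed

text \<open>A square root of \<open>x \<otimes> y\<close> has the value halfway between. For
  \<open>y = \<zero>\<close> there is no midpoint, and an element of positive value gives a step
  upwards instead.\<close>

lemma dense:
  assumes "x <v y" "x \<in> K" "y \<in> K"
  shows "\<exists>z \<in> K. z ~= \<zero> \<and> x <v z \<and> z <v y"
proof -
  have x0: "x ~= \<zero>" using assms by auto
  show ?thesis
  proof (cases "y = \<zero>")
    case True
    obtain t where "t \<in> K" "t ~= \<zero>" "\<one> <v t" using exists_gt_one by blast
    then have "x <v x \<otimes> t" using mult_le_iff(2)[of t \<one> x] assms x0 by simp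
    with True \<open>t \<in> K\<close> \<open>t ~= \<zero>\<close> show ?thesis using assms x0 by (intro bexI[of _ "x \<otimes> t"]) auto
  next
    case False
    obtain z where z: "z \<in> K" "z \<otimes> z = x \<otimes> y" using exists_sqrt assms by blast
    then have z0: "z ~= \<zero>" using False x0 assms by (metis l_null mult_zero_iff)
    have "x <v z"
    proof
      assume "z \<le>v x"
      then have "z \<otimes> z \<le>v z \<otimes> x" "z \<otimes> x \<le>v x \<otimes> x"
        by (simp_all only: mult_le_iff z(1) assms x0 z0 not_False_eq_True)
      then have "x \<otimes> y \<le>v x \<otimes> x" using z le_trans[of "x \<otimes> y" "z \<otimes> x" "x \<otimes> x"] assms by simp
      then show False using assms x0 by simp
    qed
    moreover have "z <v y"
    proof
      assume "y \<le>v z"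
      then have "y \<otimes> y \<le>v z \<otimes> y" "z \<otimes> y \<le>v z \<otimes> z"
        by (simp_all only: mult_le_iff z(1) assms False z0 not_False_eq_True)
      then have "y \<otimes> y \<le>v x \<otimes> y" using z le_trans[of "y \<otimes> y" "z \<otimes> y" "x \<otimes> y"] assms by simp
      then show False using assms False by simp
    qed
    ultimately show ?thesis using z z0 by blast
  qed
qed

lemma exists_gt: "x \<in> K ==> x ~= \<zero> ==> \<exists>z \<in> K. z ~= \<zero> \<and> x <v z"
  using dense[of \<zero> x] by auto

lemma exists_lt:
  assumes "x \<in> K" "x ~= \<zero>"
  shows "\<exists>z \<in> K. z ~= \<zero> \<and> z <v x"
proof -
  obtain t where t: "t \<in> K" "t ~= \<zero>" "inv x <v t" using exists_gt[of "inv x"] assms by auto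
  then have "inv t <v x" using mult_le_iff(2)[of x "inv t" t] mult_le_iff(1)[of t "inv x" x] assms by (simp add: m_comm)
  then show ?thesis using t by (intro bexI[of _ "inv t"]) auto
qed

lemma exists_poly_prod:
  assumes "finite W" "W \<subseteq> K"
  shows "\<exists>p \<in> carrier (poly_ring R). degree p = card W \<and> (\<forall>x \<in> K. eval p x = (\<Otimes>w \<in> W. x \<ominus> w)) \<and> p ~= []"
  using assms
proof (induction rule: finite_induct)
  case empty
  have "[\<one>] \<in> carrier (poly_ring R)"
    by (simp add: univ_poly_carrier[symmetric] polynomial_def)
  then show ?case by (intro bexI[of _ "[\<one>]"]) auto
next
  case (insert w W)
  then obtain p where p: "p \<in> carrier (poly_ring R)" "degree p = card W" "p ~= []"
    "!!x. x \<in> K ==> eval p x = (\<Otimes>w \<in> W. x \<ominus> w)" by auto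
  have q: "[\<one>, \<ominus> w] \<in> carrier (poly_ring R)"
    using insert by (simp add: univ_poly_carrier[symmetric] polynomial_def)
  let ?r = "[\<one>, \<ominus> w] \<otimes>\<^bsub>poly_ring R\<^esub> p"
  have pol: "polynomial K p" "polynomial K [\<one>, \<ominus> w]" using p q by (simp_all add: univ_poly_carrier)
  have r: "?r \<in> carrier (poly_ring R)"
    using univ_poly_is_ring[OF carrier_is_subring] p q by (meson ring.ring_simprules(5))
  have "degree ?r = Suc (card W)"
    using poly_mult_degree_eq[OF carrier_is_subring pol(2,1)] p
    by (cases p) (simp_all add: univ_poly_mult del: poly_mult.simps)
  moreover from this have "?r ~= []" by auto
  moreover have "eval ?r x = (\<Otimes>w \<in> insert w W. x \<ominus> w)" if "x \<in> K" for x
  proof -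
    have "eval ?r x = eval [\<one>, \<ominus> w] x \<otimes> eval p x"
      using eval_poly_mult[OF polynomial_incl[OF pol(2)] polynomial_incl[OF pol(1)] that]
      by (simp only: univ_poly_mult)
    also have "eval [\<one>, \<ominus> w] x = x \<ominus> w" using that insert by (simp add: a_minus_def)
    finally show ?thesis using insert that p(4)[OF that] by (subst finprod_insert) auto
  qed
  ultimately show ?case using r insert by (intro bexI[of _ ?r]) auto
qed

lemma one_le_mult: "\<one> \<le>v x ==> \<one> \<le>v y ==> x \<in> K ==> y \<in> K ==> \<one> \<le>v x \<otimes> y"
  using le_trans[of \<one> y "x \<otimes> y"] le_mult[of \<one> x y] by simp

lemma mult_le_one: "x \<le>v \<one> ==> y \<le>v \<one> ==> x \<in> K ==> y \<in> K ==> x \<otimes> y \<le>v \<one>"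
  using le_trans[of "x \<otimes> y" y \<one>] le_mult[of x \<one> y] by simp

lemma one_lt_mult: "\<one> <v x ==> \<one> \<le>v y ==> x \<in> K ==> y \<in> K ==> \<one> <v x \<otimes> y"
  using le_mult[of \<one> y x] le_trans[of x "x \<otimes> y" \<one>] m_comm[of x y] by auto

text \<open>Roots of \<open>1 + \<Prod>w\<in>W. (X - w)\<close> avoid the residue classes of \<open>W\<close>.\<close>

lemma residue_field_infinite:
  assumes "finite W" "W \<subseteq> K" "!!w. w \<in> W ==> \<one> \<le>v w"
  shows "\<exists>x \<in> K. \<one> \<le>v x \<and> (\<forall>w \<in> W. x \<ominus> w \<le>v \<one>)"
proof (cases "W = {}")
  case True
  then show ?thesis by (intro bexI[of _ \<one>]) auto
next
  case False
  obtain p where p: "p \<in> carrier (poly_ring R)" "degree p = card W" "p ~= []"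
    "!!x. x \<in> K ==> eval p x = (\<Otimes>w \<in> W. x \<ominus> w)" using exists_poly_prod[OF assms(1,2)] by blast
  have cW: "card W > 0" using False assms by (simp add: card_gt_0_iff)
  let ?q = "p \<oplus>\<^bsub>poly_ring R\<^esub> [\<one>]"
  have o: "[\<one>] \<in> carrier (poly_ring R)"
    by (simp add: univ_poly_carrier[symmetric] polynomial_def)
  have pol: "polynomial K p" "polynomial K [\<one>]" using p o by (simp_all add: univ_poly_carrier)
  have "?q \<in> carrier (poly_ring R)"
    using univ_poly_is_ring[OF carrier_is_subring] p o by (meson ring.ring_simprules(1))
  moreover have "degree ?q = card W"
    using poly_add_degree_eq[OF carrier_is_subring pol] p cW by (simp add: univ_poly_add del: poly_add.simps)
  ultimately obtain x where x: "x \<in> K" "eval ?q x = \<zero>" using exists_root[of ?q] cW by auto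
  have "eval ?q x = eval p x \<oplus> eval [\<one>] x"
    using eval_poly_add[OF polynomial_incl[OF pol(1)] polynomial_incl[OF pol(2)] x(1)]
    by (simp only: univ_poly_add)
  then have e: "(\<Otimes>w \<in> W. x \<ominus> w) \<oplus> \<one> = \<zero>" using x p(4)[OF x(1)] by simp
  have pc: "(\<Otimes>w \<in> V. x \<ominus> w) \<in> K" if "V \<subseteq> W" for V
    using x assms(2) that by (intro finprod_closed) auto
  have "(\<Otimes>w \<in> W. x \<ominus> w) = \<ominus> \<one>" using minus_equality[OF e] pc[of W] by simp
  then have v: "(\<Otimes>w \<in> W. x \<ominus> w) \<le>v \<one>" "\<one> \<le>v (\<Otimes>w \<in> W. x \<ominus> w)" by simp_all
  have split: "(\<Otimes>w \<in> W. x \<ominus> w) = (x \<ominus> w) \<otimes> (\<Otimes>w \<in> W - {w}. x \<ominus> w)" if "w \<in> W" for w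
    using finprod_insert[of "W - {w}" w "\<lambda>w. x \<ominus> w"] that assms x
    by (simp add: insert_absorb Pi_def subset_iff)
  have "\<one> \<le>v x"
  proof (rule ccontr)
    \<comment> \<open>Otherwise every factor \<open>x \<ominus> w\<close> has negative value, and so
      has the product, although it equals \<open>\<ominus> \<one>\<close>.\<close>
    assume n: "~ \<one> \<le>v x"
    have xw: "x \<ominus> w <v \<one>" if "w \<in> W" for w
    proof
      assume "\<one> \<le>v x \<ominus> w"
      then have "\<one> \<le>v (x \<ominus> w) \<oplus> w" using assms that x by (intro le_add) auto
      moreover have "(x \<ominus> w) \<oplus> w = x" using that assms(2) x(1) by (intro diff_cancel) auto
      ultimately show False using n by simp
    qed
    have "(\<Otimes>w \<in> V. x \<ominus> w) \<le>v \<one>" if "V \<subseteq> W" for V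
      using finite_subset[OF that assms(1)] that
    proof (induction V rule: finite_induct)
      case (insert w V)
      then have w: "w \<in> K" "w \<in> W" "V \<subseteq> W" using assms(2) by auto
      have "(x \<ominus> w) \<otimes> (\<Otimes>w \<in> V. x \<ominus> w) \<le>v \<one>"
        using lt_imp_le[OF xw[OF w(2)]] insert.IH[OF w(3)] w(1) x(1) pc[OF w(3)] by (intro mult_le_one) auto
      then show ?case using insert w x assms(2) by (subst finprod_insert) auto
    qed simp
    note small = this
    \<comment> \<open>The bound on partial products is weak because it must hold for the empty one;
      splitting off one factor, possible as \<open>W\<close> is nonempty, makes it strict.\<close>
    obtain w where w: "w \<in> W" using False by blast
    have wK: "w \<in> K" using w assms by blast
    have "(\<Otimes>w \<in> W. x \<ominus> w) \<le>v \<one> \<otimes> (x \<ominus> w)"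
      using le_mult[OF _ _ _ small[of "W - {w}"], of "x \<ominus> w"] pc[of "W - {w}"] wK x split[OF w]
      by (simp add: m_comm)
    then show False using v xw[OF w] wK x pc[of W] le_trans[of \<one> "\<Otimes>w \<in> W. x \<ominus> w" "x \<ominus> w"] by simp
  qed
  moreover have "x \<ominus> w \<le>v \<one>" if "w \<in> W" for w
  proof (rule ccontr)
    \<comment> \<open>All factors are integral, so a single one of positive value would make the
      value of the product positive.\<close>
    assume n: "\<one> <v x \<ominus> w"
    have ge: "\<one> \<le>v (\<Otimes>w \<in> V. x \<ominus> w)" if "V \<subseteq> W" for V
      using finite_subset[OF that assms(1)] that
    proof (induction V rule: finite_induct)
      case (insert w V)
      then have w: "w \<in> K" "w \<in> W" "V \<subseteq> W" using assms(2) by auto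
      have "\<one> \<le>v x \<ominus> w" using \<open>\<one> \<le>v x\<close> assms(3)[OF w(2)] w x by (intro le_diff) auto
      then have "\<one> \<le>v (x \<ominus> w) \<otimes> (\<Otimes>w \<in> V. x \<ominus> w)"
        using insert w x pc[of V] by (intro one_le_mult) auto
      then show ?case using insert w x assms(2) by (subst finprod_insert) auto
    qed simp
    have "\<one> <v (x \<ominus> w) \<otimes> (\<Otimes>w \<in> W - {w}. x \<ominus> w)"
      using n ge[of "W - {w}"] pc[of "W - {w}"] that assms x by (intro one_lt_mult) auto
    then show False using v split[OF that] by simp
  qed
  ultimately show ?thesis using x by blast
qed

end

section \<open>Definability in a \<open>C\<close>-minimal field\<close>

named_theorems dfn

text \<open>
  \<open>dp n P\<close> stands for definability with parameters of the set of \<open>n\<close>-tuples satisfying \<open>P\<close>. In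
  the rules collected in \<open>dfn\<close>, quantifiers push their variable to the front of the tuple, so
  that \<open>intro dfn\<close> decides definability of explicit predicates.
\<close>

locale c_minimal_field = valued_field R le
  for R (structure) and le (infix \<open>\<le>v\<close> 50) +
  fixes dp :: "nat \<Rightarrow> ('a list \<Rightarrow> bool) \<Rightarrow> bool"
  assumes dp_cong: "(!!xs. length xs = n ==> set xs \<subseteq> carrier R ==> P xs = Q xs) ==> dp n P ==> dp n Q"
    and dp_not [dfn]: "dp n P ==> dp n (\<lambda>xs. ~ P xs)"
    and dp_conj [dfn]: "dp n P ==> dp n Q ==> dp n (\<lambda>xs. P xs \<and> Q xs)"
    and dp_ex [dfn]: "dp (Suc n) (\<lambda>ys. Q' (hd ys) (tl ys)) ==> dp n (\<lambda>xs. \<exists>y \<in> carrier R. Q' y xs)"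
    and dp_rename: "dp m P ==> length js = m ==> (!!i. i \<in> set js ==> i < n) ==>
      dp n (\<lambda>xs. P (map ((!) xs) js))"
    and dp_param: "dp (Suc n) P ==> a \<in> carrier R ==> dp n (\<lambda>xs. P (a # xs))"
    and dp_le_base: "dp 2 (\<lambda>xs. xs ! 0 \<le>v xs ! 1)"
    and dp_eq_base: "dp 2 (\<lambda>xs. xs ! 0 = xs ! 1)"
    and dp_add_base: "dp 3 (\<lambda>xs. xs ! 0 = xs ! 1 \<oplus> xs ! 2)"
    and dp_mult_base: "dp 3 (\<lambda>xs. xs ! 0 = xs ! 1 \<otimes> xs ! 2)"
    and c_minimal: "dp 1 P ==> {x \<in> carrier R. P [x]} \<in> bool_combs (carrier R)
      ({B. \<exists>a \<in> carrier R. \<exists>g \<in> carrier R - {\<zero>}.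
          B = {x \<in> carrier R. ~ x \<ominus> a \<le>v g} \<or> B = {x \<in> carrier R. g \<le>v x \<ominus> a}} \<union>
       {{a} | a. a \<in> carrier R})"
begin

section \<open>Definable terms and substitution\<close>

definition def1 :: "('a \<Rightarrow> bool) \<Rightarrow> bool" where
  "def1 P \<longleftrightarrow> dp 1 (\<lambda>xs. P (hd xs))"

definition def2 :: "('a \<Rightarrow> 'a \<Rightarrow> bool) \<Rightarrow> bool" where
  "def2 P \<longleftrightarrow> dp 2 (\<lambda>xs. P (hd xs) (hd (tl xs)))"

definition def3 :: "('a \<Rightarrow> 'a \<Rightarrow> 'a \<Rightarrow> bool) \<Rightarrow> bool" where
  "def3 P \<longleftrightarrow> dp 3 (\<lambda>xs. P (xs ! 0) (xs ! 1) (xs ! 2))"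

lemma dp_congI: "dp n P ==> (!!xs. length xs = n ==> set xs \<subseteq> K ==> P xs = Q xs) ==> dp n Q"
  using dp_cong by blast

lemma dp_disj [dfn]: "dp n P ==> dp n Q ==> dp n (\<lambda>xs. P xs \<or> Q xs)"
  by (rule dp_congI[OF dp_not[OF dp_conj[OF dp_not[of n P] dp_not[of n Q]]]]) auto

lemma dp_imp [dfn]: "dp n P ==> dp n Q ==> dp n (\<lambda>xs. P xs --> Q xs)"
  by (rule dp_congI[OF dp_disj[OF dp_not[of n P]]]) auto

lemma dp_iff [dfn]: "dp n P ==> dp n Q ==> dp n (\<lambda>xs. P xs \<longleftrightarrow> Q xs)"
  by (rule dp_congI[OF dp_conj[OF dp_imp[of n P Q] dp_imp[of n Q P]]]) auto

lemma dp_all [dfn]: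
  assumes "dp (Suc n) (\<lambda>ys. Q (hd ys) (tl ys))"
  shows "dp n (\<lambda>xs. \<forall>y \<in> K. Q y xs)"
  by (rule dp_congI[OF dp_not[OF dp_ex[OF dp_not[OF assms]]]]) auto

lemma map_nth_shift:
  "length ys = k + n ==> map ((!) ys) [k..<k + n] = drop k ys"
  by (auto intro: nth_equalityI)

text \<open>Inserts a dummy variable behind the front one. This is the place needed for weakening a
  graph \<open>hd ys = t (tl ys)\<close>, whose value stands in front.\<close>

lemma dp_weaken_snd:
  assumes "dp (Suc n) P" shows "dp (Suc (Suc n)) (\<lambda>zs. P (hd zs # tl (tl zs)))"
proof (rule dp_congI)
  show "dp (Suc (Suc n)) (\<lambda>ys. P (map ((!) ys) (0 # [2..<2 + n])))"
    by (rule dp_rename[OF assms]) auto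
  fix xs :: "'a list" assume "length xs = Suc (Suc n)"
  then show "P (map ((!) xs) (0 # [2..<2 + n])) = P (hd xs # tl (tl xs))"
    by (simp only: list.map map_nth_shift[of xs 2 n]) (auto simp: numeral_2_eq_2 drop_Suc hd_conv_nth length_Suc_conv)
qed

text \<open>Definable functions, with the value in front of the arguments in the graph. Treating
  them as terms lets \<open>intro dfn\<close> descend through nested applications.\<close>

definition dt :: "nat \<Rightarrow> ('a list \<Rightarrow> 'a) \<Rightarrow> bool" where
  "dt n t \<longleftrightarrow> (\<forall>xs. length xs = n --> set xs \<subseteq> K --> t xs \<in> K) \<and> dp (Suc n) (\<lambda>ys. hd ys = t (tl ys))"

lemma dt_cong:
  assumes eq: "!!xs. length xs = n ==> set xs \<subseteq> K ==> t xs = u xs" and t: "dt n t"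
  shows "dt n u"
proof -
  from t have 1: "dp (Suc n) (\<lambda>ys. hd ys = t (tl ys))" by (simp add: dt_def)
  have "dp (Suc n) (\<lambda>ys. hd ys = u (tl ys))"
    by (rule dp_congI[OF 1]) (auto simp: length_Suc_conv eq)
  with t eq show ?thesis by (simp add: dt_def)
qed

lemma dt_closed: "dt n t ==> length xs = n ==> set xs \<subseteq> K ==> t xs \<in> K"
  by (simp add: dt_def)

lemma dt_nth:
  assumes "i < n" shows "dt n (\<lambda>xs. xs ! i)"
proof -
  have "dp (Suc n) (\<lambda>ys. map ((!) ys) [0, Suc i] ! 0 = map ((!) ys) [0, Suc i] ! 1)"
    using assms by (intro dp_rename[OF dp_eq_base]) auto
  then have "dp (Suc n) (\<lambda>ys. hd ys = tl ys ! i)"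
    by (rule dp_cong[rotated]) (use assms in \<open>auto simp: length_Suc_conv\<close>)
  then show ?thesis using assms by (auto simp: dt_def)
qed

text \<open>Nested quantifier rules leave variables in exactly this shape, which unification cannot
  match against \<open>xs ! i\<close>.\<close>

lemma dt_var [dfn]:
  "0 < n ==> dt n (\<lambda>xs. hd xs)"
  "1 < n ==> dt n (\<lambda>xs. hd (tl xs))"
  "2 < n ==> dt n (\<lambda>xs. hd (tl (tl xs)))"
  "3 < n ==> dt n (\<lambda>xs. hd (tl (tl (tl xs))))"
  "4 < n ==> dt n (\<lambda>xs. hd (tl (tl (tl (tl xs)))))"
  "5 < n ==> dt n (\<lambda>xs. hd (tl (tl (tl (tl (tl xs))))))"
  "6 < n ==> dt n (\<lambda>xs. hd (tl (tl (tl (tl (tl (tl xs)))))))"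
proof -
  have *: "hd ((tl ^^ k) xs) = xs ! k" if "k < length xs" for k and xs :: "'a list"
    using that by (induction k arbitrary: xs) (auto simp: hd_conv_nth nth_tl funpow_swap1)
  have "dt n (\<lambda>xs. hd ((tl ^^ k) xs))" if "k < n" for k
    by (rule dt_cong[OF _ dt_nth[OF that]]) (use * that in auto)
  note this[of 0] this[of 1] this[of 2] this[of 3] this[of 4] this[of 5] this[of 6]
  then show "0 < n ==> dt n (\<lambda>xs. hd xs)"
    "1 < n ==> dt n (\<lambda>xs. hd (tl xs))"
    "2 < n ==> dt n (\<lambda>xs. hd (tl (tl xs)))"
    "3 < n ==> dt n (\<lambda>xs. hd (tl (tl (tl xs))))"
    "4 < n ==> dt n (\<lambda>xs. hd (tl (tl (tl (tl xs)))))"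
    "5 < n ==> dt n (\<lambda>xs. hd (tl (tl (tl (tl (tl xs))))))"
    "6 < n ==> dt n (\<lambda>xs. hd (tl (tl (tl (tl (tl (tl xs)))))))"
    by (simp_all add: eval_nat_numeral)
qed

lemma dt_const [dfn]: "a \<in> K ==> dt n (\<lambda>xs. a)"
proof -
  assume a: "a \<in> K"
  have "dp (Suc (Suc n)) (\<lambda>ys. map ((!) ys) [1, 0] ! 0 = map ((!) ys) [1, 0] ! 1)"
    by (rule dp_rename[OF dp_eq_base]) auto
  from dp_param[OF this a] have "dp (Suc n) (\<lambda>ys. hd ys = a)"
    by (rule dp_congI) (auto simp: length_Suc_conv)
  then show ?thesis using a by (simp add: dt_def)
qed

lemma dt_weaken: "dt n t ==> dt (Suc n) (\<lambda>ys. t (tl ys))"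
  unfolding dt_def using dp_weaken_snd[of n "\<lambda>ys. hd ys = t (tl ys)"] by (auto simp: length_Suc_conv)

lemma dp_nth3:
  assumes "def3 r" "i < n" "j < n" "k < n"
  shows "dp n (\<lambda>xs. r (xs ! i) (xs ! j) (xs ! k))"
proof -
  have "dp n (\<lambda>xs. r (map ((!) xs) [i, j, k] ! 0) (map ((!) xs) [i, j, k] ! 1) (map ((!) xs) [i, j, k] ! 2))"
    using assms by (intro dp_rename[OF assms(1)[unfolded def3_def]]) auto
  then show ?thesis by simp
qed

lemma dp_let:
  assumes "dt n t" "dp (Suc n) (\<lambda>ys. Q (hd ys) (tl ys))"
  shows "dp n (\<lambda>xs. Q (t xs) xs)"
proof -
  have "dp n (\<lambda>xs. \<exists>y \<in> K. y = t xs \<and> Q y xs)"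
    using assms by (intro dp_ex dp_conj) (simp_all add: dt_def)
  then show ?thesis by (rule dp_cong[rotated]) (use assms in \<open>auto simp: dt_def\<close>)
qed

lemma dp_subst3:
  assumes "def3 r" "dt n s" "dt n t" "dt n u"
  shows "dp n (\<lambda>xs. r (s xs) (t xs) (u xs))"
proof -
  \<comment> \<open>The arguments are listed in reverse, so that \<open>dp_let\<close> can replace
    the front variable by \<open>u\<close>, then by \<open>t\<close>, then by
    \<open>s\<close>.\<close>
  have "dp (Suc (Suc (Suc n))) (\<lambda>zs. r (zs ! 2) (zs ! 1) (zs ! 0))"
    by (rule dp_nth3[OF assms(1)]) auto
  then have "dp (Suc (Suc (Suc n))) (\<lambda>zs. r (hd (tl (tl zs))) (hd (tl zs)) (hd zs))"
    by (rule dp_cong[rotated]) (auto simp: length_Suc_conv)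
  then have "dp (Suc (Suc n)) (\<lambda>zs. r (hd (tl zs)) (hd zs) (u (tl (tl zs))))"
    by (rule dp_let[where n = "Suc (Suc n)" and Q = "\<lambda>y zs. r (hd (tl zs)) (hd zs) y",
          OF dt_weaken[OF dt_weaken[OF assms(4)]]])
  then have "dp (Suc n) (\<lambda>zs. r (hd zs) (t (tl zs)) (u (tl zs)))"
    by (rule dp_let[where n = "Suc n" and Q = "\<lambda>y zs. r (hd zs) y (u (tl zs))",
          OF dt_weaken[OF assms(3)]])
  then show ?thesis by (rule dp_let[where n = n and Q = "\<lambda>y zs. r y (t zs) (u zs)", OF assms(2)])
qed

lemma dp_subst2:
  assumes "def2 r" "dt n s" "dt n t"
  shows "dp n (\<lambda>xs. r (s xs) (t xs))"
proof -
  have "def3 (\<lambda>x y z. r x y)" unfolding def3_def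
    using dp_rename[OF assms(1)[unfolded def2_def], of "[0, 1]" 3] by force
  from dp_subst3[OF this assms(2,3,3)] show ?thesis .
qed

lemma dp_subst1:
  assumes "def1 r" "dt n s"
  shows "dp n (\<lambda>xs. r (s xs))"
proof -
  have "def3 (\<lambda>x y z. r x)" unfolding def3_def
    using dp_rename[OF assms(1)[unfolded def1_def], of "[0]" 3] by force
  from dp_subst3[OF this assms(2,2,2)] show ?thesis .
qed

lemma dp_le [dfn]: "dt n s ==> dt n t ==> dp n (\<lambda>xs. s xs \<le>v t xs)"
  using dp_subst2[of "(\<le>v)"] dp_congI[OF dp_le_base, of "\<lambda>xs. hd xs \<le>v hd (tl xs)"]
  by (fastforce simp: def2_def length_Suc_conv numeral_2_eq_2)

lemma dp_eq [dfn]: "dt n s ==> dt n t ==> dp n (\<lambda>xs. s xs = t xs)"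
  using dp_subst2[of "(=)"] dp_congI[OF dp_eq_base, of "\<lambda>xs. hd xs = hd (tl xs)"]
  by (fastforce simp: def2_def length_Suc_conv numeral_2_eq_2)

lemma dt_fun2:
  assumes "def3 (\<lambda>z x y. z = g x y)" "!!x y. x \<in> K ==> y \<in> K ==> g x y \<in> K" "dt n s" "dt n t"
  shows "dt n (\<lambda>xs. g (s xs) (t xs))"
  unfolding dt_def
  using assms(2) dt_closed[OF assms(3)] dt_closed[OF assms(4)]
    dp_subst3[OF assms(1) dt_var(1)[of "Suc n"] dt_weaken[OF assms(3)] dt_weaken[OF assms(4)]] by simp

lemma dt_add [dfn]: "dt n s ==> dt n t ==> dt n (\<lambda>xs. s xs \<oplus> t xs)"
  by (rule dt_fun2[of "(\<oplus>)"]) (use dp_add_base in \<open>simp_all add: def3_def\<close>)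

lemma dt_mult [dfn]: "dt n s ==> dt n t ==> dt n (\<lambda>xs. s xs \<otimes> t xs)"
  by (rule dt_fun2[of "(\<otimes>)"]) (use dp_mult_base in \<open>simp_all add: def3_def\<close>)

lemma add_eq_iff: "x \<in> K ==> y \<in> K ==> z \<in> K ==> z \<oplus> y = x \<longleftrightarrow> z = x \<ominus> y"
  using add.inv_solve_right[of z x y] by (auto simp: a_minus_def)

lemma dt_minus [dfn]: "dt n s ==> dt n t ==> dt n (\<lambda>xs. s xs \<ominus> t xs)"
proof (rule dt_fun2[of "\<lambda>x y. x \<ominus> y"])
  have 1: "dp 3 (\<lambda>xs. xs ! 0 \<oplus> xs ! 2 = xs ! 1)" by (intro dp_eq dt_add dt_nth) auto
  show "def3 (\<lambda>z x y. z = x \<ominus> y)" unfolding def3_def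
    by (rule dp_congI[OF 1]) (auto simp: length_Suc_conv numeral_3_eq_3 add_eq_iff)
qed auto

lemma dt_fun:
  assumes "def2 (\<lambda>z x. z = g x)" "!!x. x \<in> K ==> g x \<in> K" "dt n s"
  shows "dt n (\<lambda>xs. g (s xs))"
  unfolding dt_def
  using assms(2) dt_closed[OF assms(3)]
    dp_subst2[OF assms(1) dt_var(1)[of "Suc n"] dt_weaken[OF assms(3)]] by simp

lemma dp_eqv [dfn]: "dt n s ==> dt n t ==> dp n (\<lambda>xs. s xs =v t xs)"
  unfolding eqv_def by (intro dfn)

lemma dp_rveq [dfn]: "dt n s ==> dt n t ==> dp n (\<lambda>xs. s xs \<sim>v t xs)"
  unfolding rveq_def by (intro dfn)

text \<open>The punctured neighbourhood filter of \<open>\<zero>\<close>: for nonzero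
  \<open>e\<close> the condition \<open>e <v x\<close> describes a small ball. Spelling it with
  quantifiers over \<open>K\<close> keeps it first-order, hence \<open>dp_ev\<close>.\<close>

definition ev :: "('a \<Rightarrow> bool) \<Rightarrow> bool" where
  "ev P \<longleftrightarrow> (\<exists>e \<in> K. e ~= \<zero> \<and> (\<forall>x \<in> K. x ~= \<zero> --> e <v x --> P x))"

lemma dp_ev [dfn]:
  assumes "dp (Suc n) (\<lambda>ys. Q (hd ys) (tl ys))"
  shows "dp n (\<lambda>xs. ev (\<lambda>x. Q x xs))"
proof -
  \<comment> \<open>\<open>ev\<close> binds the bound \<open>e\<close> outside \<open>x\<close>; the
    predicate ignores \<open>e\<close>, which sits in second position.\<close>
  have [dfn]: "dp (Suc (Suc n)) (\<lambda>zs. Q (hd zs) (tl (tl zs)))"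
    using dp_weaken_snd[OF assms] by simp
  show ?thesis unfolding ev_def by (intro dfn) auto
qed

section \<open>Consequences of \<open>C\<close>-minimality\<close>

text \<open>The sets decided by some member of a directed family are closed under complement and
  union, so by \<open>C\<close>-minimality it is enough to decide balls and points.\<close>

lemma definable_decided:
  assumes P: "def1 P"
    and dir: "!!i j. i \<in> I ==> j \<in> I ==> \<exists>k \<in> I. N k \<subseteq> N i \<inter> N j"
    and sub: "!!i. i \<in> I ==> N i \<subseteq> K"
    and ball: "!!c g S. c \<in> K ==> g \<in> K ==> g ~= \<zero> ==>
      S = {x \<in> K. g <v x \<ominus> c} \<or> S = {x \<in> K. g \<le>v x \<ominus> c} ==> \<exists>i \<in> I. N i \<subseteq> S \<or> N i \<inter> S = {}"
    and point: "!!p. p \<in> K ==> \<exists>i \<in> I. N i \<subseteq> {p} \<or> N i \<inter> {p} = {}"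
  shows "\<exists>i \<in> I. N i \<subseteq> {x \<in> K. P x} \<or> N i \<inter> {x \<in> K. P x} = {}"
proof -
  have all: "\<exists>i \<in> I. N i \<subseteq> S \<or> N i \<inter> S = {}"
    if "S \<in> bool_combs K ({B. \<exists>a \<in> K. \<exists>g \<in> K - {\<zero>}.
          B = {x \<in> K. g <v x \<ominus> a} \<or> B = {x \<in> K. g \<le>v x \<ominus> a}} \<union> {{a} | a. a \<in> K})" for S
    using that
  proof induction
    case (base S)
    then consider c g where "c \<in> K" "g \<in> K" "g ~= \<zero>" "S = {x \<in> K. g <v x \<ominus> c} \<or> S = {x \<in> K. g \<le>v x \<ominus> c}"
      | p where "p \<in> K" "S = {p}" by blast
    then show ?case by cases (use ball point in simp_all)
  next
    case (compl S)
    then obtain i where "i \<in> I" "N i \<subseteq> S \<or> N i \<inter> S = {}" by blast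
    with sub[of i] show ?case by blast
  next
    case (union S S')
    then obtain i j where ij: "i \<in> I" "N i \<subseteq> S \<or> N i \<inter> S = {}" "j \<in> I" "N j \<subseteq> S' \<or> N j \<inter> S' = {}" by blast
    obtain k where "k \<in> I" "N k \<subseteq> N i \<inter> N j" using dir[OF ij(1,3)] by blast
    with ij show ?case by (intro bexI[of _ k]) blast+
  qed
  have "{x \<in> K. P x} = {x \<in> K. P (hd [x])}" by simp
  then show ?thesis using all[OF c_minimal[OF P[unfolded def1_def]]] by simp
qed

section \<open>Dichotomies along annuli and along residue classes\<close>

lemma le_max: "a \<in> K ==> a' \<in> K ==> x \<in> K ==> (if a \<le>v a' then a' else a) <v x ==> a <v x \<and> a' <v x"
  using le_total[of a a'] le_trans[of x a a'] le_trans[of x a' a] by (auto split: if_splits)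

lemma le_min: "b \<in> K ==> b' \<in> K ==> x \<in> K ==> x <v (if b \<le>v b' then b else b') ==> x <v b \<and> x <v b'"
  using le_total[of b b'] le_trans[of b b' x] le_trans[of b' b x] by (auto split: if_splits)

text \<open>By \<open>dec\<close> no nonzero value lies strictly between all of \<open>A\<close> and
  all of \<open>Bs\<close>, so any given value can be cut off by shrinking the annulus. A ball
  missing \<open>\<zero>\<close> has all its elements of one value; a ball containing
  \<open>\<zero>\<close> only compares the value of \<open>x\<close> with its radius. Singletons for
  \<open>A\<close> or \<open>Bs\<close> give one-sided neighbourhoods of a value, and
  \<open>sup_exists\<close> applies the lemma to a gap.\<close>

lemma annulus_dichotomy:
  assumes P: "def1 P" and A: "A \<subseteq> K" "A ~= {}" and Bs: "Bs \<subseteq> K" "Bs ~= {}"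
    and dec: "!!d. d \<in> K ==> d ~= \<zero> ==> (\<exists>a \<in> A. d \<le>v a) \<or> (\<exists>b \<in> Bs. b \<le>v d)"
  shows "\<exists>a \<in> A. \<exists>b \<in> Bs. (\<forall>x \<in> K. a <v x --> x <v b --> P x) \<or> (\<forall>x \<in> K. a <v x --> x <v b --> ~ P x)"
proof -
  define N where "N a b = {x \<in> K. a <v x \<and> x <v b}" for a b
  define D where "D S \<longleftrightarrow> (\<exists>a \<in> A. \<exists>b \<in> Bs. N a b \<subseteq> S \<or> N a b \<inter> S = {})" for S
  obtain a0 b0 where ab0: "a0 \<in> A" "b0 \<in> Bs" using A Bs by blast
  have off: "D S" if c: "c \<in> K" "c ~= \<zero>" and S: "!!x. x \<in> S ==> x \<in> K ==> x =v c" for c S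
    using dec[OF c]
  proof
    assume "\<exists>a \<in> A. c \<le>v a"
    then obtain a where a: "a \<in> A" "c \<le>v a" by blast
    have "x =v c ==> x \<in> K ==> ~ a <v x" for x
      using a A c le_trans[of x c a] by (auto simp: eqv_def)
    then have "N a b0 \<inter> S = {}" using S by (auto simp: N_def)
    with a ab0 show ?thesis unfolding D_def by blast
  next
    assume "\<exists>b \<in> Bs. b \<le>v c"
    then obtain b where b: "b \<in> Bs" "b \<le>v c" by blast
    have "x =v c ==> x \<in> K ==> ~ x <v b" for x
      using b Bs c le_trans[of b c x] by (auto simp: eqv_def)
    then have "N a0 b \<inter> S = {}" using S by (auto simp: N_def)
    with b ab0 show ?thesis unfolding D_def by blast
  qed
  have ball: "D S" if c: "c \<in> K" and g: "g \<in> K" "g ~= \<zero>"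
    and S: "S = {x \<in> K. g <v x \<ominus> c} \<or> S = {x \<in> K. g \<le>v x \<ominus> c}" for c g S
  proof (cases "g \<le>v c")
    case False
    \<comment> \<open>The radius exceeds \<open>v(c)\<close>: all elements of the ball have the
      leading term of \<open>c\<close>, hence its value.\<close>
    have "x =v c" if "x \<in> S" "x \<in> K" for x
    proof -
      have "g \<le>v x \<ominus> c" using S that g c lt_imp_le[of g "x \<ominus> c"] by auto
      then have "c \<sim>v x" using False that g c rveqI[of g c x] diff_sym[of x c] by auto
      then show ?thesis using rveq_eqv c that eqv_sym by blast
    qed
    moreover have "c ~= \<zero>" using False g by auto
    ultimately show ?thesis using off c by blast
  next
    case True
    from dec[OF g] show ?thesis
    proof
      assume "\<exists>a \<in> A. g \<le>v a"
      then obtain a where a: "a \<in> A" "a \<in> K" "g \<le>v a" using A by blast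
      have gx: "g <v x" if "x \<in> N a b0" for x
        using that a g le_trans[of x g a] by (auto simp: N_def)
      show ?thesis
      proof (cases "S = {x \<in> K. g \<le>v x \<ominus> c}")
        case S: True
        have "N a b0 \<subseteq> S"
        proof
          fix x assume x: "x \<in> N a b0"
          then have "x \<in> K" by (simp add: N_def)
          then show "x \<in> S" using S le_diff[of g x c] True lt_imp_le[OF gx[OF x]] g c by simp
        qed
        then show ?thesis using a ab0 unfolding D_def by blast
      next
        case S': False
        then have S: "S = {x \<in> K. g <v x \<ominus> c}" using S by blast
        show ?thesis
        proof (cases "g <v c")
          case gc: True
          have "N a b0 \<subseteq> S"
          proof
            fix x assume x: "x \<in> N a b0"
            then have "x \<in> K" by (simp add: N_def)
            then show "x \<in> S" using S lt_diff[of x g c] gc gx[OF x] g c by simp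
          qed
          then show ?thesis using a ab0 unfolding D_def by blast
        next
          case gc: False
          \<comment> \<open>Here \<open>v(c)\<close> equals the radius, and an open ball about
            \<open>c\<close> of that radius contains no \<open>x\<close> of larger value.\<close>
          have "x \<notin> S" if x: "x \<in> N a b0" for x
          proof
            assume "x \<in> S"
            then have "g <v x \<ominus> c" "x \<in> K" using S by auto
            then have "g <v x \<ominus> (x \<ominus> c)" using lt_diff[of x g "x \<ominus> c"] gx[OF x] g c by simp
            then show False using diff_cancel \<open>x \<in> K\<close> c gc by simp
          qed
          then have "N a b0 \<inter> S = {}" by blast
          then show ?thesis using a ab0 unfolding D_def by blast
        qed
      qed
    next
      assume "\<exists>b \<in> Bs. b \<le>v g"
      then obtain b where b: "b \<in> Bs" "b \<in> K" "b \<le>v g" using Bs by blast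
      have "x \<notin> S" if x: "x \<in> N a0 b" for x
      proof
        assume "x \<in> S"
        then have xc: "g \<le>v x \<ominus> c" "x \<in> K" using S lt_imp_le[of g "x \<ominus> c"] g c by auto
        then have "g \<le>v (x \<ominus> c) \<oplus> c" using le_add[of g "x \<ominus> c" c] True g c by simp
        then have "g \<le>v x" using diff_cancel xc c by simp
        then show False using x xc b g le_trans[of b g x] by (simp add: N_def)
      qed
      then have "N a0 b \<inter> S = {}" by blast
      then show ?thesis using b ab0 unfolding D_def by blast
    qed
  qed
  have point: "D {p}" if "p \<in> K" for p
  proof (cases "p = \<zero>")
    case True
    have "\<zero> \<notin> N a0 b0" using ab0 Bs by (auto simp: N_def)
    then show ?thesis using True ab0 unfolding D_def by blast
  next
    case False
    show ?thesis by (rule off[of p "{p}"]) (use False that in auto)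
  qed
  have "\<exists>i \<in> A \<times> Bs. N (fst i) (snd i) \<subseteq> {x \<in> K. P x} \<or> N (fst i) (snd i) \<inter> {x \<in> K. P x} = {}"
  proof (rule definable_decided[OF P])
    fix i j assume i: "i \<in> A \<times> Bs" and j: "j \<in> A \<times> Bs"
    obtain a b a' b' where ij: "i = (a, b)" "j = (a', b')" by (cases i, cases j)
    define a'' where "a'' = (if a \<le>v a' then a' else a)"
    define b'' where "b'' = (if b \<le>v b' then b else b')"
    have K4: "a \<in> K" "a' \<in> K" "b \<in> K" "b' \<in> K" using i j ij A Bs by auto
    have "N a'' b'' \<subseteq> N a b \<inter> N a' b'"
      using le_max[OF K4(1,2)] le_min[OF K4(3,4)] unfolding N_def a''_def b''_def by auto
    moreover have "(a'', b'') \<in> A \<times> Bs" using i j ij by (auto simp: a''_def b''_def)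
    ultimately show "\<exists>k \<in> A \<times> Bs. N (fst k) (snd k) \<subseteq> N (fst i) (snd i) \<inter> N (fst j) (snd j)"
      unfolding ij by (intro bexI[of _ "(a'', b'')"]) auto
  next
    fix i assume "i \<in> A \<times> Bs"
    show "N (fst i) (snd i) \<subseteq> K" by (auto simp: N_def)
  qed (use ball point in \<open>auto simp: D_def\<close>)
  then show ?thesis unfolding N_def by (simp add: subset_iff disjoint_iff) blast
qed

text \<open>An annulus whose upper end is the value \<infinity> of \<open>\<zero>\<close> is a
  punctured neighbourhood of \<open>\<zero>\<close>.\<close>

lemma ev_dichotomy:
  assumes "def1 P" shows "ev P \<or> ev (\<lambda>x. ~ P x)"
proof -
  have "\<exists>a \<in> K - {\<zero>}. \<exists>b \<in> {\<zero>}. (\<forall>x \<in> K. a <v x --> x <v b --> P x) \<or> (\<forall>x \<in> K. a <v x --> x <v b --> ~ P x)"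
    by (rule annulus_dichotomy[OF assms]) (auto intro: exI[of _ \<one>] le_refl)
  then show ?thesis unfolding ev_def by auto
qed

lemma ev_mono: "ev P ==> (!!x. x \<in> K ==> x ~= \<zero> ==> P x ==> Q x) ==> ev Q"
  unfolding ev_def by blast

lemma exists_max:
  assumes "a \<in> K" "b \<in> K" "a ~= \<zero>" "b ~= \<zero>"
  obtains c where "c \<in> K" "c ~= \<zero>" "a \<le>v c" "b \<le>v c"
  using assms le_total[of a b] le_refl by blast

lemma ev_conj:
  assumes "ev P" "ev Q" shows "ev (\<lambda>x. P x \<and> Q x)"
proof -
  obtain a b where ab: "a \<in> K" "a ~= \<zero>" "b \<in> K" "b ~= \<zero>"
    and a: "\<forall>x \<in> K. x ~= \<zero> --> a <v x --> P x" and b: "\<forall>x \<in> K. x ~= \<zero> --> b <v x --> Q x"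
    using assms unfolding ev_def by blast
  obtain c where "c \<in> K" "c ~= \<zero>" "a \<le>v c" "b \<le>v c" using exists_max[OF ab(1,3,2,4)] .
  then show ?thesis unfolding ev_def using a b ab le_lt_trans[of a c] le_lt_trans[of b c]
    by (intro bexI[of _ c]) auto
qed

lemma ev_exists: "ev P ==> \<exists>x \<in> K. x ~= \<zero> \<and> P x"
  unfolding ev_def using exists_gt by blast

lemma ev_True: "(!!x. x \<in> K ==> x ~= \<zero> ==> P x) ==> ev P"
  unfolding ev_def by (intro bexI[of _ \<one>]) auto

lemma ev_gt: "e \<in> K ==> e ~= \<zero> ==> ev (\<lambda>x. e <v x)"
  unfolding ev_def by blast

lemma ev_conj3: "ev P ==> ev Q ==> ev S ==> ev (\<lambda>x. P x \<and> Q x \<and> S x)"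
  by (intro ev_conj)

lemma ev_scale:
  assumes "ev P" "u \<in> K" "u ~= \<zero>" shows "ev (\<lambda>x. P (u \<otimes> x))"
proof -
  obtain e where e: "e \<in> K" "e ~= \<zero>" "!!x. x \<in> K ==> x ~= \<zero> ==> e <v x ==> P x"
    using assms unfolding ev_def by blast
  have "P (u \<otimes> x)" if "x \<in> K" "x ~= \<zero>" "inv u \<otimes> e <v x" for x
  proof (rule e(3))
    show "e <v u \<otimes> x" using that e assms mult_le_iff(2)[of x "inv u \<otimes> e" u] by simp
  qed (use that assms in auto)
  then show ?thesis using e assms unfolding ev_def by (intro bexI[of _ "inv u \<otimes> e"]) auto
qed

text \<open>Strong minimality of the residue field. A ball contains the valuation ring, misses it,
  or meets it within one residue class; in the last case the class is removed by putting the centre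
  into \<open>W\<close>. The condition \<open>x \<ominus> w \<le>v \<one>\<close> says that integral
  \<open>x\<close> and \<open>w\<close> have different residues.\<close>

lemma residue_dichotomy:
  assumes P: "def1 P"
  shows "\<exists>W. finite W \<and> W \<subseteq> {w \<in> K. \<one> \<le>v w} \<and>
    ((\<forall>x \<in> K. \<one> \<le>v x --> (\<forall>w \<in> W. x \<ominus> w \<le>v \<one>) --> P x) \<or>
     (\<forall>x \<in> K. \<one> \<le>v x --> (\<forall>w \<in> W. x \<ominus> w \<le>v \<one>) --> ~ P x))"
proof -
  define N where "N W = {x \<in> K. \<one> \<le>v x \<and> (\<forall>w \<in> W. x \<ominus> w \<le>v \<one>)}" for W
  define D where "D S \<longleftrightarrow> (\<exists>W. finite W \<and> W \<subseteq> {w \<in> K. \<one> \<le>v w} \<and> (N W \<subseteq> S \<or> N W \<inter> S = {}))" for S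
  have empty: "N {} \<subseteq> S \<or> N {} \<inter> S = {} ==> D S" for S
    unfolding D_def by blast
  have single: "N {c} \<inter> S = {} ==> c \<in> K ==> \<one> \<le>v c ==> D S" for S c
    unfolding D_def by blast
  have ball: "D S" if c: "c \<in> K" and g: "g \<in> K" "g ~= \<zero>"
    and S: "S = {x \<in> K. g <v x \<ominus> c} \<or> S = {x \<in> K. g \<le>v x \<ominus> c}" for c g S
  proof (cases "\<one> \<le>v c")
    case c1: True
    consider "g <v \<one>" | "\<one> \<le>v g" "S = {x \<in> K. g <v x \<ominus> c}" | "\<one> <v g"
      | "\<one> =v g" "S = {x \<in> K. g \<le>v x \<ominus> c}" using S unfolding eqv_def by blast
    then show ?thesis
    proof cases
      case 1
      have "x \<in> S" if "x \<in> N {}" for x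
      proof -
        have x: "x \<in> K" "\<one> \<le>v x" using that by (auto simp: N_def)
        have "\<one> \<le>v x \<ominus> c" using le_diff[of \<one> x c] x c c1 by simp
        then have "g <v x \<ominus> c" using 1 g c x le_trans[of \<one> "x \<ominus> c" g] by auto
        then show ?thesis using S lt_imp_le[of g "x \<ominus> c"] g c x by auto
      qed
      then show ?thesis using empty by blast
    next
      case 2
      have "x \<notin> S" if "x \<in> N {c}" for x
        using that 2 le_trans[of "x \<ominus> c" \<one> g] g c by (simp add: N_def)
      then show ?thesis using single[of c S] c c1 by blast
    next
      case 3
      have "x \<notin> S" if "x \<in> N {c}" for x
      proof
        assume "x \<in> S"
        then have "g \<le>v x \<ominus> c" "x \<in> K" using S lt_imp_le[of g "x \<ominus> c"] g c by auto
        then show False using that 3 le_trans[of g "x \<ominus> c" \<one>] g c by (simp add: N_def)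
      qed
      then show ?thesis using single[of c S] c c1 by blast
    next
      case 4
      have "x \<in> S" if "x \<in> N {}" for x
      proof -
        have "\<one> \<le>v x \<ominus> c" using that le_diff[of \<one> x c] c c1 by (simp add: N_def)
        then show ?thesis using 4 that eqv_le(1)[OF 4(1), of "x \<ominus> c"] g c by (simp add: N_def)
      qed
      then show ?thesis using empty by blast
    qed
  next
    case c1: False
    \<comment> \<open>A centre of negative value has the same distance from all integral elements,
      so no class needs to be removed.\<close>
    have xc: "x \<ominus> c =v c" if "x \<in> N {}" for x
    proof -
      have x: "x \<in> K" "\<one> \<le>v x" using that by (auto simp: N_def)
      then have "c <v x" using c1 c le_trans[of \<one> x c] by auto
      then have "c \<sim>v c \<ominus> x" using diff_cancel[of c x] c x by (simp add: rveq_def)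
      then have "c =v c \<ominus> x" using rveq_eqv c x by blast
      then show ?thesis using diff_sym[of x c c] c x by (simp add: eqv_def)
    qed
    have "x \<in> S \<longleftrightarrow> (if S = {x \<in> K. g \<le>v x \<ominus> c} then g \<le>v c else g <v c)" if "x \<in> N {}" for x
      using S eqv_le[OF xc[OF that]] that c g by (auto simp: N_def)
    then show ?thesis using empty[of S] by (auto split: if_splits)
  qed
  have point: "D {p}" if "p \<in> K" for p
  proof (cases "\<one> \<le>v p")
    case True
    have "N {p} \<inter> {p} = {}" using that by (auto simp: N_def)
    then show ?thesis using single True that by blast
  next
    case False
    then have "N {} \<inter> {p} = {}" by (auto simp: N_def)
    then show ?thesis using empty by blast
  qed
  have "\<exists>W \<in> {W. finite W \<and> W \<subseteq> {w \<in> K. \<one> \<le>v w}}. N W \<subseteq> {x \<in> K. P x} \<or> N W \<inter> {x \<in> K. P x} = {}"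
  proof (rule definable_decided[OF P])
    fix W W' assume "W \<in> {W. finite W \<and> W \<subseteq> {w \<in> K. \<one> \<le>v w}}" "W' \<in> {W. finite W \<and> W \<subseteq> {w \<in> K. \<one> \<le>v w}}"
    then show "\<exists>V \<in> {W. finite W \<and> W \<subseteq> {w \<in> K. \<one> \<le>v w}}. N V \<subseteq> N W \<inter> N W'"
      by (intro bexI[of _ "W \<union> W'"]) (auto simp: N_def)
  next
    fix W show "N W \<subseteq> K" by (auto simp: N_def)
  qed (use ball point in \<open>simp_all add: D_def conj_assoc\<close>)
  then obtain W where "finite W" "W \<subseteq> {w \<in> K. \<one> \<le>v w}" "N W \<subseteq> {x \<in> K. P x} \<or> N W \<inter> {x \<in> K. P x} = {}"
    by blast
  then show ?thesis by (intro exI[of _ W]) (auto simp: N_def subset_iff disjoint_iff)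
qed

definition is_sup :: "('a \<Rightarrow> bool) \<Rightarrow> 'a \<Rightarrow> bool" where
  "is_sup S s \<longleftrightarrow> (\<forall>x \<in> K. x ~= \<zero> --> S x --> x \<le>v s) \<and>
     (\<forall>e \<in> K. e ~= \<zero> --> e <v s --> (\<exists>x \<in> K. x ~= \<zero> \<and> S x \<and> e <v x))"

text \<open>Without a supremum, \<open>S\<close> and its upper bounds form a gap, and on some
  annulus around it the question whether a value lies below an element of \<open>S\<close> would
  have a constant answer. There is room on both sides of the gap, with different answers.\<close>

lemma sup_exists:
  assumes S: "def1 S" and a: "a \<in> K" "a ~= \<zero>" "S a"
    and b: "b \<in> K" "b ~= \<zero>" "!!x. x \<in> K ==> x ~= \<zero> ==> S x ==> x \<le>v b"
  shows "\<exists>s \<in> K. s ~= \<zero> \<and> is_sup S s"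
proof (rule ccontr)
  assume no: "~ ?thesis"
  define A where "A = {x \<in> K. x ~= \<zero> \<and> S x}"
  define Bs where "Bs = {y \<in> K. y ~= \<zero> \<and> (\<forall>x \<in> A. x \<le>v y)}"
  have nosup: "\<exists>e \<in> Bs. e <v s" if "s \<in> Bs" for s
    using no that unfolding is_sup_def A_def Bs_def by blast
  note [dfn] = dp_subst1[OF S]
  have P: "def1 (\<lambda>y. \<exists>x \<in> K. x ~= \<zero> \<and> S x \<and> y \<le>v x)"
    unfolding def1_def by (intro dfn) auto
  have "\<exists>a \<in> A. \<exists>b \<in> Bs.
      (\<forall>y \<in> K. a <v y --> y <v b --> (\<exists>x \<in> K. x ~= \<zero> \<and> S x \<and> y \<le>v x)) \<or>
      (\<forall>y \<in> K. a <v y --> y <v b --> ~ (\<exists>x \<in> K. x ~= \<zero> \<and> S x \<and> y \<le>v x))"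
  proof (rule annulus_dichotomy[OF P])
    show "A ~= {}" "Bs ~= {}" using a b by (auto simp: A_def Bs_def)
    show "A \<subseteq> K" "Bs \<subseteq> K" by (auto simp: A_def Bs_def)
    fix d assume d: "d \<in> K" "d ~= \<zero>"
    show "(\<exists>a \<in> A. d \<le>v a) \<or> (\<exists>b \<in> Bs. b \<le>v d)"
    proof (cases "\<exists>a \<in> A. d \<le>v a")
      case False
      then have "d \<in> Bs" using d lt_imp_le unfolding A_def Bs_def by blast
      then show ?thesis using d le_refl by blast
    qed blast
  qed
  then obtain p q where p: "p \<in> A" and q: "q \<in> Bs"
    and pq: "(\<forall>y \<in> K. p <v y --> y <v q --> (\<exists>x \<in> A. y \<le>v x)) \<or>
      (\<forall>y \<in> K. p <v y --> y <v q --> ~ (\<exists>x \<in> A. y \<le>v x))"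
    unfolding A_def by blast
  have AK: "x \<in> A ==> x \<in> K" and BK: "x \<in> Bs ==> x \<in> K" for x by (auto simp: A_def Bs_def)
  have up: "\<exists>x' \<in> A. x <v x'" if "x \<in> A" for x
  proof (rule ccontr)
    assume "~ ?thesis"
    then have "x \<in> Bs" using that by (auto simp: A_def Bs_def)
    then obtain e where "e \<in> Bs" "e <v x" using nosup by blast
    then show False using that by (auto simp: Bs_def)
  qed
  from pq show False
  proof
    assume *: "\<forall>y \<in> K. p <v y --> y <v q --> (\<exists>x \<in> A. y \<le>v x)"
    \<comment> \<open>Two steps down inside \<open>Bs\<close>: the upper bound \<open>e'\<close>
      strictly below \<open>e\<close> shows that no element of \<open>S\<close> reaches
      \<open>e\<close>.\<close>
    obtain e where e: "e \<in> Bs" "e <v q" using nosup q by blast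
    obtain e' where e': "e' \<in> Bs" "e' <v e" using nosup e by blast
    have "p \<le>v e'" using p e' by (simp add: Bs_def)
    then have "p <v e" using e' p e AK BK le_trans[of e p e'] by blast
    then obtain x where "x \<in> A" "e \<le>v x" using * e BK by blast
    moreover have "x \<le>v e'" using \<open>x \<in> A\<close> e' by (simp add: Bs_def)
    ultimately show False using e e' AK BK le_trans[of e x e'] by blast
  next
    assume *: "\<forall>y \<in> K. p <v y --> y <v q --> ~ (\<exists>x \<in> A. y \<le>v x)"
    obtain p' where p': "p' \<in> A" "p <v p'" using up p by blast
    obtain p'' where p'': "p'' \<in> A" "p' <v p''" using up p' by blast
    have "p'' \<le>v q" using p'' q by (simp add: Bs_def)
    then have "p' <v q" using p' p'' q AK BK le_trans[of p'' q p'] by blast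
    then show False using * p' AK le_refl by blast
  qed
qed

text \<open>
  A definable map on the value group with bounded fibres is eventually injective: the suprema of
  its fibres are cofinal, so by \<open>C\<close>-minimality every large value is the supremum of a fibre, which
  forces it to be the maximum of its own fibre.
\<close>

lemma eventually_injective:
  assumes R: "def2 r"
    and inv: "ev (\<lambda>x. \<forall>u \<in> K. u =v \<one> --> (\<forall>d \<in> K. r (u \<otimes> x) d \<longleftrightarrow> r x d))"
    and bdd: "!!x. x \<in> K ==> x ~= \<zero> ==> ev (\<lambda>y. \<exists>d \<in> K. ~ (r x d \<longleftrightarrow> r y d))"
  shows "\<exists>e \<in> K. e ~= \<zero> \<and> (\<forall>x \<in> K. \<forall>y \<in> K. x ~= \<zero> --> y ~= \<zero> --> e <v x --> e <v y -->
           (\<forall>d \<in> K. r x d \<longleftrightarrow> r y d) --> x =v y)"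
proof -
  note [dfn] = dp_subst2[OF R]
  \<comment> \<open>The map in question sends \<open>x\<close> to the set of all \<open>d\<close>
    with \<open>r x d\<close>, so \<open>Q\<close> is equality of images.\<close>
  define Q where "Q x y \<longleftrightarrow> (\<forall>d \<in> K. r x d \<longleftrightarrow> r y d)" for x y
  have Qdef: "def2 Q" unfolding Q_def def2_def by (intro dfn) auto
  note [dfn] = dp_subst2[OF Qdef]
  have Qrefl: "Q x x" and Qsym: "Q x y ==> Q y x" and Qtrans: "Q x y ==> Q y z ==> Q x z" for x y z
    unfolding Q_def by auto
  obtain e0 where e0: "e0 \<in> K" "e0 ~= \<zero>"
    and inv0: "!!x u d. x \<in> K ==> x ~= \<zero> ==> e0 <v x ==> u \<in> K ==> u =v \<one> ==> d \<in> K ==> r (u \<otimes> x) d \<longleftrightarrow> r x d"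
    using inv unfolding ev_def by blast
  have Qeqv: "Q y x" if "x \<in> K" "y \<in> K" "x ~= \<zero>" "y ~= \<zero>" "e0 <v x" "y =v x" for x y
  proof -
    have "y \<otimes> inv x =v \<one>" using eqv_mult_iff(1)[of y x "inv x"] that by simp
    moreover have "y \<otimes> inv x \<otimes> x = y" using that by simp
    ultimately show ?thesis using inv0[of x "y \<otimes> inv x"] that by (simp add: Q_def)
  qed
  define C where "C a x \<longleftrightarrow> e0 <v x \<and> Q a x" for a x
  have Cdef: "def2 C" unfolding C_def def2_def using e0 by (intro dfn) auto
  note [dfn] = dp_subst2[OF Cdef]
  define T where "T s \<longleftrightarrow> (\<exists>a \<in> K. a ~= \<zero> \<and> e0 <v a \<and> is_sup (C a) s)" for s
  have Tdef: "def1 T" unfolding T_def def1_def is_sup_def using e0 by (intro dfn) auto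
  have ex_sup: "\<exists>s \<in> K. s ~= \<zero> \<and> is_sup (C a) s" if a: "a \<in> K" "a ~= \<zero>" "e0 <v a" for a
  proof -
    obtain e where e: "e \<in> K" "e ~= \<zero>" "!!y. y \<in> K ==> y ~= \<zero> ==> e <v y ==> ~ Q a y"
      using bdd[OF a(1,2)] unfolding ev_def Q_def by blast
    have "def1 (C a)" unfolding def1_def using a by (intro dfn) auto
    moreover have "C a a" using a Qrefl by (simp add: C_def)
    ultimately show ?thesis using sup_exists[of "C a" a e] a e by (auto simp: C_def)
  qed
  have "~ ev (\<lambda>s. ~ T s)"
  proof
    assume "ev (\<lambda>s. ~ T s)"
    then obtain e where e: "e \<in> K" "e ~= \<zero>" "!!y. y \<in> K ==> y ~= \<zero> ==> e <v y ==> ~ T y"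
      unfolding ev_def by blast
    obtain c where c: "c \<in> K" "c ~= \<zero>" "e0 \<le>v c" "e \<le>v c" using exists_max e0 e(1,2) by blast
    obtain a where a: "a \<in> K" "a ~= \<zero>" "c <v a" using exists_gt c by blast
    have a': "e0 <v a" "e <v a" using a c e0 e le_lt_trans[of e0 c a] le_lt_trans[of e c a] by auto
    obtain s where s: "s \<in> K" "s ~= \<zero>" "is_sup (C a) s" using ex_sup a a' by blast
    have "a \<le>v s" using s(3) a a' Qrefl unfolding is_sup_def C_def by blast
    then have "e <v s" using a' a s e le_trans[of a s e] by blast
    moreover have "T s" using s a a' unfolding T_def by blast
    ultimately show False using e s by blast
  qed
  then have "ev T" using ev_dichotomy[OF Tdef] by blast
  then obtain e where e: "e \<in> K" "e ~= \<zero>" and eT: "!!y. y \<in> K ==> y ~= \<zero> ==> e <v y ==> T y"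
    unfolding ev_def by blast
  obtain m where m: "m \<in> K" "m ~= \<zero>" "e0 \<le>v m" "e \<le>v m" using exists_max e0 e by blast
  have gtm: "e0 <v x \<and> e <v x" if "m <v x" "x \<in> K" for x
    using le_lt_trans[of e0 m x] le_lt_trans[of e m x] m that e0 e by blast
  \<comment> \<open>The supremum of a fibre is attained. Just below \<open>s\<close> the fibre is
    either empty or everything.\<close>
  have top: "Q a s" if a: "a \<in> K" "a ~= \<zero>" and s: "s \<in> K" "s ~= \<zero>" "m <v s" "is_sup (C a) s" for a s
  proof -
    have "def1 (Q a)" unfolding def1_def using a by (intro dfn) auto
    then have "\<exists>c \<in> {c \<in> K. c ~= \<zero> \<and> c <v s}. \<exists>b \<in> {s}. (\<forall>x \<in> K. c <v x --> x <v b --> Q a x) \<or>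
        (\<forall>x \<in> K. c <v x --> x <v b --> ~ Q a x)"
      by (rule annulus_dichotomy) (use s exists_lt[of s] in auto)
    then obtain c where c: "c \<in> K" "c ~= \<zero>" "c <v s"
      and cs: "(\<forall>x \<in> K. c <v x --> x <v s --> Q a x) \<or> (\<forall>x \<in> K. c <v x --> x <v s --> ~ Q a x)"
      by blast
    from cs show ?thesis
    proof
      assume *: "\<forall>x \<in> K. c <v x --> x <v s --> ~ Q a x"
      obtain x where x: "x \<in> K" "x ~= \<zero>" "C a x" "c <v x" using s(4) c unfolding is_sup_def by blast
      have "x \<le>v s" using s(4) x unfolding is_sup_def by blast
      moreover have "s \<le>v x" using * x by (auto simp: C_def)
      ultimately have "Q s x" using Qeqv[of x s] x s by (simp add: eqv_def C_def)
      moreover have "Q a x" using x by (simp add: C_def)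
      ultimately show ?thesis using Qtrans Qsym by blast
    next
      assume *: "\<forall>x \<in> K. c <v x --> x <v s --> Q a x"
      \<comment> \<open>The fibre fills an interval below \<open>s\<close>. The interior point
        \<open>d2\<close> is the supremum of some fibre; that fibre meets the interval, so it is the
        fibre of \<open>a\<close>, which also contains \<open>d3\<close> above
        \<open>d2\<close>.\<close>
      obtain c' where c': "c' \<in> K" "c' ~= \<zero>" "c' <v s" "c \<le>v c'" "m \<le>v c'"
        using c m s le_total[of c m] le_refl by blast
      obtain d1 where d1: "d1 \<in> K" "d1 ~= \<zero>" "c' <v d1" "d1 <v s" using dense c' s by blast
      obtain d2 where d2: "d2 \<in> K" "d2 ~= \<zero>" "d1 <v d2" "d2 <v s" using dense d1 s by blast
      obtain d3 where d3: "d3 \<in> K" "d3 ~= \<zero>" "d2 <v d3" "d3 <v s" using dense d2 s by blast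
      have cd1: "c <v d1" using c' d1 c le_lt_trans[of c c' d1] by blast
      have gt: "m <v d1" "m <v d2" "m <v d3"
        using c' d1 d2 d3 m le_lt_trans[of m c' d1] lt_trans[where x = m and y = d1 and z = d2]
          lt_trans[where x = m and y = d1 and z = d3] lt_trans[where x = d1 and y = d2 and z = d3] by blast+
      have cgt: "c <v d2" "c <v d3"
        using cd1 c d1 d2 d3 lt_trans[where x = c and y = d1 and z = d2]
          lt_trans[where x = c and y = d1 and z = d3] lt_trans[where x = d1 and y = d2 and z = d3] by blast+
      have "T d2" using eT gtm gt d2 by blast
      then obtain b where b: "b \<in> K" "b ~= \<zero>" "e0 <v b" "is_sup (C b) d2" unfolding T_def by blast
      obtain x where x: "x \<in> K" "x ~= \<zero>" "C b x" "d1 <v x" using b(4) d1 d2 unfolding is_sup_def by blast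
      have xd2: "x \<le>v d2" using b(4) x unfolding is_sup_def by blast
      have "x <v s" using xd2 d2 x s le_lt_trans[of x d2 s] by blast
      moreover have "c <v x" using cd1 x d1 c lt_trans[where x = c and y = d1 and z = x] by blast
      ultimately have "Q a x" using * x by blast
      moreover have "Q b x" using x by (simp add: C_def)
      ultimately have "Q b a" using Qsym Qtrans by blast
      moreover have "Q a d3" using * d3 cgt by blast
      ultimately have "Q b d3" using Qtrans by blast
      then have "C b d3" using gtm gt d3 by (simp add: C_def)
      then have "d3 \<le>v d2" using b(4) d3 unfolding is_sup_def by blast
      then show ?thesis using d3 by blast
    qed
  qed
  have sup_self: "y \<le>v x" if xy: "x \<in> K" "y \<in> K" "x ~= \<zero>" "y ~= \<zero>" "m <v x" "m <v y" "Q x y" for x y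
  proof -
    have "T x" using eT gtm xy by blast
    then obtain a where a: "a \<in> K" "a ~= \<zero>" "is_sup (C a) x" unfolding T_def by blast
    then have "Q a x" using top xy by blast
    then have "Q a y" using Qtrans xy by blast
    then have "C a y" using xy gtm by (simp add: C_def)
    then show ?thesis using a(3) xy unfolding is_sup_def by blast
  qed
  then show ?thesis using m Qsym unfolding Q_def[symmetric] eqv_def by (intro bexI[of _ m]) blast+
qed

text \<open>
  Orthogonality of residue field and value group: an increasing definable family of finite subsets
  of the residue field, indexed by the value group, is eventually constant, as otherwise it would
  be eventually injective.
\<close>

lemma ev_residue_swap:
  assumes P: "def2 P"
    and res: "!!w w' x. w \<in> K ==> w' \<in> K ==> x \<in> K ==> \<one> \<le>v w ==> \<one> <v w' \<ominus> w ==> P w x ==> P w' x"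
    and all: "!!w. w \<in> K ==> \<one> \<le>v w ==> ev (P w)"
  shows "ev (\<lambda>x. \<forall>w \<in> K. \<one> \<le>v w --> P w x)"
proof -
  note [dfn] = dp_subst2[OF P]
  \<comment> \<open>By \<open>res\<close>, \<open>E a\<close> is a union of residue classes; it
    grows with \<open>v(a)\<close>, and by \<open>all\<close> every class belongs to it
    eventually.\<close>
  define E where "E a w \<longleftrightarrow> \<one> \<le>v w \<and> (\<forall>x \<in> K. x ~= \<zero> --> a <v x --> P w x)" for a w
  have Edef: "def2 E" unfolding def2_def E_def by (intro dfn) auto
  note [dfn] = dp_subst2[OF Edef]
  have Emono: "E b w" if "E a w" "a \<le>v b" "a \<in> K" "b \<in> K" for a b w
    using that le_lt_trans[of a b] unfolding E_def by blast
  have Eres: "E a w'" if "E a w" "\<one> <v w' \<ominus> w" "a \<in> K" "w \<in> K" "w' \<in> K" for a w w'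
  proof -
    have "\<one> \<le>v w' \<ominus> w" "\<one> \<le>v w" using that lt_imp_le[of "w' \<ominus> w" \<one>] by (auto simp: E_def)
    then have "\<one> \<le>v (w' \<ominus> w) \<oplus> w" using that le_add[of \<one> "w' \<ominus> w" w] by simp
    then have "\<one> \<le>v w'" using diff_cancel that by simp
    then show ?thesis using that res unfolding E_def by blast
  qed
  have Eex: "\<exists>a \<in> K. a ~= \<zero> \<and> E a w" if "w \<in> K" "\<one> \<le>v w" for w
    using all[OF that] that unfolding ev_def E_def by blast
  define near where "near W w \<longleftrightarrow> (\<exists>v \<in> W. \<one> <v w \<ominus> v)" for W w
  show ?thesis
  proof (cases "\<exists>a W. a \<in> K \<and> a ~= \<zero> \<and> finite W \<and> W \<subseteq> {w \<in> K. \<one> \<le>v w} \<and>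
      (\<forall>w \<in> K. \<one> \<le>v w --> ~ near W w --> E a w)")
    case True
    \<comment> \<open>Some \<open>E a\<close> misses only finitely many classes. Each of these
      enters later, and finitely many bounds have a maximum.\<close>
    then obtain a W where a: "a \<in> K" "a ~= \<zero>" and W: "finite W" "W \<subseteq> {w \<in> K. \<one> \<le>v w}"
      and aw: "!!w. w \<in> K ==> \<one> \<le>v w ==> ~ near W w ==> E a w" by blast
    have "\<exists>b \<in> K. b ~= \<zero> \<and> (\<forall>w \<in> W. E b w)" using W
    proof (induction W rule: finite_induct)
      case empty
      then show ?case using a by blast
    next
      case (insert w W)
      then obtain b where b: "b \<in> K" "b ~= \<zero>" "\<forall>w \<in> W. E b w" by auto
      obtain c where c: "c \<in> K" "c ~= \<zero>" "E c w" using Eex insert by blast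
      obtain d where d: "d \<in> K" "d ~= \<zero>" "b \<le>v d" "c \<le>v d" using exists_max b c by blast
      then have "\<forall>w \<in> insert w W. E d w" using b c Emono by blast
      with d show ?case by blast
    qed
    then obtain b where b: "b \<in> K" "b ~= \<zero>" "!!w. w \<in> W ==> E b w" by blast
    obtain d where d: "d \<in> K" "d ~= \<zero>" "a \<le>v d" "b \<le>v d" using exists_max a b by blast
    have "E d w" if w: "w \<in> K" "\<one> \<le>v w" for w
    proof (cases "near W w")
      case True
      then obtain v where "v \<in> W" "\<one> <v w \<ominus> v" unfolding near_def by blast
      then have "E b w" using Eres b w W by blast
      then show ?thesis using Emono b d by blast
    next
      case False
      then show ?thesis using aw w Emono a d by blast
    qed
    then show ?thesis using d unfolding ev_def E_def by blast
  next
    case False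
    \<comment> \<open>No \<open>E a\<close> is cofinite, so by \<open>residue_dichotomy\<close> each
      is covered by finitely many classes.\<close>
    have small: "\<exists>W. finite W \<and> W \<subseteq> {w \<in> K. \<one> \<le>v w} \<and> (\<forall>w \<in> K. E a w --> near W w)"
      if a: "a \<in> K" "a ~= \<zero>" for a
    proof -
      have "def1 (E a)" unfolding def1_def using a by (intro dfn) auto
      from residue_dichotomy[OF this] obtain W where W: "finite W" and sub: "W \<subseteq> {w \<in> K. \<one> \<le>v w}"
        and 2: "(\<forall>x \<in> K. \<one> \<le>v x --> (\<forall>w \<in> W. x \<ominus> w \<le>v \<one>) --> E a x) \<or>
           (\<forall>x \<in> K. \<one> \<le>v x --> (\<forall>w \<in> W. x \<ominus> w \<le>v \<one>) --> ~ E a x)" by blast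
      have "~ (\<forall>x \<in> K. \<one> \<le>v x --> (\<forall>w \<in> W. x \<ominus> w \<le>v \<one>) --> E a x)"
      proof
        assume "\<forall>x \<in> K. \<one> \<le>v x --> (\<forall>w \<in> W. x \<ominus> w \<le>v \<one>) --> E a x"
        then have "\<forall>w \<in> K. \<one> \<le>v w --> ~ near W w --> E a w" by (simp add: near_def)
        with a W sub False show False by blast
      qed
      then have "\<forall>x \<in> K. \<one> \<le>v x --> (\<forall>w \<in> W. x \<ominus> w \<le>v \<one>) --> ~ E a x" using 2 by blast
      then have "\<forall>w \<in> K. E a w --> near W w" unfolding near_def by (auto simp: E_def)
      with W sub show ?thesis by blast
    qed
    have "\<exists>e \<in> K. e ~= \<zero> \<and> (\<forall>x \<in> K. \<forall>y \<in> K. x ~= \<zero> --> y ~= \<zero> --> e <v x --> e <v y -->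
           (\<forall>d \<in> K. E x d \<longleftrightarrow> E y d) --> x =v y)"
    proof (rule eventually_injective[OF Edef])
      have "E (u \<otimes> x) d = E x d" if "u \<in> K" "u =v \<one>" "x \<in> K" "x ~= \<zero>" "d \<in> K" for u x d
      proof -
        have "u \<otimes> x =v x" using eqv_mult_iff(1)[of u \<one> x] that by simp
        then show ?thesis using Emono[of x d "u \<otimes> x"] Emono[of "u \<otimes> x" d x] that by (auto simp: eqv_def)
      qed
      then show "ev (\<lambda>x. \<forall>u \<in> K. u =v \<one> --> (\<forall>d \<in> K. E (u \<otimes> x) d \<longleftrightarrow> E x d))"
        by (intro ev_True) auto
      fix x assume x: "x \<in> K" "x ~= \<zero>"
      obtain W where W: "finite W" "W \<subseteq> {w \<in> K. \<one> \<le>v w}" "\<forall>w \<in> K. E x w --> near W w"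
        using small[OF x] by blast
      \<comment> \<open>Fibres are bounded: a class outside the finite set \<open>E x\<close> exists
        and enters eventually.\<close>
      obtain w where w: "w \<in> K" "\<one> \<le>v w" "\<forall>v \<in> W. w \<ominus> v \<le>v \<one>"
        using residue_field_infinite[of W] W by blast
      then have n: "~ E x w" using W unfolding near_def by blast
      obtain a where a: "a \<in> K" "a ~= \<zero>" "E a w" using Eex w by blast
      have "ev (\<lambda>y. E y w)" using a Emono lt_imp_le unfolding ev_def by blast
      then show "ev (\<lambda>y. \<exists>d \<in> K. ~ (E x d \<longleftrightarrow> E y d))" by (rule ev_mono) (use n w in blast)
    qed
    then obtain e where e: "e \<in> K" "e ~= \<zero>"
      and inj: "!!x y. x \<in> K ==> y \<in> K ==> x ~= \<zero> ==> y ~= \<zero> ==> e <v x ==> e <v y ==>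
           (\<forall>d \<in> K. E x d \<longleftrightarrow> E y d) ==> x =v y" by blast
    obtain g where g: "g \<in> K" "g ~= \<zero>" "e <v g" using exists_gt e by blast
    obtain W where W: "finite W" "W \<subseteq> {w \<in> K. \<one> \<le>v w}" "\<forall>w \<in> K. E g w --> near W w"
      using small[OF g(1,2)] by blast
    \<comment> \<open>For \<open>x\<close> between \<open>e\<close> and \<open>g\<close> all classes
      of \<open>E x\<close> are represented in \<open>W\<close>, and \<open>N\<close> counts their
      representatives. At a minimum of \<open>N\<close> a slightly smaller value, given by density,
      has the same set \<open>E\<close>, against injectivity.\<close>
    define N where "N x = card {v \<in> W. \<exists>w \<in> K. \<one> <v w \<ominus> v \<and> E x w}" for x
    define Z where "Z x \<longleftrightarrow> x \<in> K \<and> x ~= \<zero> \<and> e <v x \<and> x \<le>v g" for x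
    have "Z g" using g by (simp add: Z_def)
    then obtain x where x: "Z x" "!!y. Z y ==> N x \<le> N y" using ex_has_least_nat[of Z g N] by blast
    have xK: "x \<in> K" "x ~= \<zero>" "e <v x" "x \<le>v g" using x by (auto simp: Z_def)
    obtain y where y: "y \<in> K" "y ~= \<zero>" "e <v y" "y <v x" using dense[OF xK(3)] e xK by blast
    have yx: "y \<le>v x" using y xK lt_imp_le by blast
    have "Z y" using y xK yx le_trans[of y x g] g by (auto simp: Z_def)
    have sub: "{v \<in> W. \<exists>w \<in> K. \<one> <v w \<ominus> v \<and> E y w} \<subseteq> {v \<in> W. \<exists>w \<in> K. \<one> <v w \<ominus> v \<and> E x w}"
      using Emono yx y xK by blast
    then have eq: "{v \<in> W. \<exists>w \<in> K. \<one> <v w \<ominus> v \<and> E y w} = {v \<in> W. \<exists>w \<in> K. \<one> <v w \<ominus> v \<and> E x w}"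
      using x(2)[OF \<open>Z y\<close>] W(1) unfolding N_def by (intro card_seteq) auto
    have "E y d" if d: "d \<in> K" "E x d" for d
    proof -
      have "E g d" using Emono d xK g by blast
      then obtain v where v: "v \<in> W" "\<one> <v d \<ominus> v" using W d unfolding near_def by blast
      then have "v \<in> {v \<in> W. \<exists>w \<in> K. \<one> <v w \<ominus> v \<and> E y w}" using d unfolding eq by blast
      then obtain w where w: "w \<in> K" "\<one> <v w \<ominus> v" "E y w" by blast
      have vK: "v \<in> K" using v W by blast
      have "\<one> <v v \<ominus> w" using w vK diff_sym by simp
      then have "\<one> <v d \<ominus> w" using lt_diff_trans[where x = d and y = v and g = \<one> and z = w] v vK d w by auto
      then show ?thesis using Eres w y d by blast
    qed
    then have "y =v x" using inj[of y x] y xK Emono yx by blast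
    then show ?thesis using y by (simp add: eqv_def)
  qed
qed

text \<open>Invariance under \<open>u\<close> need not depend only on the residue of
  \<open>u\<close>, so \<open>ev_residue_swap\<close> is applied to the weaker condition that each
  unit class contains a good unit. For fixed \<open>x\<close> the residue dichotomy then makes all
  units off finitely many classes good, and comparing two good units covers the rest.\<close>

lemma ev_const_on_annuli:
  assumes R: "def2 r"
    and inv: "!!u. u \<in> K ==> u =v \<one> ==> ev (\<lambda>x. \<forall>d \<in> K. r (u \<otimes> x) d \<longleftrightarrow> r x d)"
  shows "ev (\<lambda>x. \<forall>u \<in> K. u =v \<one> --> (\<forall>d \<in> K. r (u \<otimes> x) d \<longleftrightarrow> r x d))"
proof -
  note [dfn] = dp_subst2[OF R]
  define Q where "Q x y \<longleftrightarrow> (\<forall>d \<in> K. r x d \<longleftrightarrow> r y d)" for x y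
  have Qdef: "def2 Q" unfolding Q_def def2_def by (intro dfn) auto
  note [dfn] = dp_subst2[OF Qdef]
  have Qsym: "Q x y ==> Q y x" and Qtrans: "Q x y ==> Q y z ==> Q x z" for x y z
    unfolding Q_def by auto
  define P where "P w x \<longleftrightarrow> \<one> <v w \<or> (\<exists>u \<in> K. u =v \<one> \<and> \<one> <v u \<ominus> w \<and> Q (u \<otimes> x) x)" for w x
  have Pdef: "def2 P" unfolding def2_def P_def by (intro dfn) auto
  have "ev (\<lambda>x. \<forall>w \<in> K. \<one> \<le>v w --> P w x)"
  proof (rule ev_residue_swap[OF Pdef])
    fix w assume w: "w \<in> K" "\<one> \<le>v w"
    show "ev (P w)"
    proof (cases "w =v \<one>")
      case True
      then show ?thesis using inv[OF w(1) True] w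
        by (elim ev_mono) (auto simp: P_def Q_def intro!: bexI[of _ w])
    next
      case False
      then show ?thesis using w by (intro ev_True) (auto simp: P_def eqv_def)
    qed
  next
    fix w w' x assume *: "w \<in> K" "w' \<in> K" "x \<in> K" "\<one> \<le>v w" "\<one> <v w' \<ominus> w" "P w x"
    then have **: "\<one> <v w \<ominus> w'" using diff_sym by simp
    from \<open>P w x\<close> show "P w' x" unfolding P_def
    proof
      assume "\<one> <v w"
      then have "\<one> <v w \<ominus> (w \<ominus> w')" using ** * lt_diff[where g = \<one> and x = w and y = "w \<ominus> w'"] by simp
      then have "\<one> <v w'" using diff_cancel * by simp
      then show "\<one> <v w' \<or> (\<exists>u \<in> K. u =v \<one> \<and> \<one> <v u \<ominus> w' \<and> Q (u \<otimes> x) x)" by blast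
    next
      assume "\<exists>u \<in> K. u =v \<one> \<and> \<one> <v u \<ominus> w \<and> Q (u \<otimes> x) x"
      then obtain u where u: "u \<in> K" "u =v \<one>" "\<one> <v u \<ominus> w" "Q (u \<otimes> x) x" by blast
      then have "\<one> <v u \<ominus> w'" using ** * lt_diff_trans[where x = u and y = w and g = \<one> and z = w'] by blast
      then show "\<one> <v w' \<or> (\<exists>u \<in> K. u =v \<one> \<and> \<one> <v u \<ominus> w' \<and> Q (u \<otimes> x) x)" using u by blast
    qed
  qed
  then obtain e where e: "e \<in> K" "e ~= \<zero>"
    and eP: "!!x w. x \<in> K ==> x ~= \<zero> ==> e <v x ==> w \<in> K ==> \<one> \<le>v w ==> P w x" unfolding ev_def by blast
  have cogen: "\<exists>W. finite W \<and> W \<subseteq> {w \<in> K. \<one> \<le>v w} \<and>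
      (\<forall>u \<in> K. u =v \<one> --> (\<forall>w \<in> W. u \<ominus> w \<le>v \<one>) --> Q (u \<otimes> x) x)"
    if x: "x \<in> K" "x ~= \<zero>" "e <v x" for x
  proof -
    have "def1 (\<lambda>u. Q (u \<otimes> x) x)" unfolding def1_def using x by (intro dfn) auto
    from residue_dichotomy[OF this] obtain W where W: "finite W" and sub: "W \<subseteq> {w \<in> K. \<one> \<le>v w}"
      and 2: "(\<forall>u \<in> K. \<one> \<le>v u --> (\<forall>w \<in> W. u \<ominus> w \<le>v \<one>) --> Q (u \<otimes> x) x) \<or>
         (\<forall>u \<in> K. \<one> \<le>v u --> (\<forall>w \<in> W. u \<ominus> w \<le>v \<one>) --> ~ Q (u \<otimes> x) x)" by blast
    have "~ (\<forall>u \<in> K. \<one> \<le>v u --> (\<forall>w \<in> W. u \<ominus> w \<le>v \<one>) --> ~ Q (u \<otimes> x) x)"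
    proof
      assume *: "\<forall>u \<in> K. \<one> \<le>v u --> (\<forall>w \<in> W. u \<ominus> w \<le>v \<one>) --> ~ Q (u \<otimes> x) x"
      \<comment> \<open>Avoiding \<open>\<zero>\<close> as well makes \<open>w\<close> a unit, so
        the first alternative in \<open>P\<close> is excluded.\<close>
      have "\<exists>w \<in> K. \<one> \<le>v w \<and> (\<forall>v \<in> insert \<zero> W. w \<ominus> v \<le>v \<one>)"
        by (rule residue_field_infinite) (use W sub in auto)
      then obtain w where w: "w \<in> K" "\<one> \<le>v w" "\<forall>v \<in> insert \<zero> W. w \<ominus> v \<le>v \<one>" by blast
      have "P w x" using eP x w by blast
      moreover have "~ \<one> <v w" using w by simp
      ultimately obtain u where u: "u \<in> K" "u =v \<one>" "\<one> <v u \<ominus> w" "Q (u \<otimes> x) x" unfolding P_def by blast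
      have "u \<ominus> v \<le>v \<one>" if v: "v \<in> W" for v
      proof (rule ccontr)
        assume "\<one> <v u \<ominus> v"
        moreover have "\<one> <v w \<ominus> u" using u w diff_sym by simp
        ultimately have "\<one> <v w \<ominus> v" using lt_diff_trans[where x = w and y = u and g = \<one> and z = v] u w v sub by blast
        then show False using w v by blast
      qed
      then show False using * u by (auto simp: eqv_def)
    qed
    then have "\<forall>u \<in> K. \<one> \<le>v u --> (\<forall>w \<in> W. u \<ominus> w \<le>v \<one>) --> Q (u \<otimes> x) x" using 2 by blast
    then show ?thesis using W sub unfolding eqv_def by blast
  qed
  have "Q (s \<otimes> x) x" if x: "x \<in> K" "x ~= \<zero>" "e <v x" and s: "s \<in> K" "s =v \<one>" for x s
  proof -
    have s0: "s ~= \<zero>" using s eqv_zero_iff[of s \<one>] by auto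
    have sx: "s \<otimes> x =v x" using eqv_mult_iff(1)[of s \<one> x] x s by simp
    then have "e <v s \<otimes> x" using eqv_le(1)[OF sx] x s e by simp
    then obtain V where V: "finite V" "V \<subseteq> {w \<in> K. \<one> \<le>v w}"
      "\<forall>u \<in> K. u =v \<one> --> (\<forall>w \<in> V. u \<ominus> w \<le>v \<one>) --> Q (u \<otimes> (s \<otimes> x)) (s \<otimes> x)"
      using cogen[of "s \<otimes> x"] x s s0 by auto
    obtain W where W: "finite W" "W \<subseteq> {w \<in> K. \<one> \<le>v w}"
      "\<forall>u \<in> K. u =v \<one> --> (\<forall>w \<in> W. u \<ominus> w \<le>v \<one>) --> Q (u \<otimes> x) x" using cogen[OF x] by (elim exE conjE)
    \<comment> \<open>A unit \<open>u\<close> is wanted that is good for \<open>x\<close> while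
      \<open>u / s\<close> is good for \<open>s x\<close>. Both then relate to the same element
      \<open>u x\<close>, which links \<open>x\<close> with \<open>s x\<close>.\<close>
    have "\<exists>u \<in> K. \<one> \<le>v u \<and> (\<forall>w \<in> insert \<zero> (W \<union> (\<otimes>) s ` V). u \<ominus> w \<le>v \<one>)"
      using W V s one_le_mult[of s] by (intro residue_field_infinite) (auto simp: eqv_def)
    then obtain u where u: "u \<in> K" "\<one> \<le>v u" "u \<ominus> \<zero> \<le>v \<one>" "\<forall>w \<in> W. u \<ominus> w \<le>v \<one>"
      "\<forall>w \<in> V. u \<ominus> s \<otimes> w \<le>v \<one>" by auto
    have u1: "u =v \<one>" using u by (simp add: eqv_def)
    then have Q1: "Q (u \<otimes> x) x" using W u by blast
    have si: "inv s =v \<one>" using eqv_mult_iff(1)[of s \<one> "inv s"] s s0 by (simp add: eqv_sym)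
    have us: "u \<otimes> inv s =v \<one>" using eqv_mult_iff(1)[of u \<one> "inv s"] u1 u s s0 si
      eqv_trans[of "u \<otimes> inv s" "inv s" \<one>] by simp
    have "u \<otimes> inv s \<ominus> w \<le>v \<one>" if w: "w \<in> V" for w
    proof -
      have wK: "w \<in> K" using w V by blast
      define z where "z = u \<otimes> inv s"
      have z: "z \<in> K" "s \<otimes> z = u" using u s s0 by (simp_all add: z_def m_comm[of u])
      have "s \<otimes> (z \<ominus> w) = s \<otimes> z \<ominus> s \<otimes> w" using z(1) wK s(1) by (simp add: a_minus_def r_distr r_minus)
      then have "s \<otimes> (z \<ominus> w) \<le>v \<one>" using u w z by simp
      then have "s \<otimes> (z \<ominus> w) \<le>v s" using eqv_le(2)[OF s(2), of "s \<otimes> (z \<ominus> w)"] s z wK by simp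
      then show ?thesis using mult_le_iff(2)[of "z \<ominus> w" \<one> s] s s0 z wK by (simp add: z_def)
    qed
    then have "Q (u \<otimes> inv s \<otimes> (s \<otimes> x)) (s \<otimes> x)" using V us u s s0 by auto
    moreover have "u \<otimes> inv s \<otimes> (s \<otimes> x) = u \<otimes> x" using u s s0 x by (simp add: m_assoc)
    ultimately show ?thesis using Q1 Qsym Qtrans by metis
  qed
  then show ?thesis unfolding ev_def Q_def using e by blast
qed

text \<open>If no class were eventually right, each would be eventually wrong; by
  \<open>ev_residue_swap\<close> all would be wrong at one \<open>x\<close>, against
  \<open>tot\<close>. In effect, a definable residue depending on \<open>x\<close> is eventually
  constant.\<close>

lemma ev_residue_const:
  assumes G: "def2 G"
    and res: "!!w w' x. w \<in> K ==> w' \<in> K ==> x \<in> K ==> \<one> \<le>v w ==> \<one> <v w' \<ominus> w ==> G w x ==> G w' x"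
    and tot: "ev (\<lambda>x. \<exists>w \<in> K. \<one> \<le>v w \<and> G w x)"
  shows "\<exists>w \<in> K. \<one> \<le>v w \<and> ev (G w)"
proof (rule ccontr)
  note [dfn] = dp_subst2[OF G]
  assume no: "~ ?thesis"
  have "ev (\<lambda>x. ~ G w x)" if "w \<in> K" "\<one> \<le>v w" for w
  proof -
    have "def1 (G w)" unfolding def1_def using that by (intro dfn) auto
    then show ?thesis using ev_dichotomy no that by blast
  qed
  moreover have "def2 (\<lambda>w x. ~ G w x)" unfolding def2_def by (intro dfn) auto
  moreover have "~ G w' x" if "w \<in> K" "w' \<in> K" "x \<in> K" "\<one> \<le>v w" "\<one> <v w' \<ominus> w" "~ G w x" for w w' x
  proof -
    have "\<one> \<le>v (w' \<ominus> w) \<oplus> w" using that lt_imp_le[of "w' \<ominus> w" \<one>] le_add[of \<one> "w' \<ominus> w" w] by simp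
    then have "\<one> \<le>v w'" using diff_cancel that by simp
    moreover have "\<one> <v w \<ominus> w'" using that diff_sym by simp
    ultimately show ?thesis using res[of w' w x] that by blast
  qed
  ultimately have "ev (\<lambda>x. \<forall>w \<in> K. \<one> \<le>v w --> ~ G w x)"
    by (intro ev_residue_swap) auto
  then show False using tot ev_exists[OF ev_conj] by blast
qed

section \<open>Limits at zero\<close>

lemma unit_nonzero: "u \<in> K ==> u =v \<one> ==> u ~= \<zero>"
  using eqv_zero_iff[of u \<one>] by auto

lemma unit_inv: "u \<in> K ==> u =v \<one> ==> inv u =v \<one>"
  using eqv_mult_iff(1)[of u \<one> "inv u"] unit_nonzero[of u] by (simp add: eqv_sym)

lemma unit_mult:
  assumes "u \<in> K" "w \<in> K" "u =v \<one>" "w =v \<one>" shows "u \<otimes> w =v \<one>"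
  using eqv_mult_iff(1)[of u \<one> w] unit_nonzero[of w] eqv_trans[of "u \<otimes> w" w \<one>] assms by simp

text \<open>For a unit \<open>w\<close>, the quotient \<open>s / u\<close> avoids the class of
  \<open>w\<close> exactly when \<open>u\<close> avoids that of \<open>s / w\<close>. So both
  demands exclude finitely many classes of \<open>u\<close>; the class of \<open>\<zero>\<close> is
  excluded to make \<open>u\<close> a unit.\<close>

lemma exists_unit_avoiding:
  assumes W: "finite W" "W \<subseteq> {w \<in> K. \<one> \<le>v w}" and s: "s \<in> K" "s =v \<one>"
  shows "\<exists>u \<in> K. u =v \<one> \<and> (\<forall>w \<in> W. u \<ominus> w \<le>v \<one>) \<and> (\<forall>w \<in> W. s \<otimes> inv u \<ominus> w \<le>v \<one>)"
proof -
  define V where "V = insert \<zero> (W \<union> (\<lambda>w. s \<otimes> inv w) ` {w \<in> W. w =v \<one>})"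
  have unit: "s \<otimes> inv w \<in> K \<and> s \<otimes> inv w =v \<one>" if "w \<in> K" "w =v \<one>" for w
    using that s unit_mult[of s "inv w"] unit_inv[of w] unit_nonzero[of w] by simp
  have "\<exists>u \<in> K. \<one> \<le>v u \<and> (\<forall>v \<in> V. u \<ominus> v \<le>v \<one>)"
  proof (rule residue_field_infinite)
    show "finite V" using W by (simp add: V_def)
    show "V \<subseteq> K" using W unit by (auto simp: V_def)
    show "\<one> \<le>v v" if "v \<in> V" for v using that W unit by (auto simp: V_def eqv_def)
  qed
  then obtain u where u: "u \<in> K" "\<one> \<le>v u" "!!v. v \<in> V ==> u \<ominus> v \<le>v \<one>" by blast
  have u1: "u =v \<one>" using u(3)[of \<zero>] u by (simp add: V_def eqv_def)
  have u0: "u ~= \<zero>" using unit_nonzero u u1 by blast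
  have "s \<otimes> inv u \<ominus> w \<le>v \<one>" if w: "w \<in> W" for w
  proof (cases "w =v \<one>")
    case True
    have wK: "w \<in> K" "w ~= \<zero>" using w W True unit_nonzero by auto
    have "u \<ominus> s \<otimes> inv w \<le>v \<one>" using u(3) w True by (simp add: V_def)
    then have 1: "s \<otimes> inv w \<ominus> u \<le>v \<one>" using diff_sym u s wK by simp
    define p q where "p = inv w" and "q = inv u"
    have pq: "p \<in> K" "q \<in> K" "w \<otimes> p = \<one>" "u \<otimes> q = \<one>" using wK u u0 by (simp_all add: p_def q_def)
    \<comment> \<open>This identity turns the distance of \<open>u\<close> from \<open>s / w\<close>
      into that of \<open>s / u\<close> from \<open>w\<close>, up to the unit factor
      \<open>w / u\<close>.\<close>
    have "(w \<otimes> q) \<otimes> (s \<otimes> p \<ominus> u) = (w \<otimes> p) \<otimes> (s \<otimes> q) \<ominus> (u \<otimes> q) \<otimes> w"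
      using pq(1,2) s(1) wK(1) u(1)
      by (simp add: a_minus_def r_distr r_minus m_ac)
    then have eq: "(w \<otimes> q) \<otimes> (s \<otimes> p \<ominus> u) = s \<otimes> q \<ominus> w" using pq s wK by simp
    have wq: "w \<otimes> q =v \<one>" using unit_mult[of w q] wK True pq unit_inv u u1 by (simp add: q_def)
    have "(w \<otimes> q) \<otimes> (s \<otimes> p \<ominus> u) \<le>v \<one>"
      using mult_le_iff(2)[of "s \<otimes> p \<ominus> u" \<one> "w \<otimes> q"] 1 wq unit_nonzero[of "w \<otimes> q"] pq wK s u
        le_trans[of "(w \<otimes> q) \<otimes> (s \<otimes> p \<ominus> u)" "w \<otimes> q" \<one>] by (simp add: p_def eqv_def)
    then have "s \<otimes> q \<ominus> w \<le>v \<one>" by (simp only: eq)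
    then show ?thesis by (simp add: q_def)
  next
    case False
    then have w1: "\<one> <v w" "w \<in> K" using w W by (auto simp: eqv_def)
    show ?thesis
    proof (rule ccontr)
      assume "~ ?thesis"
      then have "\<one> <v (s \<otimes> inv u \<ominus> w) \<oplus> w" using lt_add[where z = \<one> and y = w] w1 s u u0 by simp
      then have "\<one> <v s \<otimes> inv u" using diff_cancel w1 s u u0 by simp
      then show False using unit[of u] u u1 by (simp add: eqv_def)
    qed
  qed
  moreover have "u \<ominus> w \<le>v \<one>" if "w \<in> W" for w using that u(3) by (simp add: V_def)
  ultimately show ?thesis using u u1 by blast
qed

text \<open>Off finitely many classes \<open>Y\<close> always holds or always fails. If it holds
  there, \<open>s\<close> is the product of two such units \<open>u\<close> and
  \<open>s / u\<close>; if it fails there, it fails for some \<open>u\<close> together with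
  \<open>inv u\<close>, against \<open>tot\<close>.\<close>

lemma unit_semigroup:
  assumes Y: "def1 Y"
    and mult: "!!u w. u \<in> K ==> w \<in> K ==> u =v \<one> ==> w =v \<one> ==> Y u ==> Y w ==> Y (u \<otimes> w)"
    and tot: "!!u. u \<in> K ==> u =v \<one> ==> Y u \<or> Y (inv u)"
    and s: "s \<in> K" "s =v \<one>"
  shows "Y s"
proof -
  from residue_dichotomy[OF Y] obtain W where W: "finite W" "W \<subseteq> {w \<in> K. \<one> \<le>v w}"
    and 2: "(\<forall>u \<in> K. \<one> \<le>v u --> (\<forall>w \<in> W. u \<ominus> w \<le>v \<one>) --> Y u) \<or>
        (\<forall>u \<in> K. \<one> \<le>v u --> (\<forall>w \<in> W. u \<ominus> w \<le>v \<one>) --> ~ Y u)" by blast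
  from 2 show ?thesis
  proof
    assume *: "\<forall>u \<in> K. \<one> \<le>v u --> (\<forall>w \<in> W. u \<ominus> w \<le>v \<one>) --> Y u"
    obtain u where u: "u \<in> K" "u =v \<one>" "\<forall>w \<in> W. u \<ominus> w \<le>v \<one>" "\<forall>w \<in> W. s \<otimes> inv u \<ominus> w \<le>v \<one>"
      using exists_unit_avoiding[OF W s] by blast
    have u0: "u ~= \<zero>" using unit_nonzero u by blast
    have su: "s \<otimes> inv u \<in> K" "s \<otimes> inv u =v \<one>" using s u u0 unit_mult[of s "inv u"] unit_inv by simp_all
    have "Y u" "Y (s \<otimes> inv u)" using * u su by (auto simp: eqv_def)
    then have "Y (s \<otimes> inv u \<otimes> u)" using mult su u by blast
    then show ?thesis using s u u0 by simp
  next
    assume *: "\<forall>u \<in> K. \<one> \<le>v u --> (\<forall>w \<in> W. u \<ominus> w \<le>v \<one>) --> ~ Y u"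
    obtain u where u: "u \<in> K" "u =v \<one>" "\<forall>w \<in> W. u \<ominus> w \<le>v \<one>" "\<forall>w \<in> W. \<one> \<otimes> inv u \<ominus> w \<le>v \<one>"
      using exists_unit_avoiding[OF W, of \<one>] by auto
    have u0: "u ~= \<zero>" using unit_nonzero u by blast
    have "~ Y u" "~ Y (inv u)" using * u u0 unit_inv[of u] by (auto simp: eqv_def)
    then show ?thesis using tot u by blast
  qed
qed

text \<open>\<open>Psi x y\<close> says that \<open>y\<close> lies in a class of leading terms
  \<open>\<psi>(x)\<close> whose value tends to 0 from above. Once \<open>\<psi>(x)\<close> depends
  only on \<open>v(x)\<close> and its value determines \<open>v(x)\<close>, a value just above 0
  carries at most one of the classes \<open>\<psi>(x)\<close>, while
  \<open>annulus_dichotomy\<close> would provide all classes of that value.\<close>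

lemma no_definable_rv_section:
  assumes Psi: "def2 Psi"
    and ex: "ev (\<lambda>x. \<exists>y \<in> K. Psi x y)"
    and uniq: "!!x y y'. x \<in> K ==> y \<in> K ==> y' \<in> K ==> Psi x y ==> Psi x y' ==> y \<sim>v y'"
    and inv: "!!u. u \<in> K ==> u =v \<one> ==> ev (\<lambda>x. \<forall>y \<in> K. Psi (u \<otimes> x) y \<longleftrightarrow> Psi x y)"
    and lim: "!!g. g \<in> K ==> g ~= \<zero> ==> \<one> <v g ==> ev (\<lambda>x. \<forall>y \<in> K. Psi x y --> \<one> <v y \<and> y <v g)"
  shows False
proof -
  note [dfn] = dp_subst2[OF Psi]
  have const: "ev (\<lambda>x. \<forall>u \<in> K. u =v \<one> --> (\<forall>y \<in> K. Psi (u \<otimes> x) y \<longleftrightarrow> Psi x y))"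
    by (rule ev_const_on_annuli[OF Psi inv])
  define r where "r x d \<longleftrightarrow> (\<exists>y \<in> K. Psi x y \<and> y =v d)" for x d
  have rdef: "def2 r" unfolding r_def def2_def by (intro dfn) auto
  have "\<exists>e \<in> K. e ~= \<zero> \<and> (\<forall>x \<in> K. \<forall>y \<in> K. x ~= \<zero> --> y ~= \<zero> --> e <v x --> e <v y -->
           (\<forall>d \<in> K. r x d \<longleftrightarrow> r y d) --> x =v y)"
  proof (rule eventually_injective[OF rdef])
    show "ev (\<lambda>x. \<forall>u \<in> K. u =v \<one> --> (\<forall>d \<in> K. r (u \<otimes> x) d \<longleftrightarrow> r x d))"
      by (rule ev_mono[OF const]) (auto simp: r_def)
    fix x assume x: "x \<in> K" "x ~= \<zero>"
    show "ev (\<lambda>y. \<exists>d \<in> K. ~ (r x d \<longleftrightarrow> r y d))"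
    proof (cases "\<exists>y \<in> K. Psi x y")
      case True
      then obtain y where y: "y \<in> K" "Psi x y" by blast
      have y0: "y ~= \<zero>" using uniq[OF x(1) y(1) y(1) y(2) y(2)] rveq_nonzero y by blast
      have rxy: "r x y" using y unfolding r_def by auto
      show ?thesis
      \<comment> \<open>Bounded fibres: a positive \<open>v(y)\<close> is eventually undercut by
        \<open>\<psi>\<close>, and a value that is not positive is eventually not taken.\<close>
      proof (cases "\<one> <v y")
        case True
        show ?thesis using lim[OF y(1) y0 True]
        proof (rule ev_mono)
          fix x' assume "\<forall>y' \<in> K. Psi x' y' --> \<one> <v y' \<and> y' <v y"
          then have "~ r x' y" unfolding r_def eqv_def by blast
          then show "\<exists>d \<in> K. ~ (r x d \<longleftrightarrow> r x' d)" using rxy y by blast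
        qed
      next
        case False
        obtain g where "g \<in> K" "g ~= \<zero>" "\<one> <v g" using exists_gt_one by blast
        from lim[OF this] show ?thesis
        proof (rule ev_mono)
          fix x' assume "\<forall>y' \<in> K. Psi x' y' --> \<one> <v y' \<and> y' <v g"
          then have "~ r x' y" using False y le_trans[of _ y \<one>] unfolding r_def eqv_def by blast
          then show "\<exists>d \<in> K. ~ (r x d \<longleftrightarrow> r x' d)" using rxy y by blast
        qed
      qed
    next
      case False
      show ?thesis using ex by (rule ev_mono) (use False eqv_refl in \<open>unfold r_def, blast\<close>)
    qed
  qed
  then obtain e1 where e1: "e1 \<in> K" "e1 ~= \<zero>"
    and inj: "!!x y. x \<in> K ==> y \<in> K ==> x ~= \<zero> ==> y ~= \<zero> ==> e1 <v x ==> e1 <v y ==>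
           (\<forall>d \<in> K. r x d \<longleftrightarrow> r y d) ==> x =v y" by blast
  obtain e2 where e2: "e2 \<in> K" "e2 ~= \<zero>"
    and cst: "!!x u y. x \<in> K ==> x ~= \<zero> ==> e2 <v x ==> u \<in> K ==> u =v \<one> ==> y \<in> K ==>
      Psi (u \<otimes> x) y \<longleftrightarrow> Psi x y"
    using const unfolding ev_def by blast
  obtain m where m: "m \<in> K" "m ~= \<zero>" "e1 \<le>v m" "e2 \<le>v m" using exists_max e1 e2 by blast
  have gtm: "e1 <v x \<and> e2 <v x" if "m <v x" "x \<in> K" for x
    using le_lt_trans[of e1 m x] le_lt_trans[of e2 m x] m that e1 e2 by blast
  define S where "S y \<longleftrightarrow> (\<exists>x \<in> K. x ~= \<zero> \<and> m <v x \<and> Psi x y)" for y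
  have Sdef: "def1 S" unfolding S_def def1_def using m by (intro dfn) auto
  have "\<exists>a \<in> {\<one>}. \<exists>b \<in> {b \<in> K. b ~= \<zero> \<and> \<one> <v b}. (\<forall>y \<in> K. a <v y --> y <v b --> S y) \<or>
      (\<forall>y \<in> K. a <v y --> y <v b --> ~ S y)"
    by (rule annulus_dichotomy[OF Sdef]) (use exists_gt_one in auto)
  then obtain b where b: "b \<in> K" "b ~= \<zero>" "\<one> <v b"
    and bS: "(\<forall>y \<in> K. \<one> <v y --> y <v b --> S y) \<or> (\<forall>y \<in> K. \<one> <v y --> y <v b --> ~ S y)" by blast
  obtain x where x: "x \<in> K" "x ~= \<zero>" "m <v x" "\<exists>y \<in> K. Psi x y"
    "\<forall>y \<in> K. Psi x y --> \<one> <v y \<and> y <v b"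
    using ev_exists[OF ev_conj3[OF ev_gt[OF m(1,2)] ex lim[OF b]]] by blast
  obtain y where y: "y \<in> K" "Psi x y" "\<one> <v y" "y <v b" using x by blast
  have y0: "y ~= \<zero>" using uniq[OF x(1) y(1) y(1) y(2) y(2)] rveq_nonzero y by blast
  have "S y" using x y unfolding S_def by blast
  then have all: "S w" if "w \<in> K" "\<one> <v w" "w <v b" for w using bS that y by blast
  \<comment> \<open>A unit with residue other than 1 is needed: then \<open>u \<otimes> y\<close>
    has the value of \<open>y\<close> but a different leading term.\<close>
  have "\<exists>u \<in> K. \<one> \<le>v u \<and> (\<forall>v \<in> {\<zero>, \<one>}. u \<ominus> v \<le>v \<one>)"
    by (rule residue_field_infinite) auto
  then obtain u where u: "u \<in> K" "u =v \<one>" "u \<ominus> \<one> \<le>v \<one>" by (auto simp: eqv_def)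
  have nu: "~ \<one> \<sim>v u" using u diff_sym(2)[of u \<one> \<one>] by (simp add: rveq_def)
  have uy: "u \<otimes> y =v y" using eqv_mult_iff(1)[of u \<one> y] u y y0 by simp
  have uyK: "u \<otimes> y \<in> K" using u y by simp
  have "S (u \<otimes> y)" using all[OF uyK] eqv_le[OF uy uyK y(1)] y b by simp
  then obtain x' where x': "x' \<in> K" "x' ~= \<zero>" "m <v x'" "Psi x' (u \<otimes> y)" unfolding S_def by blast
  have rchar: "r x1 d \<longleftrightarrow> y1 =v d" if "Psi x1 y1" "x1 \<in> K" "y1 \<in> K" "d \<in> K" for x1 y1 d
    unfolding r_def using that uniq[of x1 _ y1] rveq_eqv eqv_trans eqv_sym by blast
  have "r x d \<longleftrightarrow> r x' d" if "d \<in> K" for d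
    using rchar[OF y(2) x(1) y(1) that] rchar[OF x'(4,1) uyK that] uy eqv_trans[of y "u \<otimes> y" d]
      eqv_trans[of "u \<otimes> y" y d] eqv_sym uyK y that by blast
  then have "x' =v x" using inj[of x' x] x x' gtm by blast
  then have "x' \<otimes> inv x =v \<one>" using eqv_mult_iff(1)[of x' x "inv x"] x x' by simp
  then have "Psi (x' \<otimes> inv x \<otimes> x) (u \<otimes> y) \<longleftrightarrow> Psi x (u \<otimes> y)" using cst[of x "x' \<otimes> inv x"] x x' gtm uyK by simp
  then have "Psi x (u \<otimes> y)" using x x' by simp
  then have "y \<sim>v u \<otimes> y" using uniq x y uyK by blast
  then have "\<one> \<sim>v u" using rveq_mult_iff(2)[of \<one> u y] y y0 u by simp
  then show False using nu by blast
qed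

text \<open>The bad case normalised to radius 0: by \<open>B1\<close> and \<open>B2\<close> the
  radii of closed balls that eventually contain \<open>f x\<close> have supremum 0 without attaining
  it. Differences \<open>f x \<ominus> f y\<close> then have values below 0 that approach 0.\<close>

lemma no_limit_from_below:
  assumes f: "def2 (\<lambda>z x. z = f x)" and fK: "!!x. x \<in> K ==> f x \<in> K"
    and B1: "!!g. g \<in> K ==> g ~= \<zero> ==> g <v \<one> ==> \<exists>a \<in> K. ev (\<lambda>x. g \<le>v f x \<ominus> a)"
    and B2: "!!a. a \<in> K ==> ev (\<lambda>x. f x \<ominus> a <v \<one>)"
  shows False
proof -
  note [simp, intro] = fK
  note [dfn] = dt_fun[OF f fK]
  \<comment> \<open>\<open>Phi x z\<close>: the leading term of \<open>z\<close> is the eventual leading term \<open>\<phi>(x)\<close> of \<open>f(x) - f(y)\<close> as \<open>y \<rightarrow> 0\<close>.\<close>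
  define Phi where "Phi x z \<longleftrightarrow> ev (\<lambda>y. z \<sim>v f x \<ominus> f y)" for x z
  have Phidef: "def2 Phi" unfolding Phi_def def2_def by (intro dfn) auto
  note [dfn] = dp_subst2[OF Phidef]
  have Phi_uniq: "z \<sim>v z'" if h: "Phi x z" "Phi x z'" "x \<in> K" "z \<in> K" "z' \<in> K" for x z z'
  proof -
    obtain y where "y \<in> K" "z \<sim>v f x \<ominus> f y" "z' \<sim>v f x \<ominus> f y"
      using ev_exists[OF ev_conj[OF h(1)[unfolded Phi_def] h(2)[unfolded Phi_def]]] by blast
    then show ?thesis using h rveq_sym[of z' "f x \<ominus> f y"] rveq_trans[of z "f x \<ominus> f y" z'] by simp
  qed
  have Phi_eqv: "z =v z'" if "Phi x z" "Phi x z'" "x \<in> K" "z \<in> K" "z' \<in> K" for x z z'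
    using Phi_uniq that rveq_eqv by blast
  have Phi_nz: "z ~= \<zero>" if "Phi x z" "x \<in> K" "z \<in> K" for x z
    using Phi_uniq[of x z z] that rveq_nonzero by blast
  have Phi_lt: "z <v \<one>" if h: "Phi x z" "x \<in> K" "z \<in> K" for x z
  proof -
    obtain y where y: "y \<in> K" "z \<sim>v f x \<ominus> f y" "f y \<ominus> f x <v \<one>"
      using ev_exists[OF ev_conj[OF h(1)[unfolded Phi_def] B2[OF fK[OF h(2)]]]] by blast
    then have "z =v f x \<ominus> f y" using rveq_eqv h by simp
    then show ?thesis using eqv_le(2)[of z "f x \<ominus> f y" \<one>] y h diff_sym[of "f x" "f y" \<one>] by simp
  qed
  \<comment> \<open>With \<open>v(f x - f y)\<close> below \<open>v(g)\<close> and
    \<open>f y\<close> eventually confined to a ball of radius \<open>v(g)\<close>, the leading term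
    of the difference no longer moves.\<close>
  define good where "good x \<longleftrightarrow> (\<exists>g \<in> K. g ~= \<zero> \<and> g <v \<one> \<and> ev (\<lambda>y. f x \<ominus> f y <v g))" for x
  have gooddef: "def1 good" unfolding good_def def1_def by (intro dfn) auto
  have far: "ev (\<lambda>y. g \<le>v f x \<ominus> f y)" if "~ good x" "x \<in> K" "g \<in> K" "g ~= \<zero>" "g <v \<one>" for x g
  proof -
    have "def1 (\<lambda>y. f x \<ominus> f y <v g)" unfolding def1_def using that fK by (intro dfn) auto
    then have "ev (\<lambda>y. ~ (f x \<ominus> f y <v g))" using ev_dichotomy that unfolding good_def by blast
    then show ?thesis by simp
  qed
  have "~ ev (\<lambda>x. ~ good x)"
  proof
    assume bad: "ev (\<lambda>x. ~ good x)"
    \<comment> \<open>Take bad \<open>x0\<close> and \<open>x1\<close> with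
      \<open>v(f x1 - f x0)\<close> below 0. For \<open>g\<close> in between, some
      \<open>f y\<close> is within \<open>v(g)\<close> of both images, which is too close.\<close>
    obtain x0 where x0: "x0 \<in> K" "~ good x0" using ev_exists[OF bad] by blast
    obtain x1 where x1: "x1 \<in> K" "~ good x1" "f x1 \<ominus> f x0 <v \<one>"
      using ev_exists[OF ev_conj[OF bad B2[OF fK[OF x0(1)]]]] by blast
    obtain g where g: "g \<in> K" "g ~= \<zero>" "f x1 \<ominus> f x0 <v g" "g <v \<one>"
      using dense[OF x1(3)] x0 x1 by auto
    obtain y where y: "y \<in> K" "g \<le>v f x1 \<ominus> f y" "g \<le>v f x0 \<ominus> f y"
      using ev_exists[OF ev_conj[OF far[OF x1(2,1) g(1,2,4)] far[OF x0(2,1) g(1,2,4)]]] by blast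
    have "g \<le>v f y \<ominus> f x0" using y g x0 diff_sym[of "f y" "f x0" g] by simp
    then have "g \<le>v f x1 \<ominus> f x0" using le_diff_trans[of g "f x1" "f y" "f x0"] y g x0 x1 by simp
    then show False using g by blast
  qed
  then have "ev good" using ev_dichotomy[OF gooddef] by blast
  then have Phi_ex: "ev (\<lambda>x. \<exists>z \<in> K. Phi x z)"
  proof (rule ev_mono)
    fix x assume x: "x \<in> K" "good x"
    then obtain g where g: "g \<in> K" "g ~= \<zero>" "g <v \<one>" "ev (\<lambda>y. f x \<ominus> f y <v g)" unfolding good_def by blast
    obtain a where a: "a \<in> K" "ev (\<lambda>y. g \<le>v f y \<ominus> a)" using B1 g by blast
    obtain y0 where y0: "y0 \<in> K" "f x \<ominus> f y0 <v g" "g \<le>v f y0 \<ominus> a"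
      using ev_exists[OF ev_conj[OF g(4) a(2)]] by blast
    have "Phi x (f x \<ominus> f y0)" unfolding Phi_def using a(2)
    proof (rule ev_mono)
      fix y assume y: "y \<in> K" "g \<le>v f y \<ominus> a"
      have "g \<le>v a \<ominus> f y0" using y0 a g diff_sym[of a "f y0" g] by simp
      then have "g \<le>v f y \<ominus> f y0" using le_diff_trans[of g "f y" a "f y0"] y y0 a g by simp
      moreover have "(f x \<ominus> f y0) \<ominus> (f x \<ominus> f y) = f y \<ominus> f y0"
      proof -
        have *: "f x \<in> K" "f y \<in> K" "f y0 \<in> K" using x y y0 by auto
        define p q s where "p = f x" and "q = f y" and "s = f y0"
        have "p \<in> K" "q \<in> K" "s \<in> K" using * by (simp_all add: p_def q_def s_def)
        then have "(p \<ominus> s) \<ominus> (p \<ominus> q) = q \<ominus> s"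
          by (simp add: a_minus_def minus_add a_ac r_neg1 r_neg2 r_neg l_neg)
        then show ?thesis by (simp add: p_def q_def s_def)
      qed
      ultimately show "f x \<ominus> f y0 \<sim>v f x \<ominus> f y" using rveqI[of g "f x \<ominus> f y0" "f x \<ominus> f y"] y0 x y g by simp
    qed
    then show "\<exists>z \<in> K. Phi x z" using x y0 by blast
  qed
  have Phi_ge: "ev (\<lambda>x. \<forall>z \<in> K. Phi x z --> g \<le>v z)" if g: "g \<in> K" "g ~= \<zero>" "g <v \<one>" for g
  proof -
    obtain a where a: "a \<in> K" "ev (\<lambda>y. g \<le>v f y \<ominus> a)" using B1 g by blast
    from a(2) show ?thesis
    proof (rule ev_mono)
      fix x assume x: "x \<in> K" "g \<le>v f x \<ominus> a"
      show "\<forall>z \<in> K. Phi x z --> g \<le>v z"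
      proof (intro ballI impI)
        fix z assume z: "z \<in> K" "Phi x z"
        obtain y where y: "y \<in> K" "g \<le>v f y \<ominus> a" "z \<sim>v f x \<ominus> f y"
          using ev_exists[OF ev_conj[OF a(2) z(2)[unfolded Phi_def]]] by blast
        have "g \<le>v a \<ominus> f y" using y a g diff_sym[of a "f y" g] by simp
        then have "g \<le>v f x \<ominus> f y" using le_diff_trans[of g "f x" a "f y"] x y a g by simp
        then show "g \<le>v z" using eqv_le(2)[OF rveq_eqv[OF y(3)]] x y z g by simp
      qed
    qed
  qed
  \<comment> \<open>The units \<open>u\<close> with \<open>v(\<phi>(x)) \<le> v(\<phi>(u x))\<close> for small \<open>x\<close> form a semigroup that contains \<open>u\<close> or
    \<open>1 / u\<close> for every \<open>u\<close>; by genericity it contains all units.\<close>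
  define Y where "Y u \<longleftrightarrow> ev (\<lambda>x. \<forall>z \<in> K. \<forall>z' \<in> K. Phi x z --> Phi (u \<otimes> x) z' --> z \<le>v z')" for u
  have Ydef: "def1 Y" unfolding Y_def def1_def by (intro dfn) auto
  have Y: "Y u" if "u \<in> K" "u =v \<one>" for u
  proof (rule unit_semigroup[OF Ydef _ _ that])
    fix u w assume u: "u \<in> K" "u =v \<one>" and w: "w \<in> K" "w =v \<one>" and "Y u" "Y w"
    have "w ~= \<zero>" using unit_nonzero w by blast
    have 1: "ev (\<lambda>x. \<forall>z \<in> K. \<forall>z' \<in> K. Phi (w \<otimes> x) z --> Phi (u \<otimes> (w \<otimes> x)) z' --> z \<le>v z')"
      using ev_scale[OF \<open>Y u\<close>[unfolded Y_def] w(1) \<open>w ~= \<zero>\<close>] .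
    have 2: "ev (\<lambda>x. \<exists>z \<in> K. Phi (w \<otimes> x) z)" using ev_scale[OF Phi_ex w(1) \<open>w ~= \<zero>\<close>] .
    show "Y (u \<otimes> w)" unfolding Y_def
    proof (rule ev_mono[OF ev_conj3[OF 1 2 \<open>Y w\<close>[unfolded Y_def]]], intro ballI impI)
      fix x z z'
      assume x: "x \<in> K" and h: "(\<forall>z \<in> K. \<forall>z' \<in> K. Phi (w \<otimes> x) z --> Phi (u \<otimes> (w \<otimes> x)) z' --> z \<le>v z') \<and>
          (\<exists>z \<in> K. Phi (w \<otimes> x) z) \<and> (\<forall>z \<in> K. \<forall>z' \<in> K. Phi x z --> Phi (w \<otimes> x) z' --> z \<le>v z')"
        and z: "z \<in> K" "z' \<in> K" "Phi x z" "Phi (u \<otimes> w \<otimes> x) z'"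
      obtain z1 where z1: "z1 \<in> K" "Phi (w \<otimes> x) z1" using h by blast
      have "Phi (u \<otimes> (w \<otimes> x)) z'" using z u w x by (simp add: m_assoc)
      then have "z \<le>v z1" "z1 \<le>v z'" using h z z1 by blast+
      then show "z \<le>v z'" using le_trans[of z z1 z'] z z1 by blast
    qed
  next
    fix u assume u: "u \<in> K" "u =v \<one>"
    have u0: "u ~= \<zero>" using unit_nonzero u by blast
    have "def1 (\<lambda>x. \<forall>z \<in> K. \<forall>z' \<in> K. Phi x z --> Phi (u \<otimes> x) z' --> z \<le>v z')"
      unfolding def1_def using u by (intro dfn) auto
    from ev_dichotomy[OF this] show "Y u \<or> Y (inv u)"
    proof
      assume "ev (\<lambda>x. ~ (\<forall>z \<in> K. \<forall>z' \<in> K. Phi x z --> Phi (u \<otimes> x) z' --> z \<le>v z'))"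
      then have "ev (\<lambda>x. \<forall>z \<in> K. \<forall>z' \<in> K. Phi x z --> Phi (u \<otimes> x) z' --> z' \<le>v z)"
      proof (rule ev_mono, intro ballI impI)
        fix x z z'
        assume x: "x \<in> K" and "~ (\<forall>z \<in> K. \<forall>z' \<in> K. Phi x z --> Phi (u \<otimes> x) z' --> z \<le>v z')"
          and z: "z \<in> K" "z' \<in> K" "Phi x z" "Phi (u \<otimes> x) z'"
        then obtain w w' where w: "w \<in> K" "w' \<in> K" "Phi x w" "Phi (u \<otimes> x) w'" "w' <v w" by blast
        have "z =v w" "z' =v w'" using Phi_eqv x u w z by blast+
        then show "z' \<le>v z" using eqv_le[of z w] eqv_le[of z' w'] w z lt_imp_le[OF w(5)] by simp
      qed
      then have "ev (\<lambda>x. \<forall>z \<in> K. \<forall>z' \<in> K. Phi (inv u \<otimes> x) z --> Phi (u \<otimes> (inv u \<otimes> x)) z' --> z' \<le>v z)"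
        by (rule ev_scale[where u = "inv u"]) (use u u0 in simp_all)
      then have "Y (inv u)" unfolding Y_def by (rule ev_mono) (use u u0 in auto)
      then show ?thesis ..
    qed (simp add: Y_def)
  qed
  have c_inv: "ev (\<lambda>x. \<forall>z \<in> K. \<forall>z' \<in> K. Phi x z --> Phi (u \<otimes> x) z' --> z =v z')"
    if u: "u \<in> K" "u =v \<one>" for u
  proof -
    have u0: "u ~= \<zero>" using unit_nonzero u by blast
    \<comment> \<open>Membership of \<open>inv u\<close>, read at \<open>u \<otimes> x\<close>, is
      the reverse inequality.\<close>
    have "Y (inv u)" using Y unit_inv u u0 by blast
    then have "ev (\<lambda>x. \<forall>z \<in> K. \<forall>z' \<in> K. Phi (u \<otimes> x) z --> Phi (inv u \<otimes> (u \<otimes> x)) z' --> z \<le>v z')"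
      unfolding Y_def by (rule ev_scale[where u = u]) (use u u0 in simp_all)
    from ev_conj[OF this Y[OF u, unfolded Y_def]] show ?thesis
      by (rule ev_mono) (use u u0 in \<open>simp add: eqv_def\<close>)
  qed
  have chi: "\<exists>c \<in> K. ev (\<lambda>x. \<exists>z \<in> K. \<exists>z' \<in> K. Phi x z \<and> Phi (u \<otimes> x) z' \<and> z' \<sim>v c \<otimes> z)"
    if u: "u \<in> K" "u =v \<one>" for u
  proof -
    have u0: "u ~= \<zero>" using unit_nonzero u by blast
    \<comment> \<open>\<open>G w x\<close> says that \<open>w\<close> has the residue of
      \<open>\<phi>(u x) / \<phi>(x)\<close>, which has value 0 by \<open>c_inv\<close>; multiplying
      by \<open>z\<close> avoids the division.\<close>
    define G where "G w x \<longleftrightarrow> (\<exists>z \<in> K. \<exists>z' \<in> K. Phi x z \<and> Phi (u \<otimes> x) z' \<and> z <v w \<otimes> z \<ominus> z')" for w x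
    have Gdef: "def2 G" unfolding G_def def2_def using u by (intro dfn) auto
    have "\<exists>w \<in> K. \<one> \<le>v w \<and> ev (G w)"
    proof (rule ev_residue_const[OF Gdef])
      fix w w' x assume w: "w \<in> K" "w' \<in> K" "x \<in> K" "\<one> <v w' \<ominus> w" "G w x"
      then obtain z z' where z: "z \<in> K" "z' \<in> K" "Phi x z" "Phi (u \<otimes> x) z'" "z <v w \<otimes> z \<ominus> z'"
        unfolding G_def by blast
      have z0: "z ~= \<zero>" using Phi_nz z w by blast
      have "w' \<otimes> z \<ominus> w \<otimes> z = (w' \<ominus> w) \<otimes> z" using z(1) w(1,2) by (simp add: a_minus_def l_distr l_minus)
      then have "z <v w' \<otimes> z \<ominus> w \<otimes> z" using mult_le_iff(1)[of "w' \<ominus> w" \<one> z] z z0 w by simp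
      then have "z <v w' \<otimes> z \<ominus> z'" using lt_diff_trans[where x = "w' \<otimes> z" and y = "w \<otimes> z" and g = z and z = z'] z w by simp
      then show "G w' x" using z unfolding G_def by blast
    next
      have "ev (\<lambda>x. \<exists>z \<in> K. Phi (u \<otimes> x) z)" using ev_scale[OF Phi_ex u(1) u0] .
      from ev_conj3[OF this Phi_ex c_inv[OF u]] show "ev (\<lambda>x. \<exists>w \<in> K. \<one> \<le>v w \<and> G w x)"
      proof (rule ev_mono)
        fix x assume x: "x \<in> K" and "(\<exists>z \<in> K. Phi (u \<otimes> x) z) \<and> (\<exists>z \<in> K. Phi x z) \<and>
          (\<forall>z \<in> K. \<forall>z' \<in> K. Phi x z --> Phi (u \<otimes> x) z' --> z =v z')"
        then obtain z z' where z: "z \<in> K" "z' \<in> K" "Phi x z" "Phi (u \<otimes> x) z'" "z =v z'" by blast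
        have z0: "z ~= \<zero>" using Phi_nz z x by blast
        have "\<one> \<le>v z' \<otimes> inv z" using mult_le_iff(1)[of z z' "inv z"] z z0 by (simp add: eqv_def)
        moreover have "G (z' \<otimes> inv z) x" unfolding G_def using z z0 by (intro bexI[of _ z] bexI[of _ z']) simp_all
        ultimately show "\<exists>w \<in> K. \<one> \<le>v w \<and> G w x" using z z0 by blast
      qed
    qed
    then obtain c where c: "c \<in> K" "ev (G c)" by blast
    have "ev (\<lambda>x. \<exists>z \<in> K. \<exists>z' \<in> K. Phi x z \<and> Phi (u \<otimes> x) z' \<and> z' \<sim>v c \<otimes> z)"
    proof (rule ev_mono[OF ev_conj[OF c(2) c_inv[OF u]]])
      fix x assume x: "x \<in> K" and h: "G c x \<and> (\<forall>z \<in> K. \<forall>z' \<in> K. Phi x z --> Phi (u \<otimes> x) z' --> z =v z')"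
      then obtain z z' where z: "z \<in> K" "z' \<in> K" "Phi x z" "Phi (u \<otimes> x) z'" "z <v c \<otimes> z \<ominus> z'" "z =v z'"
        unfolding G_def by blast
      have "z' \<sim>v c \<otimes> z" unfolding rveq_def
        using eqv_le(2)[OF z(6,1,2), of "c \<otimes> z \<ominus> z'"] diff_sym(2)[of "c \<otimes> z" z' z'] z c by simp
      then show "\<exists>z \<in> K. \<exists>z' \<in> K. Phi x z \<and> Phi (u \<otimes> x) z' \<and> z' \<sim>v c \<otimes> z" using z by blast
    qed
    then show ?thesis using c by blast
  qed
  define C where "C x d \<longleftrightarrow> (\<exists>z \<in> K. Phi x z \<and> z =v d)" for x d
  have Cdef: "def2 C" unfolding C_def def2_def by (intro dfn) auto
  have "\<exists>e \<in> K. e ~= \<zero> \<and> (\<forall>x \<in> K. \<forall>y \<in> K. x ~= \<zero> --> y ~= \<zero> --> e <v x --> e <v y -->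
           (\<forall>d \<in> K. C x d \<longleftrightarrow> C y d) --> x =v y)"
  proof (rule eventually_injective[OF Cdef])
    show "ev (\<lambda>x. \<forall>u \<in> K. u =v \<one> --> (\<forall>d \<in> K. C (u \<otimes> x) d \<longleftrightarrow> C x d))"
    proof (rule ev_const_on_annuli[OF Cdef])
      fix u assume u: "u \<in> K" "u =v \<one>"
      have u0: "u ~= \<zero>" using unit_nonzero u by blast
      show "ev (\<lambda>x. \<forall>d \<in> K. C (u \<otimes> x) d \<longleftrightarrow> C x d)"
      proof (rule ev_mono[OF ev_conj3[OF ev_scale[OF Phi_ex u(1) u0] Phi_ex c_inv[OF u]]])
        fix x assume x: "x \<in> K" and h: "(\<exists>z \<in> K. Phi (u \<otimes> x) z) \<and> (\<exists>z \<in> K. Phi x z) \<and>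
          (\<forall>z \<in> K. \<forall>z' \<in> K. Phi x z --> Phi (u \<otimes> x) z' --> z =v z')"
        then obtain z0 z1 where z01: "z0 \<in> K" "z1 \<in> K" "Phi x z0" "Phi (u \<otimes> x) z1" by blast
        show "\<forall>d \<in> K. C (u \<otimes> x) d \<longleftrightarrow> C x d"
        proof (intro ballI iffI)
          fix d assume d: "d \<in> K" "C (u \<otimes> x) d"
          then obtain z where z: "z \<in> K" "Phi (u \<otimes> x) z" "z =v d" unfolding C_def by blast
          then have "z0 =v z" using h z01 by blast
          then have "z0 =v d" using eqv_trans[of z0 z d] z z01 d by blast
          then show "C x d" using z01 unfolding C_def by blast
        next
          fix d assume d: "d \<in> K" "C x d"
          then obtain z where z: "z \<in> K" "Phi x z" "z =v d" unfolding C_def by blast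
          then have "z1 =v z" using h z01 eqv_sym by blast
          then have "z1 =v d" using eqv_trans[of z1 z d] z z01 d by blast
          then show "C (u \<otimes> x) d" using z01 unfolding C_def by blast
        qed
      qed
    qed
    fix x assume x: "x \<in> K" "x ~= \<zero>"
    show "ev (\<lambda>y. \<exists>d \<in> K. ~ (C x d \<longleftrightarrow> C y d))"
    proof (cases "\<exists>z \<in> K. Phi x z")
      case True
      then obtain z where z: "z \<in> K" "Phi x z" by blast
      have Cz: "C x z" using z unfolding C_def by auto
      \<comment> \<open>Fibres are bounded since the value of \<open>z\<close> is below 0, while
        that of \<open>\<phi>(y)\<close> eventually passes any \<open>g\<close> below 0.\<close>
      obtain g where g: "g \<in> K" "g ~= \<zero>" "z <v g" "g <v \<one>" using dense Phi_lt[OF z(2) x(1) z(1)] z by blast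
      show ?thesis
      proof (rule ev_mono[OF Phi_ge[OF g(1,2,4)]])
        fix y assume "\<forall>z \<in> K. Phi y z --> g \<le>v z"
        then have "~ C y z" using g z le_trans[of g _ z] unfolding C_def eqv_def by blast
        then show "\<exists>d \<in> K. ~ (C x d \<longleftrightarrow> C y d)" using Cz z by blast
      qed
    next
      case False
      show ?thesis using Phi_ex by (rule ev_mono) (use False eqv_refl in \<open>unfold C_def, blast\<close>)
    qed
  qed
  then obtain e where e: "e \<in> K" "e ~= \<zero>"
    and inj: "!!x y. x \<in> K ==> y \<in> K ==> x ~= \<zero> ==> y ~= \<zero> ==> e <v x ==> e <v y ==>
           (\<forall>d \<in> K. C x d \<longleftrightarrow> C y d) ==> x =v y" by blast
  \<comment> \<open>Since \<open>v(\<phi>(t x)) ~= v(\<phi>(x))\<close> for small \<open>x\<close>, the pair \<open>(a, b)\<close> below is \<open>(1, t)\<close> or \<open>(t, 1)\<close>, and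
    \<open>Psi x y\<close> says that \<open>y\<close> has the leading term of \<open>\<phi>(b x) / \<phi>(a x)\<close>.\<close>
  obtain t where t: "t \<in> K" "t ~= \<zero>" "\<one> <v t" using exists_gt_one by blast
  have neq: "ev (\<lambda>x. \<forall>z \<in> K. \<forall>z' \<in> K. Phi x z --> Phi (t \<otimes> x) z' --> ~ z =v z')"
  proof (rule ev_mono[OF ev_gt[OF e]], intro ballI impI notI)
    fix x z z' assume x: "x \<in> K" "x ~= \<zero>" "e <v x"
      and z: "z \<in> K" "z' \<in> K" "Phi x z" "Phi (t \<otimes> x) z'" "z =v z'"
    have tx: "t \<otimes> x \<in> K" "t \<otimes> x ~= \<zero>" "x <v t \<otimes> x" using t x mult_le_iff(1)[of t \<one> x] by simp_all
    have "e <v t \<otimes> x" using lt_trans[where x = e and y = x and z = "t \<otimes> x"] x tx e by blast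
    moreover have "C x1 d \<longleftrightarrow> z1 =v d" if "Phi x1 z1" "x1 \<in> K" "z1 \<in> K" "d \<in> K" for x1 z1 d
      unfolding C_def using that Phi_eqv[of x1 _ z1] eqv_trans eqv_sym by blast
    then have "\<forall>d \<in> K. C x d \<longleftrightarrow> C (t \<otimes> x) d"
      using z x tx eqv_trans[of z z'] eqv_trans[of z' z] eqv_sym[of z z'] by blast
    ultimately have "x =v t \<otimes> x" using inj[of x "t \<otimes> x"] x tx by blast
    then show False using tx by (simp add: eqv_def)
  qed
  have "\<exists>a \<in> K. \<exists>b \<in> K. a ~= \<zero> \<and> b ~= \<zero> \<and> ev (\<lambda>x. \<forall>z \<in> K. \<forall>z' \<in> K. Phi (a \<otimes> x) z --> Phi (b \<otimes> x) z' --> z <v z')"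
  proof -
    have "def1 (\<lambda>x. \<forall>z \<in> K. \<forall>z' \<in> K. Phi x z --> Phi (t \<otimes> x) z' --> z <v z')"
      unfolding def1_def using t by (intro dfn) auto
    from ev_dichotomy[OF this] show ?thesis
    proof
      assume "ev (\<lambda>x. \<forall>z \<in> K. \<forall>z' \<in> K. Phi x z --> Phi (t \<otimes> x) z' --> z <v z')"
      then have "ev (\<lambda>x. \<forall>z \<in> K. \<forall>z' \<in> K. Phi (\<one> \<otimes> x) z --> Phi (t \<otimes> x) z' --> z <v z')"
        by (rule ev_mono) simp
      then show ?thesis using t by (intro bexI[of _ \<one>] bexI[of _ t]) auto
    next
      assume "ev (\<lambda>x. ~ (\<forall>z \<in> K. \<forall>z' \<in> K. Phi x z --> Phi (t \<otimes> x) z' --> z <v z'))"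
      from ev_conj[OF this neq]
      have "ev (\<lambda>x. \<forall>z \<in> K. \<forall>z' \<in> K. Phi (t \<otimes> x) z --> Phi (\<one> \<otimes> x) z' --> z <v z')"
      proof (rule ev_mono, intro ballI impI)
        fix x z z' assume x: "x \<in> K" and h: "~ (\<forall>z \<in> K. \<forall>z' \<in> K. Phi x z --> Phi (t \<otimes> x) z' --> z <v z') \<and>
            (\<forall>z \<in> K. \<forall>z' \<in> K. Phi x z --> Phi (t \<otimes> x) z' --> ~ z =v z')"
          and z: "z \<in> K" "z' \<in> K" "Phi (t \<otimes> x) z" "Phi (\<one> \<otimes> x) z'"
        then obtain w w' where w: "w \<in> K" "w' \<in> K" "Phi x w" "Phi (t \<otimes> x) w'" "w' \<le>v w" by blast
        have "Phi x z'" using z x by simp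
        then have 1: "z =v w'" "z' =v w" using Phi_eqv[of "t \<otimes> x" z w'] Phi_eqv[of x z' w] x t w z by auto
        then have "z \<le>v z'" using eqv_le[of z w'] eqv_le[of z' w] w z by simp
        moreover have "~ z' =v z" using h z \<open>Phi x z'\<close> by blast
        ultimately show "z <v z'" by (auto simp: eqv_def)
      qed
      then show ?thesis using t by (intro bexI[of _ t] bexI[of _ \<one>]) auto
    qed
  qed
  then obtain a b where ab: "a \<in> K" "b \<in> K" "a ~= \<zero>" "b ~= \<zero>"
    and lt_ab: "ev (\<lambda>x. \<forall>z \<in> K. \<forall>z' \<in> K. Phi (a \<otimes> x) z --> Phi (b \<otimes> x) z' --> z <v z')" by blast
  define Psi where "Psi x y \<longleftrightarrow> (\<exists>z \<in> K. \<exists>z' \<in> K. Phi (a \<otimes> x) z \<and> Phi (b \<otimes> x) z' \<and> z' \<sim>v y \<otimes> z)" for x y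
  have Psidef: "def2 Psi" unfolding Psi_def def2_def using ab by (intro dfn) auto
  have Psi_iff: "Psi x y \<longleftrightarrow> z' \<sim>v y \<otimes> z"
    if "Phi (a \<otimes> x) z" "Phi (b \<otimes> x) z'" "x \<in> K" "y \<in> K" "z \<in> K" "z' \<in> K" for x y z z'
  proof
    assume "Psi x y"
    then obtain w w' where w: "w \<in> K" "w' \<in> K" "Phi (a \<otimes> x) w" "Phi (b \<otimes> x) w'" "w' \<sim>v y \<otimes> w"
      unfolding Psi_def by blast
    have y0: "y ~= \<zero>" using rveq_nonzero(2)[OF w(5)] w that by auto
    have "z' \<sim>v w'" "w \<sim>v z" using Phi_uniq that w ab by simp_all
    then show "z' \<sim>v y \<otimes> z" using w that y0 rveq_mult_iff(1)[of w z y]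
        rveq_trans[of z' w' "y \<otimes> w"] rveq_trans[of z' "y \<otimes> w" "y \<otimes> z"] by simp
  qed (use that in \<open>auto simp: Psi_def\<close>)
  have Psi_nz: "y ~= \<zero>" if "Psi x y" "x \<in> K" "y \<in> K" for x y
    using that rveq_nonzero(2) unfolding Psi_def by fastforce
  have ex_a: "ev (\<lambda>x. \<exists>z \<in> K. Phi (a \<otimes> x) z)" and ex_b: "ev (\<lambda>x. \<exists>z \<in> K. Phi (b \<otimes> x) z)"
    using ev_scale[OF Phi_ex] ab by auto
  show False
  proof (rule no_definable_rv_section[OF Psidef])
    from ev_conj[OF ex_a ex_b] show "ev (\<lambda>x. \<exists>y \<in> K. Psi x y)"
    proof (rule ev_mono)
      fix x assume x: "x \<in> K" and "(\<exists>z \<in> K. Phi (a \<otimes> x) z) \<and> (\<exists>z \<in> K. Phi (b \<otimes> x) z)"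
      then obtain z z' where z: "z \<in> K" "z' \<in> K" "Phi (a \<otimes> x) z" "Phi (b \<otimes> x) z'" by blast
      then have "z ~= \<zero>" "z' ~= \<zero>" using Phi_nz[of "a \<otimes> x" z] Phi_nz[of "b \<otimes> x" z'] x ab by auto
      then show "\<exists>y \<in> K. Psi x y" using Psi_iff[OF z(3,4) x, of "z' \<otimes> inv z"] z rveq_refl[of z']
        by (intro bexI[of _ "z' \<otimes> inv z"]) simp_all
    qed
  next
    fix x y y' assume x: "x \<in> K" and y: "y \<in> K" "y' \<in> K" "Psi x y" "Psi x y'"
    then obtain z z' where z: "z \<in> K" "z' \<in> K" "Phi (a \<otimes> x) z" "Phi (b \<otimes> x) z'" unfolding Psi_def by blast
    have "z ~= \<zero>" using Phi_nz[of "a \<otimes> x" z] z x ab by auto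
    moreover have "z' \<sim>v y \<otimes> z" "z' \<sim>v y' \<otimes> z" using Psi_iff[OF z(3,4) x _ z(1,2)] y by blast+
    then have "y \<otimes> z \<sim>v y' \<otimes> z" using rveq_sym[of z' "y \<otimes> z"] rveq_trans[of "y \<otimes> z" z' "y' \<otimes> z"] y z by simp
    ultimately show "y \<sim>v y'" using rveq_mult_iff(2)[of y y' z] y z by simp
  next
    fix u assume u: "u \<in> K" "u =v \<one>"
    obtain c where c: "c \<in> K" "ev (\<lambda>x. \<exists>z \<in> K. \<exists>z' \<in> K. Phi x z \<and> Phi (u \<otimes> x) z' \<and> z' \<sim>v c \<otimes> z)"
      using chi[OF u] by blast
    \<comment> \<open>The constant \<open>c\<close> belongs to \<open>u\<close> alone, so it appears
      at \<open>a \<otimes> x\<close> and at \<open>b \<otimes> x\<close> alike and cancels in the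
      quotient.\<close>
    from ev_conj[OF ev_scale[OF c(2) ab(1,3)] ev_scale[OF c(2) ab(2,4)]]
    show "ev (\<lambda>x. \<forall>y \<in> K. Psi (u \<otimes> x) y \<longleftrightarrow> Psi x y)"
    proof (rule ev_mono)
      fix x assume x: "x \<in> K" and
        "(\<exists>z \<in> K. \<exists>z' \<in> K. Phi (a \<otimes> x) z \<and> Phi (u \<otimes> (a \<otimes> x)) z' \<and> z' \<sim>v c \<otimes> z) \<and>
         (\<exists>z \<in> K. \<exists>z' \<in> K. Phi (b \<otimes> x) z \<and> Phi (u \<otimes> (b \<otimes> x)) z' \<and> z' \<sim>v c \<otimes> z)"
      then obtain z1 z1' z2 z2' where z: "z1 \<in> K" "z1' \<in> K" "z2 \<in> K" "z2' \<in> K"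
        "Phi (a \<otimes> x) z1" "Phi (u \<otimes> (a \<otimes> x)) z1'" "z1' \<sim>v c \<otimes> z1"
        "Phi (b \<otimes> x) z2" "Phi (u \<otimes> (b \<otimes> x)) z2'" "z2' \<sim>v c \<otimes> z2" by blast
      have c0: "c ~= \<zero>" using rveq_nonzero(2)[OF z(7)] z c by auto
      have z': "Phi (a \<otimes> (u \<otimes> x)) z1'" "Phi (b \<otimes> (u \<otimes> x)) z2'" using z(6,9) u x ab by (simp_all add: m_lcomm)
      have uxK: "u \<otimes> x \<in> K" using u x by simp
      show "\<forall>y \<in> K. Psi (u \<otimes> x) y \<longleftrightarrow> Psi x y"
      proof
        fix y assume y: "y \<in> K"
        show "Psi (u \<otimes> x) y \<longleftrightarrow> Psi x y"
        proof (cases "y = \<zero>")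
          case True
          then show ?thesis using Psi_nz uxK x by blast
        next
          case False
          have 1: "Psi (u \<otimes> x) y \<longleftrightarrow> z2' \<sim>v y \<otimes> z1'" using Psi_iff[OF z' uxK y z(2,4)] .
          have 2: "Psi x y \<longleftrightarrow> z2 \<sim>v y \<otimes> z1" using Psi_iff[OF z(5,8) x y z(1,3)] .
          have "y \<otimes> z1' \<sim>v y \<otimes> (c \<otimes> z1)" using rveq_mult_iff(1)[of z1' "c \<otimes> z1" y] z c y False by simp
          then have "z2' \<sim>v y \<otimes> z1' \<longleftrightarrow> z2' \<sim>v y \<otimes> (c \<otimes> z1)" using rveq_cong(2)[of "y \<otimes> z1'" "y \<otimes> (c \<otimes> z1)" z2'] z c y by simp
          also have "\<dots> \<longleftrightarrow> c \<otimes> z2 \<sim>v y \<otimes> (c \<otimes> z1)" using rveq_cong(1)[OF z(10), of "y \<otimes> (c \<otimes> z1)"] z c y by simp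
          also have "y \<otimes> (c \<otimes> z1) = c \<otimes> (y \<otimes> z1)" using z c y by (simp add: m_lcomm)
          also have "c \<otimes> z2 \<sim>v c \<otimes> (y \<otimes> z1) \<longleftrightarrow> z2 \<sim>v y \<otimes> z1" using rveq_mult_iff(1)[of z2 "y \<otimes> z1" c] z c y c0 by simp
          finally show ?thesis using 1 2 by blast
        qed
      qed
    qed
  next
    fix g assume g: "g \<in> K" "g ~= \<zero>" "\<one> <v g"
    \<comment> \<open>The value of \<open>\<psi>(x)\<close> is
      \<open>v(\<phi>(b x)) - v(\<phi>(a x))\<close>: the first is below 0 and the second eventually
      at least \<open>- v(g)\<close>.\<close>
    have "inv g <v \<one>" using mult_le_iff(1)[of g \<one> "inv g"] g by simp
    then have "ev (\<lambda>x. \<forall>z \<in> K. Phi x z --> inv g \<le>v z)" using Phi_ge[of "inv g"] g by simp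
    from ev_conj[OF ev_scale[OF this ab(1,3)] lt_ab]
    show "ev (\<lambda>x. \<forall>y \<in> K. Psi x y --> \<one> <v y \<and> y <v g)"
    proof (rule ev_mono, intro ballI impI)
      fix x y assume x: "x \<in> K" and h: "(\<forall>z \<in> K. Phi (a \<otimes> x) z --> inv g \<le>v z) \<and>
          (\<forall>z \<in> K. \<forall>z' \<in> K. Phi (a \<otimes> x) z --> Phi (b \<otimes> x) z' --> z <v z')"
        and y: "y \<in> K" "Psi x y"
      obtain z z' where z: "z \<in> K" "z' \<in> K" "Phi (a \<otimes> x) z" "Phi (b \<otimes> x) z'" "z' \<sim>v y \<otimes> z"
        using y unfolding Psi_def by blast
      have z0: "z ~= \<zero>" using Phi_nz[of "a \<otimes> x" z] z x ab by auto
      have "z <v z'" "inv g \<le>v z" using h z by blast+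
      have zy: "z' =v y \<otimes> z" using rveq_eqv z y by simp
      have "z' <v \<one>" using Phi_lt[of "b \<otimes> x" z'] z x ab by simp
      have "z <v y \<otimes> z" using eqv_le(1)[OF zy, of z] \<open>z <v z'\<close> z y by simp
      then have "\<one> <v y" using mult_le_iff(1)[of y \<one> z] z z0 y by simp
      moreover have "y <v g"
      proof
        assume "g \<le>v y"
        then have "g \<otimes> z \<le>v y \<otimes> z" using mult_le_iff(1)[of g y z] z z0 y g by simp
        moreover have "\<one> \<le>v g \<otimes> z" using mult_le_iff(2)[of "inv g" z g] \<open>inv g \<le>v z\<close> g z by simp
        ultimately have "\<one> \<le>v y \<otimes> z" using le_trans[of \<one> "g \<otimes> z" "y \<otimes> z"] g y z by simp
        then show False using eqv_le(2)[OF zy, of \<one>] \<open>z' <v \<one>\<close> z y by simp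
      qed
      ultimately show "\<one> <v y \<and> y <v g" ..
    qed
  qed
qed

text \<open>A fixed value at the zeros of \<open>f\<close> keeps the inverse total with definable
  graph; below it is applied to a function that is eventually nonzero.\<close>

lemma def_fun_total_inverse:
  assumes f: "def2 (\<lambda>z x. z = f x)" and fK: "!!x. x \<in> K ==> f x \<in> K"
  shows "def2 (\<lambda>z x. z = (if f x = \<zero> then \<zero> else inv (f x)))"
proof -
  note [dfn] = dt_fun[OF f fK]
  have *: "dp 2 (\<lambda>xs. (f (hd (tl xs)) = \<zero> \<and> hd xs = \<zero>) \<or>
      (f (hd (tl xs)) ~= \<zero> \<and> hd xs \<otimes> f (hd (tl xs)) = \<one>))"
    by (intro dfn) auto
  have iff: "z \<otimes> y = \<one> \<longleftrightarrow> z = inv y" if "z \<in> K" "y \<in> K" "y ~= \<zero>" for z y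
    using that comm_inv_char[of y z] m_comm[of y z] by auto
  show ?thesis unfolding def2_def
  proof (rule dp_congI[OF *])
    fix xs assume "length xs = 2" "set xs \<subseteq> K"
    then obtain z x where "xs = [z, x]" "z \<in> K" "x \<in> K" by (auto simp: numeral_2_eq_2 length_Suc_conv)
    then show "((f (hd (tl xs)) = \<zero> \<and> hd xs = \<zero>) \<or> (f (hd (tl xs)) ~= \<zero> \<and> hd xs \<otimes> f (hd (tl xs)) = \<one>)) =
        (hd xs = (if f (hd (tl xs)) = \<zero> then \<zero> else inv (f (hd (tl xs)))))"
      using iff[of z "f x"] fK by auto
  qed
qed

lemma no_limit_from_below_scaled:
  assumes f: "def2 (\<lambda>z x. z = f x)" and fK: "!!x. x \<in> K ==> f x \<in> K"
    and s: "s \<in> K" "s ~= \<zero>"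
    and B1: "!!g. g \<in> K ==> g ~= \<zero> ==> g <v s ==> \<exists>a \<in> K. ev (\<lambda>x. g \<le>v f x \<ominus> a)"
    and B2: "!!a. a \<in> K ==> ev (\<lambda>x. f x \<ominus> a <v s)"
  shows False
proof (rule no_limit_from_below[of "\<lambda>x. inv s \<otimes> f x"])
  note [dfn] = dt_fun[OF f fK]
  show "def2 (\<lambda>z x. z = inv s \<otimes> f x)" unfolding def2_def using s by (intro dfn) auto
  show "inv s \<otimes> f x \<in> K" if "x \<in> K" for x using that s fK by simp
  have dist: "inv s \<otimes> y \<ominus> inv s \<otimes> a = inv s \<otimes> (y \<ominus> a)" if "y \<in> K" "a \<in> K" for y a
    using that s by (simp add: a_minus_def r_distr r_minus)
  show "\<exists>a \<in> K. ev (\<lambda>x. g \<le>v inv s \<otimes> f x \<ominus> a)" if g: "g \<in> K" "g ~= \<zero>" "g <v \<one>" for g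
  proof -
    have "s \<otimes> g <v s" using mult_le_iff(2)[of \<one> g s] g s by simp
    then obtain a where a: "a \<in> K" "ev (\<lambda>x. s \<otimes> g \<le>v f x \<ominus> a)" using B1[of "s \<otimes> g"] g s by auto
    have "ev (\<lambda>x. g \<le>v inv s \<otimes> f x \<ominus> inv s \<otimes> a)" using a(2)
    proof (rule ev_mono)
      fix x assume x: "x \<in> K" "s \<otimes> g \<le>v f x \<ominus> a"
      then have "inv s \<otimes> (s \<otimes> g) \<le>v inv s \<otimes> (f x \<ominus> a)"
        using mult_le_iff(2)[of "s \<otimes> g" "f x \<ominus> a" "inv s"] s g a fK by simp
      then show "g \<le>v inv s \<otimes> f x \<ominus> inv s \<otimes> a" using dist[of "f x" a] x fK a s g by simp
    qed
    then show ?thesis using a s by blast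
  qed
  show "ev (\<lambda>x. inv s \<otimes> f x \<ominus> a <v \<one>)" if a: "a \<in> K" for a
  proof (rule ev_mono[OF B2[of "s \<otimes> a"]])
    fix x assume x: "x \<in> K" "f x \<ominus> s \<otimes> a <v s"
    then have "inv s \<otimes> (f x \<ominus> s \<otimes> a) <v inv s \<otimes> s"
      using mult_le_iff(2)[of s "f x \<ominus> s \<otimes> a" "inv s"] s a fK by simp
    then show "inv s \<otimes> f x \<ominus> a <v \<one>" using dist[of "f x" "s \<otimes> a"] x fK a s by simp
  qed (use a s in auto)
qed

text \<open>The assumption \<open>complete\<close> is definable completeness for closed balls
  indexed by pairs of a centre \<open>a\<close> and an element \<open>g\<close> representing the
  radius. The second alternative of the conclusion is convergence to \<infinity>.\<close>

lemma limit_exists: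
  assumes f: "def2 (\<lambda>z x. z = f x)" and fK: "!!x. x \<in> K ==> f x \<in> K"
    and complete: "!!D :: 'a \<Rightarrow> 'a \<Rightarrow> bool. def2 D ==>
      (!!a g. a \<in> K ==> g \<in> K ==> D a g ==> g ~= \<zero>) ==>
      (!!a g a' g'. a \<in> K ==> g \<in> K ==> a' \<in> K ==> g' \<in> K ==> D a g ==> D a' g' ==>
         {x \<in> K. g \<le>v x \<ominus> a} \<subseteq> {x \<in> K. g' \<le>v x \<ominus> a'} \<or> {x \<in> K. g' \<le>v x \<ominus> a'} \<subseteq> {x \<in> K. g \<le>v x \<ominus> a}) ==>
      (!!h. h \<in> K ==> h ~= \<zero> ==> \<exists>a \<in> K. \<exists>g \<in> K. D a g \<and> h <v g) ==>
      \<exists>l \<in> K. \<forall>a \<in> K. \<forall>g \<in> K. D a g --> g \<le>v l \<ominus> a"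
  shows "(\<exists>l \<in> K. \<forall>g \<in> K. g ~= \<zero> --> ev (\<lambda>x. g <v f x \<ominus> l)) \<or> (\<forall>g \<in> K. g ~= \<zero> --> ev (\<lambda>x. f x <v g))"
proof (rule disjCI)
  note [dfn] = dt_fun[OF f fK]
  assume "~ (\<forall>g \<in> K. g ~= \<zero> --> ev (\<lambda>x. f x <v g))"
  then obtain g0 where g0: "g0 \<in> K" "g0 ~= \<zero>" "~ ev (\<lambda>x. f x <v g0)" by blast
  have ball_dich: "ev (\<lambda>x. g \<le>v f x \<ominus> a) \<or> ev (\<lambda>x. f x \<ominus> a <v g)" if "g \<in> K" "a \<in> K" for g a
    by (rule ev_dichotomy) (use that in \<open>unfold def1_def, intro dfn, auto\<close>)
  define D where "D a g \<longleftrightarrow> g ~= \<zero> \<and> ev (\<lambda>x. g \<le>v f x \<ominus> a)" for a g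
  have Ddef: "def2 D" unfolding D_def def2_def by (intro dfn) auto
  note [dfn] = dp_subst2[OF Ddef]
  have Dmono: "D a h" if "D a g" "h \<le>v g" "h ~= \<zero>" "a \<in> K" "g \<in> K" "h \<in> K" for a g h
  proof -
    have "ev (\<lambda>x. h \<le>v f x \<ominus> a)" using that(1)[unfolded D_def, THEN conjunct2]
      by (rule ev_mono) (use that fK le_trans[of h g] in auto)
    then show ?thesis using that unfolding D_def by blast
  qed
  have D0: "D \<zero> g0"
  proof -
    have "~ ev (\<lambda>x. f x \<ominus> \<zero> <v g0)"
    proof
      assume "ev (\<lambda>x. f x \<ominus> \<zero> <v g0)"
      then have "ev (\<lambda>x. f x <v g0)" by (rule ev_mono) (simp add: fK)
      then show False using g0 by blast
    qed
    then show ?thesis using ball_dich[of g0 \<zero>] g0 unfolding D_def by simp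
  qed
  show "\<exists>l \<in> K. \<forall>g \<in> K. g ~= \<zero> --> ev (\<lambda>x. g <v f x \<ominus> l)"
  proof (cases "\<forall>h \<in> K. h ~= \<zero> --> (\<exists>a \<in> K. \<exists>g \<in> K. D a g \<and> h <v g)")
    case True
    \<comment> \<open>Two balls that eventually contain \<open>f x\<close> share a point
      \<open>f y\<close>, so they are nested according to their radii.\<close>
    have sub: "{x \<in> K. g \<le>v x \<ominus> a} \<subseteq> {x \<in> K. g' \<le>v x \<ominus> a'}"
      if K4: "a \<in> K" "g \<in> K" "a' \<in> K" "g' \<in> K" and D2: "D a g" "D a' g'" and "g' \<le>v g" for a g a' g'
    proof
      fix x assume x: "x \<in> {x \<in> K. g \<le>v x \<ominus> a}"
      obtain y where y: "y \<in> K" "g \<le>v f y \<ominus> a" "g' \<le>v f y \<ominus> a'"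
        using ev_exists[OF ev_conj[OF D2(1)[unfolded D_def, THEN conjunct2] D2(2)[unfolded D_def, THEN conjunct2]]] by blast
      have "g \<le>v a \<ominus> f y" using y K4 diff_sym[of a "f y" g] fK by simp
      then have "g \<le>v x \<ominus> f y" using le_diff_trans[of g x a "f y"] x y K4 fK by simp
      then have "g' \<le>v x \<ominus> f y" using le_trans[of g' g "x \<ominus> f y"] \<open>g' \<le>v g\<close> x y K4 fK by simp
      then have "g' \<le>v x \<ominus> a'" using le_diff_trans[of g' x "f y" a'] x y K4 fK by simp
      then show "x \<in> {x \<in> K. g' \<le>v x \<ominus> a'}" using x by simp
    qed
    have "\<exists>l \<in> K. \<forall>a \<in> K. \<forall>g \<in> K. D a g --> g \<le>v l \<ominus> a"
    proof (rule complete[OF Ddef])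
      show "g ~= \<zero>" if "D a g" for a g using that by (simp add: D_def)
      show "{x \<in> K. g \<le>v x \<ominus> a} \<subseteq> {x \<in> K. g' \<le>v x \<ominus> a'} \<or> {x \<in> K. g' \<le>v x \<ominus> a'} \<subseteq> {x \<in> K. g \<le>v x \<ominus> a}"
        if "a \<in> K" "g \<in> K" "a' \<in> K" "g' \<in> K" "D a g" "D a' g'" for a g a' g'
        using sub[of a g a' g'] sub[of a' g' a g] that le_total[of g g'] by blast
    qed (use True in blast)
    then obtain l where l: "l \<in> K" "!!a g. a \<in> K ==> g \<in> K ==> D a g ==> g \<le>v l \<ominus> a" by blast
    have "ev (\<lambda>x. h <v f x \<ominus> l)" if h: "h \<in> K" "h ~= \<zero>" for h
    proof -
      obtain a g where ag: "a \<in> K" "g \<in> K" "D a g" "h <v g" using True h by blast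
      have "g \<le>v a \<ominus> l" using l(2)[OF ag(1-3)] diff_sym[of a l g] l ag by simp
      show ?thesis
      proof (rule ev_mono[OF ag(3)[unfolded D_def, THEN conjunct2]])
        fix x assume x: "x \<in> K" "g \<le>v f x \<ominus> a"
        then have "g \<le>v f x \<ominus> l" using le_diff_trans[of g "f x" a l] \<open>g \<le>v a \<ominus> l\<close> l ag fK by simp
        then show "h <v f x \<ominus> l" using ag(4) le_trans[of g "f x \<ominus> l" h] ag x l h fK by auto
      qed
    qed
    then show ?thesis using l by blast
  next
    case False
    then obtain h where h: "h \<in> K" "h ~= \<zero>" "!!a g. a \<in> K ==> g \<in> K ==> D a g ==> g \<le>v h" by blast
    define G where "G g \<longleftrightarrow> (\<exists>a \<in> K. D a g)" for g
    have Gdef: "def1 G" unfolding G_def def1_def by (intro dfn) auto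
    have "\<exists>s \<in> K. s ~= \<zero> \<and> is_sup G s"
      by (rule sup_exists[OF Gdef g0(1,2) _ h(1,2)]) (use D0 h in \<open>auto simp: G_def\<close>)
    then obtain s where s: "s \<in> K" "s ~= \<zero>" "is_sup G s" by blast
    have below: "\<exists>a \<in> K. ev (\<lambda>x. g \<le>v f x \<ominus> a)" if g: "g \<in> K" "g ~= \<zero>" "g <v s" for g
    proof -
      obtain k a where "k \<in> K" "a \<in> K" "D a k" "g <v k" using s(3) g unfolding is_sup_def G_def by blast
      then have "D a g" using Dmono[of a k g] g lt_imp_le by blast
      then show ?thesis using \<open>a \<in> K\<close> unfolding D_def by blast
    qed
    have above: "ev (\<lambda>x. f x \<ominus> a <v g)" if g: "g \<in> K" "g ~= \<zero>" "s <v g" and a: "a \<in> K" for g a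
    proof -
      have "~ D a g" using s(3) g a unfolding is_sup_def G_def by blast
      then show ?thesis using ball_dich[of g a] g a unfolding D_def by blast
    qed
    have False
    proof (cases "\<exists>a \<in> K. D a s")
      case False
      have "ev (\<lambda>x. f x \<ominus> a <v s)" if "a \<in> K" for a
        using ball_dich[of s a] False that s unfolding D_def by blast
      then show False using no_limit_from_below_scaled[OF f fK s(1,2) below] by blast
    next
      case True
      then obtain a where a: "a \<in> K" "ev (\<lambda>x. s \<le>v f x \<ominus> a)" unfolding D_def by blast
      \<comment> \<open>The supremum is attained by a ball about \<open>a\<close>.
        \<open>H w x\<close> says that \<open>w\<close> has the residue of
        \<open>(f x - a) / s\<close>; this residue is eventually constant, and moving the centre to
        \<open>b\<close> places \<open>f x\<close> strictly inside the closed ball.\<close>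
      define H where "H w x \<longleftrightarrow> s <v (f x \<ominus> a) \<ominus> s \<otimes> w" for w x
      have Hdef: "def2 H" unfolding H_def def2_def using a s by (intro dfn) auto
      have "\<exists>w \<in> K. \<one> \<le>v w \<and> ev (H w)"
      proof (rule ev_residue_const[OF Hdef])
        fix w w' x assume w: "w \<in> K" "w' \<in> K" "x \<in> K" "\<one> <v w' \<ominus> w" "H w x"
        have "\<one> <v w \<ominus> w'" using w diff_sym by simp
        then have "s \<otimes> \<one> <v s \<otimes> (w \<ominus> w')" using mult_le_iff(2)[of "w \<ominus> w'" \<one> s] s w by simp
        moreover have "s \<otimes> (w \<ominus> w') = s \<otimes> w \<ominus> s \<otimes> w'" using s w by (simp add: a_minus_def r_distr r_minus)
        ultimately show "H w' x"
          using lt_diff_trans[where x = "f x \<ominus> a" and y = "s \<otimes> w" and z = "s \<otimes> w'" and g = s] w s a fK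
          unfolding H_def by simp
      next
        from a(2) show "ev (\<lambda>x. \<exists>w \<in> K. \<one> \<le>v w \<and> H w x)"
        proof (rule ev_mono)
          fix x assume x: "x \<in> K" "s \<le>v f x \<ominus> a"
          have "inv s \<otimes> s \<le>v inv s \<otimes> (f x \<ominus> a)" using mult_le_iff(2)[of s "f x \<ominus> a" "inv s"] x s a fK by simp
          then show "\<exists>w \<in> K. \<one> \<le>v w \<and> H w x"
            using x s a fK by (intro bexI[of _ "inv s \<otimes> (f x \<ominus> a)"]) (simp_all add: H_def)
        qed
      qed
      then obtain w where w: "w \<in> K" "ev (H w)" by blast
      define b where "b = a \<oplus> s \<otimes> w"
      have bK: "b \<in> K" using a s w by (simp add: b_def)
      have gt: "ev (\<lambda>x. s <v f x \<ominus> b)" using w(2)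
      proof (rule ev_mono)
        fix x assume x: "x \<in> K" "H w x"
        have "(f x \<ominus> a) \<ominus> s \<otimes> w = f x \<ominus> b"
          using fK[OF x(1)] a s w by (simp add: b_def a_minus_def minus_add a_assoc)
        then show "s <v f x \<ominus> b" using x by (simp add: H_def)
      qed
      \<comment> \<open>Now \<open>v(f x - b)\<close> tends to \<open>v(s)\<close> from above, so
        its inverse \<open>k\<close> tends to value \<open>- v(s)\<close> from below and the
        unattained case applies to \<open>k\<close>.\<close>
      define k where "k x = (if f x \<ominus> b = \<zero> then \<zero> else inv (f x \<ominus> b))" for x
      have fb: "def2 (\<lambda>z x. z = f x \<ominus> b)" unfolding def2_def using bK by (intro dfn) auto
      have kdef: "def2 (\<lambda>z x. z = k x)" unfolding k_def
        by (rule def_fun_total_inverse[OF fb]) (use fK bK in auto)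
      have kK: "k x \<in> K" if "x \<in> K" for x using that fK bK by (simp add: k_def)
      have k_ge: "ev (\<lambda>x. g \<le>v k x)" if g: "g \<in> K" "g ~= \<zero>" "g <v inv s" for g
      proof -
        have "s <v inv g" using inv_le_iff[of s "inv g"] g s by (simp add: field_Units Units_inv_inv)
        from above[of "inv g" b] this have "ev (\<lambda>x. f x \<ominus> b <v inv g)" using g bK by simp
        then show ?thesis
        proof (rule ev_mono)
          fix x assume x: "x \<in> K" "f x \<ominus> b <v inv g"
          have nz: "f x \<ominus> b ~= \<zero>" using x g by auto
          have "f x \<ominus> b \<le>v inv g" using x lt_imp_le g fK bK by simp
          then have "inv (inv g) \<le>v inv (f x \<ominus> b)" using inv_le_iff[of "inv g" "f x \<ominus> b"] nz x g fK bK by simp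
          then show "g \<le>v k x" using nz g by (simp add: k_def field_Units Units_inv_inv)
        qed
      qed
      \<comment> \<open>The bound \<open>h'\<close> keeps \<open>f x \<ominus> b\<close> away from
        \<open>\<zero>\<close>, where \<open>k\<close> has only its default value.\<close>
      obtain h' where h': "h' \<in> K" "h' ~= \<zero>" "s <v h'" using exists_gt[OF s(1,2)] by blast
      have k_lt: "ev (\<lambda>x. k x <v inv s)"
      proof (rule ev_mono[OF ev_conj[OF gt above[OF h' bK]]])
        fix x assume x: "x \<in> K" and "s <v f x \<ominus> b \<and> f x \<ominus> b <v h'"
        then have nz: "f x \<ominus> b ~= \<zero>" "s <v f x \<ominus> b" using h' by auto
        then show "k x <v inv s" using inv_le_iff[of s "f x \<ominus> b"] s x fK bK by (simp add: k_def)
      qed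
      show False
      proof (rule no_limit_from_below_scaled[OF kdef kK])
        show "inv s \<in> K" "inv s ~= \<zero>" using s by simp_all
        fix g assume g: "g \<in> K" "g ~= \<zero>" "g <v inv s"
        have "ev (\<lambda>x. g \<le>v k x \<ominus> \<zero>)" using k_ge[OF g] by (rule ev_mono) (simp add: kK)
        then show "\<exists>a \<in> K. ev (\<lambda>x. g \<le>v k x \<ominus> a)" by blast
      next
        fix c assume c: "c \<in> K"
        have si: "inv s \<in> K" "inv s ~= \<zero>" using s by simp_all
        show "ev (\<lambda>x. k x \<ominus> c <v inv s)"
        \<comment> \<open>In either case \<open>k x\<close> and \<open>c\<close> have different
          values and the smaller one, below \<open>- v(s)\<close>, is the value of the
          difference.\<close>
        proof (cases "inv s \<le>v c")
          case True
          from k_lt show ?thesis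
          proof (rule ev_mono)
            fix x assume x: "x \<in> K" "k x <v inv s"
            have "k x <v c" using lt_le_trans[where x = "k x" and y = "inv s" and z = c] x True si c kK by simp
            then have "k x \<ominus> c =v k x" using dominate[where x = "k x" and y = c] x c kK by simp
            then show "k x \<ominus> c <v inv s" using eqv_le(2)[of "k x \<ominus> c" "k x" "inv s"] x c kK si by simp
          qed
        next
          case False
          obtain g where g: "g \<in> K" "g ~= \<zero>" "c <v g" "g <v inv s" using dense[OF False] c si by blast
          from k_ge[OF g(1,2,4)] show ?thesis
          proof (rule ev_mono)
            fix x assume x: "x \<in> K" "g \<le>v k x"
            have "c <v k x" using lt_le_trans[where x = c and y = g and z = "k x"] g x c kK by simp
            then have "c \<ominus> k x =v c" using dominate[where x = c and y = "k x"] x c kK by simp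
            then have "k x \<ominus> c =v c" using diff_sym[of c "k x" c] x c kK by (simp add: eqv_def)
            then show "k x \<ominus> c <v inv s" using eqv_le(2)[of "k x \<ominus> c" c "inv s"] False x c kK si by simp
          qed
        qed
      qed
    qed
    then show ?thesis ..
  qed
qed

end

section \<open>Models of \<open>C\<close>-minimal theories\<close>

lemma home_ring_simps [simp]:
  "carrier (home_ring L M) = univ M (home L)"
  "x \<otimes>\<^bsub>home_ring L M\<^esub> y = fint M (mult_sym L) [x, y]"
  "x \<oplus>\<^bsub>home_ring L M\<^esub> y = fint M (add_sym L) [x, y]"
  by (simp_all add: home_ring_def)

lemma acvf_valued_field:
  assumes "acvf L M"
  shows "valued_field (home_ring L M) (vdiv L M)"
proof -
  define R where "R = home_ring L M"
  have R: "algebraically_closed R"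
    "!!x y. x \<in> carrier R ==> y \<in> carrier R ==> vdiv L M x y \<or> vdiv L M y x"
    "!!x y z. x \<in> carrier R ==> y \<in> carrier R ==> z \<in> carrier R ==> vdiv L M x y ==> vdiv L M y z ==> vdiv L M x z"
    "!!x y z. x \<in> carrier R ==> y \<in> carrier R ==> z \<in> carrier R ==> vdiv L M x y ==>
      vdiv L M (x \<otimes>\<^bsub>R\<^esub> z) (y \<otimes>\<^bsub>R\<^esub> z)"
    "!!x y. x \<in> carrier R ==> y \<in> carrier R ==> vdiv L M x y ==> vdiv L M x (x \<oplus>\<^bsub>R\<^esub> y)"
    "!!x. x \<in> carrier R ==> vdiv L M \<zero>\<^bsub>R\<^esub> x ==> x = \<zero>\<^bsub>R\<^esub>"
    and nt: "\<exists>x \<in> carrier R. x ~= \<zero>\<^bsub>R\<^esub> \<and> val L M x ~= val L M \<one>\<^bsub>R\<^esub>"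
    using assms unfolding acvf_def Let_def R_def[symmetric] by blast+
  interpret F: field R using R(1) by (simp add: algebraically_closed_def)
  have K: "univ M (home L) = carrier R" by (simp add: R_def)
  have "\<exists>x \<in> carrier R. x ~= \<zero>\<^bsub>R\<^esub> \<and> ~ (vdiv L M x \<one>\<^bsub>R\<^esub> \<and> vdiv L M \<one>\<^bsub>R\<^esub> x)"
  proof -
    obtain x where x: "x \<in> carrier R" "x ~= \<zero>\<^bsub>R\<^esub>" "val L M x ~= val L M \<one>\<^bsub>R\<^esub>" using nt by blast
    have "~ (vdiv L M x \<one>\<^bsub>R\<^esub> \<and> vdiv L M \<one>\<^bsub>R\<^esub> x)"
    proof
      assume "vdiv L M x \<one>\<^bsub>R\<^esub> \<and> vdiv L M \<one>\<^bsub>R\<^esub> x"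
      then have "vdiv L M x y \<and> vdiv L M y x \<longleftrightarrow> vdiv L M \<one>\<^bsub>R\<^esub> y \<and> vdiv L M y \<one>\<^bsub>R\<^esub>" if "y \<in> carrier R" for y
        using R(3)[of x "\<one>\<^bsub>R\<^esub>" y] R(3)[of "\<one>\<^bsub>R\<^esub>" x y] R(3)[of y x "\<one>\<^bsub>R\<^esub>"] R(3)[of y "\<one>\<^bsub>R\<^esub>" x] x that by blast
      then have "val L M x = val L M \<one>\<^bsub>R\<^esub>" unfolding val_def K by blast
      then show False using x by blast
    qed
    then show ?thesis using x by blast
  qed
  note nt' = this
  have "valued_field R (vdiv L M)"
    by (rule valued_field.intro[OF F.field_axioms valued_field_axioms.intro])
      (fact R nt')+
  then show ?thesis by (simp add: R_def)
qed

lemma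
  assumes "acvf L M" and g: "g \<in> univ M (home L)" and y: "y \<in> univ M (home L)"
  shows val_le_val: "val_le L M (val L M g) (val L M y) \<longleftrightarrow> vdiv L M g y"
    and val_less_val: "val_less L M (val L M g) (val L M y) \<longleftrightarrow> ~ vdiv L M y g"
proof -
  interpret valued_field "home_ring L M" "vdiv L M" by (rule acvf_valued_field[OF assms(1)])
  have self: "x \<in> val L M x" if "x \<in> univ M (home L)" for x
    using that le_refl[of x] by (simp add: val_def)
  show 1: "val_le L M (val L M g) (val L M y) \<longleftrightarrow> vdiv L M g y"
  proof
    assume "val_le L M (val L M g) (val L M y)"
    then obtain a b where "a \<in> univ M (home L)" "vdiv L M g a" "vdiv L M a b" "b \<in> univ M (home L)" "vdiv L M b y"
      unfolding val_le_def val_def by auto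
    then show "vdiv L M g y" using le_trans[of g a b] le_trans[of g b y] g y by simp
  qed (use self g y in \<open>auto simp: val_le_def\<close>)
  have "val L M g = val L M y \<longleftrightarrow> vdiv L M g y \<and> vdiv L M y g"
  proof
    assume "val L M g = val L M y"
    then have "g \<in> val L M y" using self g by blast
    then show "vdiv L M g y \<and> vdiv L M y g" by (simp add: val_def)
  next
    assume *: "vdiv L M g y \<and> vdiv L M y g"
    then have "vdiv L M g z \<and> vdiv L M z g \<longleftrightarrow> vdiv L M y z \<and> vdiv L M z y" if "z \<in> univ M (home L)" for z
      using le_trans[of g y z] le_trans[of y g z] le_trans[of z g y] le_trans[of z y g] g y that by auto
    then show "val L M g = val L M y" unfolding val_def by blast
  qed
  then show "val_less L M (val L M g) (val L M y) \<longleftrightarrow> ~ vdiv L M y g"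
    unfolding val_less_def 1 using le_total[of g y] g y by auto
qed

lemma
  assumes "acvf L M" and g: "g \<in> univ M (home L)" and a: "a \<in> univ M (home L)"
  shows open_ball_val: "open_ball L M a (val L M g) =
      {x \<in> univ M (home L). ~ vdiv L M (x \<ominus>\<^bsub>home_ring L M\<^esub> a) g}"
    and closed_ball_val: "closed_ball L M a (val L M g) =
      {x \<in> univ M (home L). vdiv L M g (x \<ominus>\<^bsub>home_ring L M\<^esub> a)}"
proof -
  interpret valued_field "home_ring L M" "vdiv L M" by (rule acvf_valued_field[OF assms(1)])
  have "x \<ominus>\<^bsub>home_ring L M\<^esub> a \<in> univ M (home L)" if "x \<in> univ M (home L)" for x
    using minus_closed[of x a] that a by simp
  then show "open_ball L M a (val L M g) = {x \<in> univ M (home L). ~ vdiv L M (x \<ominus>\<^bsub>home_ring L M\<^esub> a) g}"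
    and "closed_ball L M a (val L M g) = {x \<in> univ M (home L). vdiv L M g (x \<ominus>\<^bsub>home_ring L M\<^esub> a)}"
    unfolding open_ball_def closed_ball_def using val_le_val[OF assms(1) g] val_less_val[OF assms(1) g] by auto
qed

lemma is_ball_iff:
  assumes "acvf L M"
  shows "is_ball L M B \<longleftrightarrow> (\<exists>a \<in> univ M (home L). \<exists>g \<in> univ M (home L) - {\<zero>\<^bsub>home_ring L M\<^esub>}.
     B = {x \<in> univ M (home L). ~ vdiv L M (x \<ominus>\<^bsub>home_ring L M\<^esub> a) g} \<or>
     B = {x \<in> univ M (home L). vdiv L M g (x \<ominus>\<^bsub>home_ring L M\<^esub> a)})"
proof -
  have "is_ball L M B \<longleftrightarrow> (\<exists>a \<in> univ M (home L). \<exists>g \<in> univ M (home L) - {\<zero>\<^bsub>home_ring L M\<^esub>}.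
     B = open_ball L M a (val L M g) \<or> B = closed_ball L M a (val L M g))"
    unfolding is_ball_def ball_of_radius_def value_group_def by blast
  then show ?thesis using open_ball_val[OF assms] closed_ball_val[OF assms] by auto
qed

lemma c_minimal_model_field:
  assumes L: "is_vf_lang L" and M: "acvf L M" "c_minimal_model L M"
  shows "c_minimal_field (home_ring L M) (vdiv L M) (dp_of L M)"
proof -
  interpret valued_field "home_ring L M" "vdiv L M" by (rule acvf_valued_field[OF M(1)])
  show ?thesis
  proof (unfold_locales, unfold home_ring_simps)
    fix n P and Q :: "'d list \<Rightarrow> bool"
    assume *: "!!xs. length xs = n ==> set xs \<subseteq> univ M (home L) ==> P xs = Q xs" "dp_of L M n P"
    have "dp_of L M n P = dp_of L M n Q" by (rule dp_of_cong) (rule *(1))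
    then show "dp_of L M n Q" using * by simp
  next
    fix P assume "dp_of L M 1 P"
    then have "definable L M [home L] {xs \<in> ntuples (univ M (home L)) 1. P xs}"
      unfolding dp_of_def by simp
    also have "{xs \<in> ntuples (univ M (home L)) 1. P xs} = (\<lambda>x. [x]) ` {x \<in> univ M (home L). P [x]}"
      by (auto simp: length_Suc_conv image_iff)
    finally have "{x \<in> univ M (home L). P [x]} \<in> bool_combs (univ M (home L))
              ({B. is_ball L M B} \<union> {{a} | a. a \<in> univ M (home L)})"
      using M(2) unfolding c_minimal_model_def by blast
    then show "{x \<in> univ M (home L). P [x]} \<in> bool_combs (univ M (home L))
      ({B. \<exists>a \<in> univ M (home L). \<exists>g \<in> univ M (home L) - {\<zero>\<^bsub>home_ring L M\<^esub>}.
          B = {x \<in> univ M (home L). ~ vdiv L M (x \<ominus>\<^bsub>home_ring L M\<^esub> a) g} \<or>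
          B = {x \<in> univ M (home L). vdiv L M g (x \<ominus>\<^bsub>home_ring L M\<^esub> a)}} \<union>
       {{a} | a. a \<in> univ M (home L)})"
      unfolding is_ball_iff[OF M(1)] .
  qed (fact dp_of_not dp_of_conj dp_of_ex dp_of_rename dp_of_param dp_of_atoms[OF L])+
qed

text \<open>The chain is indexed by the pairs \<open>[a, g]\<close> themselves; its total space is a
  definable set of triples, as \<open>definably_complete\<close> requires.\<close>

lemma definably_complete_closed_balls:
  assumes L: "is_vf_lang L" and M: "acvf L M" "c_minimal_model L M" "definably_complete L M"
    and D: "c_minimal_field.def2 (dp_of L M) D"
    and nz: "!!a g. a \<in> univ M (home L) ==> g \<in> univ M (home L) ==> D a g ==> g ~= \<zero>\<^bsub>home_ring L M\<^esub>"
    and chain: "!!a g a' g'. a \<in> univ M (home L) ==> g \<in> univ M (home L) ==> a' \<in> univ M (home L) ==>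
        g' \<in> univ M (home L) ==> D a g ==> D a' g' ==>
      {x \<in> univ M (home L). vdiv L M g (x \<ominus>\<^bsub>home_ring L M\<^esub> a)} \<subseteq> {x \<in> univ M (home L). vdiv L M g' (x \<ominus>\<^bsub>home_ring L M\<^esub> a')} \<or>
      {x \<in> univ M (home L). vdiv L M g' (x \<ominus>\<^bsub>home_ring L M\<^esub> a')} \<subseteq> {x \<in> univ M (home L). vdiv L M g (x \<ominus>\<^bsub>home_ring L M\<^esub> a)}"
    and cof: "!!h. h \<in> univ M (home L) ==> h ~= \<zero>\<^bsub>home_ring L M\<^esub> ==>
      \<exists>a \<in> univ M (home L). \<exists>g \<in> univ M (home L). D a g \<and> ~ vdiv L M g h"
  shows "\<exists>l \<in> univ M (home L). \<forall>a \<in> univ M (home L). \<forall>g \<in> univ M (home L).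
     D a g --> vdiv L M g (l \<ominus>\<^bsub>home_ring L M\<^esub> a)"
proof -
  interpret c_minimal_field "home_ring L M" "vdiv L M" "dp_of L M"
    by (rule c_minimal_model_field[OF L M(1,2)])
  let ?K = "univ M (home L)"
  define DD where "DD = {xs \<in> ntuples ?K 2. D (hd xs) (hd (tl xs))}"
  define BB where "BB xs = closed_ball L M (hd xs) (val L M (hd (tl xs)))" for xs
  have DD_iff: "xs \<in> DD \<longleftrightarrow> (\<exists>a \<in> ?K. \<exists>g \<in> ?K. xs = [a, g] \<and> D a g)" for xs
    by (auto simp: DD_def length_Suc_conv numeral_2_eq_2)
  have BB: "BB [a, g] = {x \<in> ?K. vdiv L M g (x \<ominus>\<^bsub>home_ring L M\<^esub> a)}" if "a \<in> ?K" "g \<in> ?K" for a g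
    using closed_ball_val[OF M(1)] that by (simp add: BB_def)
  have radius: "ball_of_radius L M (BB [a, g]) (val L M g)" if "a \<in> ?K" "g \<in> ?K" "D a g" for a g
    using that nz[of a g] by (auto simp: ball_of_radius_def value_group_def BB_def)
  note [dfn] = dp_subst2[OF D]
  have 1: "definable L M [home L, home L] DD"
    using D unfolding def2_def dp_of_def DD_def by (simp add: numeral_2_eq_2)
  have "dp_of L M 3 (\<lambda>xs. D (hd (tl xs)) (hd (tl (tl xs))) \<and> vdiv L M (hd (tl (tl xs))) (hd xs \<ominus>\<^bsub>home_ring L M\<^esub> hd (tl xs)))"
    by (intro dfn) auto
  moreover have "{xs \<in> ntuples ?K 3. D (hd (tl xs)) (hd (tl (tl xs))) \<and> vdiv L M (hd (tl (tl xs))) (hd xs \<ominus>\<^bsub>home_ring L M\<^esub> hd (tl xs))}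
    = {x # a | x a. a \<in> DD \<and> x \<in> BB a}" (is "?A = ?B")
  proof (intro equalityI subsetI)
    fix xs assume "xs \<in> ?A"
    then show "xs \<in> ?B" using BB by (auto simp: DD_iff length_Suc_conv numeral_3_eq_3)
  next
    fix xs assume "xs \<in> ?B"
    then show "xs \<in> ?A" using BB by (auto simp: DD_iff)
  qed
  ultimately have 2: "definable L M (home L # [home L, home L]) {x # a | x a. a \<in> DD \<and> x \<in> BB a}"
    unfolding dp_of_def by (simp add: numeral_3_eq_3)
  have "(\<Inter>a \<in> DD. BB a) ~= {}"
  proof (rule M(3)[unfolded definably_complete_def, rule_format, OF 1 2])
    show "is_ball L M (BB xs)" if "xs \<in> DD" for xs
      using that radius unfolding is_ball_def DD_iff by blast
    show "BB xs \<subseteq> BB ys \<or> BB ys \<subseteq> BB xs" if XY: "xs \<in> DD" "ys \<in> DD" for xs ys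
    proof -
      obtain a g a' g' where *: "a \<in> ?K" "g \<in> ?K" "a' \<in> ?K" "g' \<in> ?K" "D a g" "D a' g'" "xs = [a, g]" "ys = [a', g']"
        using XY unfolding DD_iff by blast
      show ?thesis using chain[OF *(1-6)] BB * by simp
    qed
    show "\<exists>xs \<in> DD. \<exists>\<delta>. ball_of_radius L M (BB xs) \<delta> \<and> val_less L M \<gamma> \<delta>" if \<gamma>: "\<gamma> \<in> value_group L M" for \<gamma>
    proof -
      obtain h where h: "h \<in> ?K" "h ~= \<zero>\<^bsub>home_ring L M\<^esub>" "\<gamma> = val L M h"
        using \<gamma> by (auto simp: value_group_def)
      obtain a g where ag: "a \<in> ?K" "g \<in> ?K" "D a g" "~ vdiv L M g h" using cof[OF h(1,2)] by blast
      have "val_less L M \<gamma> (val L M g)" using val_less_val[OF M(1)] h ag by simp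
      then show ?thesis using radius[OF ag(1-3)] ag by (intro bexI[of _ "[a, g]"] exI) (auto simp: DD_iff)
    qed
  qed
  then obtain l where l: "!!xs. xs \<in> DD ==> l \<in> BB xs" by blast
  \<comment> \<open>The index set has to be inhabited: only membership in some ball puts
    \<open>l\<close> into the home sort.\<close>
  obtain a g where "a \<in> ?K" "g \<in> ?K" "D a g" using cof[of "\<one>\<^bsub>home_ring L M\<^esub>"] one_closed by auto
  then have "l \<in> ?K" using l[of "[a, g]"] BB by (auto simp: DD_iff)
  moreover have "vdiv L M g (l \<ominus>\<^bsub>home_ring L M\<^esub> a)" if "a \<in> ?K" "g \<in> ?K" "D a g" for a g
    using l[of "[a, g]"] BB that by (auto simp: DD_iff)
  ultimately show ?thesis by blast
qed

section \<open>The valuation topology and limits\<close>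

lemma topspace_val_topology:
  assumes "acvf L M" shows "topspace (val_topology L M) = univ M (home L)"
proof -
  interpret valued_field "home_ring L M" "vdiv L M" by (rule acvf_valued_field[OF assms])
  have "a \<in> open_ball L M a (val L M \<one>\<^bsub>home_ring L M\<^esub>)" if "a \<in> univ M (home L)" for a
    using open_ball_val[OF assms _ that] one_closed diff_self[of a] zero_le_iff[of "\<one>\<^bsub>home_ring L M\<^esub>"] that by simp
  moreover have "val L M \<one>\<^bsub>home_ring L M\<^esub> \<in> value_group L M" using one_closed by (auto simp: value_group_def)
  ultimately have "univ M (home L) \<subseteq> \<Union>{open_ball L M a \<gamma> | a \<gamma>. a \<in> univ M (home L) \<and> \<gamma> \<in> value_group L M}" by blast
  then show ?thesis unfolding val_topology_def topology_generated_by_topspace by (auto simp: open_ball_def)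
qed

lemma openin_open_ball:
  assumes "acvf L M" "a \<in> univ M (home L)" "g \<in> univ M (home L)" "g ~= \<zero>\<^bsub>home_ring L M\<^esub>"
  shows "openin (val_topology L M) {x \<in> univ M (home L). ~ vdiv L M (x \<ominus>\<^bsub>home_ring L M\<^esub> a) g}"
proof -
  have "openin (val_topology L M) (open_ball L M a (val L M g))"
    unfolding val_topology_def using assms
    by (intro topology_generated_by_Basis) (auto simp: value_group_def)
  then show ?thesis by (simp only: open_ball_val[OF assms(1,3,2)])
qed

text \<open>Induction over the generated topology: by the ultrametric inequality a basic ball
  contains a ball of the same radius about each of its points, and for intersections the larger
  radius is taken.\<close>

lemma openin_val_topologyD:
  assumes M: "acvf L M" and "openin (val_topology L M) U" "l \<in> U"
  shows "\<exists>g \<in> univ M (home L). g ~= \<zero>\<^bsub>home_ring L M\<^esub> \<and>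
     {x \<in> univ M (home L). ~ vdiv L M (x \<ominus>\<^bsub>home_ring L M\<^esub> l) g} \<subseteq> U"
proof -
  interpret valued_field "home_ring L M" "vdiv L M" by (rule acvf_valued_field[OF M])
  have lK: "l \<in> K"
    using assms(2,3) openin_subset topspace_val_topology[OF M] by fastforce
  have "generate_topology_on {open_ball L M a \<gamma> | a \<gamma>. a \<in> univ M (home L) \<and> \<gamma> \<in> value_group L M} U"
    using assms(2) unfolding val_topology_def by (rule openin_topology_generated_by)
  then have key: "l \<in> U ==> \<exists>g \<in> K. g ~= \<zero>\<^bsub>home_ring L M\<^esub> \<and> {x \<in> K. ~ vdiv L M (x \<ominus>\<^bsub>home_ring L M\<^esub> l) g} \<subseteq> U"
  proof induction
    case Empty
    then show ?case by simp
  next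
    case (Int a b)
    then obtain g h where g: "g \<in> K" "g ~= \<zero>\<^bsub>home_ring L M\<^esub>" "{x \<in> K. ~ vdiv L M (x \<ominus>\<^bsub>home_ring L M\<^esub> l) g} \<subseteq> a"
      and h: "h \<in> K" "h ~= \<zero>\<^bsub>home_ring L M\<^esub>" "{x \<in> K. ~ vdiv L M (x \<ominus>\<^bsub>home_ring L M\<^esub> l) h} \<subseteq> b" by auto
    obtain c where c: "c \<in> K" "c ~= \<zero>\<^bsub>home_ring L M\<^esub>" "vdiv L M g c" "vdiv L M h c"
      using g(1,2) h(1,2) le_total[OF g(1) h(1)] le_refl[OF g(1)] le_refl[OF h(1)] by blast
    have "~ vdiv L M z g \<and> ~ vdiv L M z h" if "z \<in> K" "~ vdiv L M z c" for z
      using le_trans[of z g c] le_trans[of z h c] that g(1) h(1) c by blast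
    then have "{x \<in> K. ~ vdiv L M (x \<ominus>\<^bsub>home_ring L M\<^esub> l) c} \<subseteq> a \<inter> b"
      using g(3) h(3) minus_closed[OF _ lK] by (simp add: subset_iff)
    then show ?case using c by blast
  next
    case (UN \<K>)
    then obtain k where k: "k \<in> \<K>" "l \<in> k" by blast
    then obtain g where "g \<in> K" "g ~= \<zero>\<^bsub>home_ring L M\<^esub>" "{x \<in> K. ~ vdiv L M (x \<ominus>\<^bsub>home_ring L M\<^esub> l) g} \<subseteq> k"
      using UN.IH by blast
    then show ?case using k by blast
  next
    case (Basis s)
    then obtain a g where a: "a \<in> K" and g: "g \<in> K" "g ~= \<zero>\<^bsub>home_ring L M\<^esub>" and s: "s = open_ball L M a (val L M g)"
      by (auto simp: value_group_def)
    have s': "s = {x \<in> K. ~ vdiv L M (x \<ominus>\<^bsub>home_ring L M\<^esub> a) g}"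
      using s open_ball_val[OF M] a g by simp
    have l: "l \<in> K" "~ vdiv L M (l \<ominus>\<^bsub>home_ring L M\<^esub> a) g" using Basis s' by auto
    have "{x \<in> K. ~ vdiv L M (x \<ominus>\<^bsub>home_ring L M\<^esub> l) g} \<subseteq> s"
      using lt_diff_trans[where y = l and z = a and g = g] l a g unfolding s' by blast
    then show ?case using g by blast
  qed
  from key[OF assms(3)] show ?thesis unfolding home_ring_simps(1) .
qed

lemma eventually_at_zeroI:
  assumes "acvf L M" "c_minimal_field (home_ring L M) (vdiv L M) d"
    and "c_minimal_field.ev (home_ring L M) (vdiv L M) (\<lambda>x. x \<in> S --> P x)"
  shows "eventually P (atin_within (val_topology L M) \<zero>\<^bsub>home_ring L M\<^esub> S)"
proof -
  interpret c_minimal_field "home_ring L M" "vdiv L M" d by (rule assms(2))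
  obtain e where e: "e \<in> K" "e ~= \<zero>\<^bsub>home_ring L M\<^esub>"
    and P: "!!x. x \<in> K ==> x ~= \<zero>\<^bsub>home_ring L M\<^esub> ==> ~ vdiv L M x e ==> x \<in> S ==> P x"
    using assms(3) unfolding ev_def by blast
  let ?T = "{x \<in> K. ~ vdiv L M (x \<ominus>\<^bsub>home_ring L M\<^esub> \<zero>\<^bsub>home_ring L M\<^esub>) e}"
  have "openin (val_topology L M) ?T"
    using openin_open_ball[OF assms(1) zero_closed[unfolded home_ring_simps(1)] e(1)[unfolded home_ring_simps(1)] e(2)]
    unfolding home_ring_simps(1) .
  moreover have "\<zero>\<^bsub>home_ring L M\<^esub> \<in> ?T"
    using zero_le_iff[OF e(1)] e zero_closed diff_self[OF zero_closed] by simp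
  moreover have "P x" if "x \<in> ?T" "x \<in> S" "x ~= \<zero>\<^bsub>home_ring L M\<^esub>" for x
    using P[of x] that diff_zero[of x] by auto
  ultimately show ?thesis unfolding eventually_atin_within by blast
qed

lemma has_limit_at_zeroI:
  assumes "acvf L M" "c_minimal_field (home_ring L M) (vdiv L M) d" and l: "l \<in> univ M (home L)"
    and ev: "!!g. g \<in> univ M (home L) ==> g ~= \<zero>\<^bsub>home_ring L M\<^esub> ==>
      c_minimal_field.ev (home_ring L M) (vdiv L M)
        (\<lambda>x. x \<in> S --> f x \<in> univ M (home L) \<and> ~ vdiv L M (f x \<ominus>\<^bsub>home_ring L M\<^esub> l) g)"
  shows "has_limit_at_zero L M S f l"
  unfolding has_limit_at_zero_def limitin_def topspace_val_topology[OF assms(1)]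
proof (intro conjI allI impI)
  interpret c_minimal_field "home_ring L M" "vdiv L M" d by (rule assms(2))
  fix U assume "openin (val_topology L M) U \<and> l \<in> U"
  then obtain g where g: "g \<in> univ M (home L)" "g ~= \<zero>\<^bsub>home_ring L M\<^esub>"
    "{x \<in> univ M (home L). ~ vdiv L M (x \<ominus>\<^bsub>home_ring L M\<^esub> l) g} \<subseteq> U"
    using openin_val_topologyD[OF assms(1)] by blast
  have "ev (\<lambda>x. x \<in> S --> f x \<in> U)" using ev[OF g(1,2)] by (rule ev_mono) (use g(3) in blast)
  then show "\<forall>\<^sub>F x in atin_within (val_topology L M) \<zero>\<^bsub>home_ring L M\<^esub> S. f x \<in> U"
    by (rule eventually_at_zeroI[OF assms(1,2)])
qed (rule l)

theorem theorem7p3: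
  fixes L :: "('s, 'f, 'r) vf_lang"
    and T :: "('s, 'f, 'r) fm set"
    and M :: "('s, 'f, 'r, 'a) struct"
    and \<kappa> :: "'k rel"
    and t :: 'f
    and B :: "'a set"
    and f :: "'a \<Rightarrow> 'a"
  assumes "is_vf_lang L"
    and "complete_theory L T"
    and "\<And>N :: ('s, 'f, 'r, 'a) struct. is_model L N T \<Longrightarrow> acvf L N"
    and "\<And>N :: ('s, 'f, 'r, 'a) struct. is_model L N T \<Longrightarrow> c_minimal_model L N"
    and "monster_model L \<kappa> T M"
    and "fdom L t = []" and "fcod L t = home L"
    and "val_less L M (val L M \<one>\<^bsub>home_ring L M\<^esub>) (val L M (fint M t []))"
    and "definably_complete L M"
    and "is_ball L M B" and "\<zero>\<^bsub>home_ring L M\<^esub> \<in> B"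
    and "definable_function L M (B - {\<zero>\<^bsub>home_ring L M\<^esub>}) f"
  shows "(\<exists>l \<in> univ M (home L). has_limit_at_zero L M (B - {\<zero>\<^bsub>home_ring L M\<^esub>}) f l) \<or>
         has_limit_infinity_at_zero L M (B - {\<zero>\<^bsub>home_ring L M\<^esub>}) f"
proof -
  have model: "is_model L M T" using assms(5) by (simp add: monster_model_def)
  have M: "acvf L M" "c_minimal_model L M" using assms(3,4) model by blast+
  interpret c_minimal_field "home_ring L M" "vdiv L M" "dp_of L M"
    by (rule c_minimal_model_field[OF assms(1) M])
  define S where "S = B - {\<zero>\<^bsub>home_ring L M\<^esub>}"
  have SK: "S \<subseteq> K" and fS: "!!x. x \<in> S ==> f x \<in> K"
    and graph: "definable L M [home L, home L] {[x, f x] | x. x \<in> S}"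
    using assms(12) by (auto simp: definable_function_def S_def)
  define Gr where "Gr x z \<longleftrightarrow> x \<in> S \<and> z = f x" for x z
  have "{xs \<in> ntuples K 2. Gr (hd xs) (hd (tl xs))} = {[x, f x] | x. x \<in> S}"
    using SK fS by (auto simp: Gr_def length_Suc_conv numeral_2_eq_2)
  then have Grdef: "def2 Gr" using graph unfolding def2_def dp_of_def by (simp add: numeral_2_eq_2)
  note [dfn] = dp_subst2[OF Grdef]
  \<comment> \<open>The abstract lemma wants a total function. Extending by \<open>\<zero>\<close>
    off \<open>S\<close> is harmless, because the conclusions are only read off at points of
    \<open>S\<close>.\<close>
  define F where "F x = (if x \<in> S then f x else \<zero>\<^bsub>home_ring L M\<^esub>)" for x
  have FK: "F x \<in> K" for x using fS zero_closed by (auto simp: F_def)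
  have *: "dp_of L M 2 (\<lambda>xs. Gr (hd (tl xs)) (hd xs) \<or>
      (hd xs = \<zero>\<^bsub>home_ring L M\<^esub> \<and> ~ (\<exists>w \<in> K. Gr (hd (tl xs)) w)))"
    by (intro dfn zero_closed) auto
  have Fdef: "def2 (\<lambda>z x. z = F x)" unfolding def2_def
    by (rule dp_congI[OF *]) (use fS in \<open>auto simp: F_def Gr_def\<close>)
  have "(\<exists>l \<in> K. \<forall>g \<in> K. g ~= \<zero>\<^bsub>home_ring L M\<^esub> --> ev (\<lambda>x. ~ vdiv L M (F x \<ominus>\<^bsub>home_ring L M\<^esub> l) g)) \<or>
      (\<forall>g \<in> K. g ~= \<zero>\<^bsub>home_ring L M\<^esub> --> ev (\<lambda>x. ~ vdiv L M g (F x)))"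
  proof (rule limit_exists[OF Fdef FK])
    fix D assume *: "def2 D"
      "!!a g. a \<in> K ==> g \<in> K ==> D a g ==> g ~= \<zero>\<^bsub>home_ring L M\<^esub>"
      "!!a g a' g'. a \<in> K ==> g \<in> K ==> a' \<in> K ==> g' \<in> K ==> D a g ==> D a' g' ==>
        {x \<in> K. vdiv L M g (x \<ominus>\<^bsub>home_ring L M\<^esub> a)} \<subseteq> {x \<in> K. vdiv L M g' (x \<ominus>\<^bsub>home_ring L M\<^esub> a')} \<or>
        {x \<in> K. vdiv L M g' (x \<ominus>\<^bsub>home_ring L M\<^esub> a')} \<subseteq> {x \<in> K. vdiv L M g (x \<ominus>\<^bsub>home_ring L M\<^esub> a)}"
      "!!h. h \<in> K ==> h ~= \<zero>\<^bsub>home_ring L M\<^esub> ==> \<exists>a \<in> K. \<exists>g \<in> K. D a g \<and> ~ vdiv L M g h"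
    show "\<exists>l \<in> K. \<forall>a \<in> K. \<forall>g \<in> K. D a g --> vdiv L M g (l \<ominus>\<^bsub>home_ring L M\<^esub> a)"
      unfolding home_ring_simps(1)
      by (rule definably_complete_closed_balls[OF assms(1) M assms(9) *(1)])
        (fact *(2-4)[unfolded home_ring_simps(1)])+
  qed
  then show ?thesis
  proof
    assume "\<exists>l \<in> K. \<forall>g \<in> K. g ~= \<zero>\<^bsub>home_ring L M\<^esub> --> ev (\<lambda>x. ~ vdiv L M (F x \<ominus>\<^bsub>home_ring L M\<^esub> l) g)"
    then obtain l where l: "l \<in> K" "!!g. g \<in> K ==> g ~= \<zero>\<^bsub>home_ring L M\<^esub> ==> ev (\<lambda>x. ~ vdiv L M (F x \<ominus>\<^bsub>home_ring L M\<^esub> l) g)"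
      by blast
    have "has_limit_at_zero L M S f l"
    proof (rule has_limit_at_zeroI[OF M(1) c_minimal_field_axioms])
      show "ev (\<lambda>x. x \<in> S --> f x \<in> univ M (home L) \<and> ~ vdiv L M (f x \<ominus>\<^bsub>home_ring L M\<^esub> l) g)"
        if "g \<in> univ M (home L)" "g ~= \<zero>\<^bsub>home_ring L M\<^esub>" for g
        using l(2)[of g] by (rule ev_mono) (use that fS in \<open>auto simp: F_def\<close>)
    qed (use l in auto)
    then show ?thesis using l by (auto simp: S_def)
  next
    assume inf: "\<forall>g \<in> K. g ~= \<zero>\<^bsub>home_ring L M\<^esub> --> ev (\<lambda>x. ~ vdiv L M g (F x))"
    have nz: "ev (\<lambda>x. x \<in> S --> f x ~= \<zero>\<^bsub>home_ring L M\<^esub>)"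
    proof (rule ev_mono[OF inf[rule_format, OF one_closed one_not_zero]])
      fix x assume "~ vdiv L M \<one>\<^bsub>home_ring L M\<^esub> (F x)"
      then show "x \<in> S --> f x ~= \<zero>\<^bsub>home_ring L M\<^esub>" using le_zero[OF one_closed] by (auto simp: F_def)
    qed
    have "has_limit_at_zero L M S (\<lambda>x. inv\<^bsub>home_ring L M\<^esub> (f x)) \<zero>\<^bsub>home_ring L M\<^esub>"
    proof (rule has_limit_at_zeroI[OF M(1) c_minimal_field_axioms])
      fix g assume "g \<in> univ M (home L)" and g0: "g ~= \<zero>\<^bsub>home_ring L M\<^esub>"
      then have g: "g \<in> K" by simp
      \<comment> \<open>Inversion reverses the order: \<open>v(f x)\<close> below
        \<open>v(h)\<close> amounts to \<open>v(1 / f x)\<close> above \<open>v(g)\<close>.\<close>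
      define h where "h = inv\<^bsub>home_ring L M\<^esub> g"
      have h: "h \<in> K" "h ~= \<zero>\<^bsub>home_ring L M\<^esub>" "inv\<^bsub>home_ring L M\<^esub> h = g"
        using g g0 inv_closed inv_cancel(3)[OF g g0] Units_inv_inv[of g] field_Units by (auto simp: h_def)
      show "ev (\<lambda>x. x \<in> S --> inv\<^bsub>home_ring L M\<^esub> (f x) \<in> univ M (home L) \<and>
          ~ vdiv L M (inv\<^bsub>home_ring L M\<^esub> (f x) \<ominus>\<^bsub>home_ring L M\<^esub> \<zero>\<^bsub>home_ring L M\<^esub>) g)"
      proof (rule ev_mono[OF ev_conj[OF nz inf[rule_format, OF h(1,2)]]], intro impI)
        fix x assume "(x \<in> S --> f x ~= \<zero>\<^bsub>home_ring L M\<^esub>) \<and> ~ vdiv L M h (F x)" and x: "x \<in> S"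
        then have fx: "f x \<in> K" "f x ~= \<zero>\<^bsub>home_ring L M\<^esub>" "~ vdiv L M h (f x)" using fS by (auto simp: F_def)
        have "~ vdiv L M (inv\<^bsub>home_ring L M\<^esub> (f x)) g"
          using inv_le_iff[OF fx(1,2) h(1,2)] fx(3) h(3) by simp
        then show "inv\<^bsub>home_ring L M\<^esub> (f x) \<in> univ M (home L) \<and>
          ~ vdiv L M (inv\<^bsub>home_ring L M\<^esub> (f x) \<ominus>\<^bsub>home_ring L M\<^esub> \<zero>\<^bsub>home_ring L M\<^esub>) g"
          using inv_closed[OF fx(1,2)] diff_zero[OF inv_closed[OF fx(1,2)]] by simp
      qed
    qed (use zero_closed in simp)
    then show ?thesis
      using eventually_at_zeroI[OF M(1) c_minimal_field_axioms nz]
      unfolding has_limit_infinity_at_zero_def S_def by blast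
  qed
qed

end
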